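(* Suppose Assumptions 1 and 2 hold. Let $\bar\xi_0\in\Xi_0$, $\bar w_{-1}\in\mathbb R^{n_x}\times\mathbb R^{n_u}$ and $W\ge\bar W$ with $W\in\mathbb Z_{\ge0}$, where $\bar W:=\frac{\log\left((\alpha^{1/2}-\alpha)/(4c_1^2L^3)\right)}{2\log\rho}$ and set $c_2:=\frac{2c_1^2L}{\rho(1-\rho^{3/2})}$. Then the SPC policy satisfies, for all $t\in\mathcal T$, $$\Big\{\mathbb E\big[\|w^{(W)}_t(\boldsymbol\xi_{0:t};\bar w_{-1})\|^2\,\big|\,\xi_0=\bar\xi_0\big]\Big\}^{1/2}\le c_2\Big(2L\rho^{t/2}\|\bar w_{-1}\|+\sum_{t'\in\mathcal T}\rho^{|t-t'|/2}\Big\{\mathbb E\big[\|p(\xi_{t'})\|^2\,\big|\,\xi_0=\bar\xi_0\big]\Big\}^{1/2}\Big).$$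
   Context: Setting. $T\in\mathbb Z_{>0}$, $\mathcal T=\{0,\dots,T\}$, $\mathcal T_{a:b}=\mathcal T\cap\{a,\dots,b\}$ (so $\mathcal T_{a:b}=\mathcal T_{a:T}$ if $b>T$). $\boldsymbol\xi=(\xi_0,\dots,\xi_T)$ is a stochastic process with values in a measurable set $\Xi$ with known distribution; $\boldsymbol\xi_{a:b}=(\xi_a,\dots,\xi_b)$; $\Xi_0$ is the support of $\xi_0$, $\boldsymbol\Xi_{0:t}$ the support of $\boldsymbol\xi_{0:t}$, and for $\tau\le t$, $\boldsymbol\Xi_{0:t}(\bar{\boldsymbol\xi}_{0:\tau})=\{\boldsymbol\zeta_{0:t}\in\boldsymbol\Xi_{0:t}:\boldsymbol\zeta_{0:\tau}=\bar{\boldsymbol\xi}_{0:\tau}\}$. Data: functions $A,B,d,Q,R,q,r$ on $\Xi$ with values in $\mathbb R^{n_x\times n_x},\mathbb R^{n_x\times n_u},\mathbb R^{n_x},\mathbb S_{n_x},\mathbb S_{n_u},\mathbb R^{n_x},\mathbb R^{n_u}$; for $w=[x;u]$: $f(w;\xi)=A(\xi)x+B(\xi)u+d(\xi)$, $\ell(w;\xi)=\tfrac12x^\top Q(\xi)x+\tfrac12u^\top R(\xi)u-q(\xi)^\top x-r(\xi)^\top u$, $p(\xi)=[q(\xi);r(\xi);d(\xi)]$. Truncated problem $\mathrm P_{\tau,W}(\bar{\boldsymbol\xi}_{0:\tau},\bar w_{\tau-1})$: minimize $\mathbb E[\sum_{t\in\mathcal T_{\tau:\tau+W}}\ell(w_t(\boldsymbol\xi_{0:t});\xi_t)\mid\boldsymbol\xi_{0:\tau}=\bar{\boldsymbol\xi}_{0:\tau}]$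 over $w_t=[x_t;u_t]:\boldsymbol\Xi_{0:t}(\bar{\boldsymbol\xi}_{0:\tau})\to\mathbb R^{n_x}\times\mathbb R^{n_u}$ subject to $x_\tau(\bar{\boldsymbol\xi}_{0:\tau})=f(\bar w_{\tau-1};\bar\xi_\tau)$, $x_t(\boldsymbol\zeta_{0:t})=f(w_{t-1}(\boldsymbol\zeta_{0:t-1});\zeta_t)$ for $t\in\mathcal T_{\tau+1:\tau+W}$, $\boldsymbol\zeta_{0:t}\in\boldsymbol\Xi_{0:t}(\bar{\boldsymbol\xi}_{0:\tau})$. Its (unique, under the assumptions) solutions for all $\bar{\boldsymbol\xi}_{0:\tau}\in\boldsymbol\Xi_{0:\tau}(\bar\xi_0)$ are glued into maps $w^{(\tau,W)}_t(\cdot;\bar w_{\tau-1})$ on $\boldsymbol\Xi_{0:t}(\bar\xi_0)$. The SPC policy is defined recursively by $w^{(W)}_{-1}=\bar w_{-1}$ and $w^{(W)}_t(\boldsymbol\xi_{0:t};\bar w_{-1})=w^{(t,W)}_t(\boldsymbol\xi_{0:t};w^{(W)}_{t-1}(\boldsymbol\xi_{0:t-1};\bar w_{-1}))$ for $t\in\mathcal T$. Assumption 1: $\boldsymbol\xi$ has finite support. Stochastic notions: $\{\Phi_t(\boldsymbol\xi_{0:t})\}_{t\in\mathcal T_{1:T}}$ is $(L,\alpha)$-stable if $\|\Phi_{t''}(\boldsymbol\xi_{0:t''})\cdots\Phi_{t'+1}(\boldsymbol\xi_{0:t'+1})\|\le L\alpha^{t''-t'}$ a.s. for all $t'<t''$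 in $\mathcal T$; $(\{A(\xi_t)\},\{B(\xi_t)\})_{t\in\mathcal T_{1:T}}$ is $(L,\alpha)$-stabilizable if there are $K_t(\boldsymbol\xi_{0:t})$, $t\in\mathcal T_{0:T-1}$ (functions of $\boldsymbol\xi_{0:t}$ only), $\|K_t\|\le L$ a.s., with $\{A(\xi_t)-B(\xi_t)K_{t-1}(\boldsymbol\xi_{0:t-1})\}_{t\in\mathcal T_{1:T}}$ $(L,\alpha)$-stable; $(\{A(\xi_t)\}_{t\in\mathcal T_{1:T}},\{C(\xi_t)\}_{t\in\mathcal T_{0:T-1}})$ is $(L,\alpha)$-detectable if there are $K_t(\boldsymbol\xi_{0:t})$, $t\in\mathcal T_{1:T}$, $\|K_t\|\le L$ a.s., with $\{A(\xi_t)-K_t(\boldsymbol\xi_{0:t})C(\xi_{t-1})\}_{t\in\mathcal T_{1:T}}$ $(L,\alpha)$-stable. Assumption 2: there exist $L\ge1$, $\alpha\in(0,1)$, $\gamma\in(0,1]$ with (a) $\|A(\xi_t)\|,\|B(\xi_t)\|,\|Q(\xi_t)\|,\|R(\xi_t)\|\le L$ a.s.; (b) $Q(\xi_t)\succeq0$, $R(\xi_t)\succeq\gamma I$ a.s.; (c) $(\{A(\xi_t)\},\{B(\xi_t)\})$ is $(L,\alpha)$-stabilizable; (d) $(\{A(\xi_t)\}_{t\in\mathcal T_{1:T}},\{Q(\xi_t)^{1/2}\}_{t\in\mathcal T_{0:T-1}})$ is $(L,\alpha)$-detectable. Constants: $L_H=2L+1$, $\gamma_F=\frac{(1-\alpha)^2}{(1+L)^2L^2}$,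 $\gamma_G=\frac{\gamma(1-\alpha)^2}{2(1+L)^2L^4}$, $\bar\mu=\frac{2L_H^2/\gamma_G+\gamma_G+L_H}{\gamma_F}$, $\gamma_H=\Big(\frac2{\gamma_G}+\big(1+\frac{4L_H}{\gamma_G}+\frac{4L_H^2}{\gamma_G^2}\big)\frac{L_H(1+\bar\mu L_H)}{\gamma_F}+\bar\mu\Big)^{-1}$, $\rho=\big(\frac{L_H^2-\gamma_H^2}{L_H^2+\gamma_H^2}\big)^{1/2}$, $c_1=\frac{L_H}{\gamma_H^2\rho}$. *)

theory Defs
  imports "HOL-Analysis.Analysis" "HOL-Probability.Probability_Mass_Function"
begin

text \<open>Trajectories of the process are functions nat => 'a (only indices 0..T matter);
  the law of the process is a pmf on trajectories. The prefix xi_{0:t} is a list.\<close>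

definition pre :: "(nat \<Rightarrow> 'a) \<Rightarrow> nat \<Rightarrow> 'a list" where
  "pre \<zeta> t = map \<zeta> [0..<Suc t]"

definition mnorm :: "real^'n^'m \<Rightarrow> real" where
  "mnorm M = onorm (\<lambda>v. M *v v)"

definition psd :: "real^'n^'n \<Rightarrow> bool" where
  "psd M \<longleftrightarrow> transpose M = M \<and> (\<forall>v. 0 \<le> v \<bullet> (M *v v))"

definition msqrt :: "real^'n^'n \<Rightarrow> real^'n^'n" where
  "msqrt M = (THE S. psd S \<and> S ** S = M)"

definition dyn :: "('a \<Rightarrow> real^'x^'x) \<Rightarrow> ('a \<Rightarrow> real^'u^'x) \<Rightarrow> ('a \<Rightarrow> real^'x)
    \<Rightarrow> ((real^'x) \<times> (real^'u)) \<Rightarrow> 'a \<Rightarrow> real^'x" where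
  "dyn A B d w \<xi> = A \<xi> *v fst w + B \<xi> *v snd w + d \<xi>"

definition stage_cost :: "('a \<Rightarrow> real^'x^'x) \<Rightarrow> ('a \<Rightarrow> real^'u^'u) \<Rightarrow> ('a \<Rightarrow> real^'x)
    \<Rightarrow> ('a \<Rightarrow> real^'u) \<Rightarrow> ((real^'x) \<times> (real^'u)) \<Rightarrow> 'a \<Rightarrow> real" where
  "stage_cost Q R q r w \<xi> =
     (1/2) * (fst w \<bullet> (Q \<xi> *v fst w)) + (1/2) * (snd w \<bullet> (R \<xi> *v snd w))
     - q \<xi> \<bullet> fst w - r \<xi> \<bullet> snd w"

primrec tprod :: "(nat \<Rightarrow> real^'n^'n) \<Rightarrow> nat \<Rightarrow> nat \<Rightarrow> real^'n^'n" where
  "tprod M t' 0 = mat 1"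
| "tprod M t' (Suc n) = (if Suc n \<le> t' then mat 1 else M (Suc n) ** tprod M t' n)"

definition stable :: "(nat \<Rightarrow> 'a) pmf \<Rightarrow> nat \<Rightarrow> real \<Rightarrow> real
    \<Rightarrow> (nat \<Rightarrow> 'a list \<Rightarrow> real^'n^'n) \<Rightarrow> bool" where
  "stable P T L \<alpha> \<Phi> \<longleftrightarrow>
     (\<forall>\<zeta>\<in>set_pmf P. \<forall>t' t''. t' < t'' \<and> t'' \<le> T \<longrightarrow>
        mnorm (tprod (\<lambda>t. \<Phi> t (pre \<zeta> t)) t' t'') \<le> L * \<alpha> ^ (t'' - t'))"

definition stabilizable :: "(nat \<Rightarrow> 'a) pmf \<Rightarrow> nat \<Rightarrow> real \<Rightarrow> real
    \<Rightarrow> ('a \<Rightarrow> real^'x^'x) \<Rightarrow> ('a \<Rightarrow> real^'u^'x) \<Rightarrow> bool" where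
  "stabilizable P T L \<alpha> A B \<longleftrightarrow>
     (\<exists>K :: nat \<Rightarrow> 'a list \<Rightarrow> real^'x^'u.
        (\<forall>\<zeta>\<in>set_pmf P. \<forall>t<T. mnorm (K t (pre \<zeta> t)) \<le> L) \<and>
        stable P T L \<alpha> (\<lambda>t h. A (h ! t) - B (h ! t) ** K (t - 1) (take t h)))"

definition detectable :: "(nat \<Rightarrow> 'a) pmf \<Rightarrow> nat \<Rightarrow> real \<Rightarrow> real
    \<Rightarrow> ('a \<Rightarrow> real^'x^'x) \<Rightarrow> ('a \<Rightarrow> real^'x^'m) \<Rightarrow> bool" where
  "detectable P T L \<alpha> A C \<longleftrightarrow>
     (\<exists>K :: nat \<Rightarrow> 'a list \<Rightarrow> real^'m^'x.
        (\<forall>\<zeta>\<in>set_pmf P. \<forall>t. 1 \<le> t \<and> t \<le> T \<longrightarrow> mnorm (K t (pre \<zeta> t)) \<le> L) \<and>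
        stable P T L \<alpha> (\<lambda>t h. A (h ! t) - K t h ** C (h ! (t - 1))))"

text \<open>Truncated problem P_{tau,W}(h, wbar), h = xibar_{0:tau} (a list of length tau+1).
  A candidate is a policy w :: nat => 'a list => state (w t applied to xi_{0:t}).\<close>

definition trunc_feasible where
  "trunc_feasible P T A B d \<tau> W h wbar (w :: nat \<Rightarrow> 'a list \<Rightarrow> (real^'x) \<times> (real^'u)) \<longleftrightarrow>
     fst (w \<tau> h) = dyn A B d wbar (h ! \<tau>) \<and>
     (\<forall>\<zeta>\<in>set_pmf P. pre \<zeta> \<tau> = h \<longrightarrow>
        (\<forall>t\<in>{Suc \<tau>..min (\<tau> + W) T}.
           fst (w t (pre \<zeta> t)) = dyn A B d (w (t - 1) (pre \<zeta> (t - 1))) (\<zeta> t)))"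

definition trunc_cost where
  "trunc_cost P T Q R q r \<tau> W h (w :: nat \<Rightarrow> 'a list \<Rightarrow> (real^'x) \<times> (real^'u)) =
     measure_pmf.expectation (cond_pmf P {\<zeta>. pre \<zeta> \<tau> = h})
       (\<lambda>\<zeta>. \<Sum>t\<in>{\<tau>..min (\<tau> + W) T}. stage_cost Q R q r (w t (pre \<zeta> t)) (\<zeta> t))"

definition trunc_opt where
  "trunc_opt P T A B d Q R q r \<tau> W h wbar w \<longleftrightarrow>
     trunc_feasible P T A B d \<tau> W h wbar w \<and>
     (\<forall>w'. trunc_feasible P T A B d \<tau> W h wbar w' \<longrightarrow>
        trunc_cost P T Q R q r \<tau> W h w \<le> trunc_cost P T Q R q r \<tau> W h w')"

text \<open>First-stage decision w^{(tau,W)}_tau(xibar_{0:tau}; wbar) of the (unique) solution.\<close>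
definition spc_first where
  "spc_first P T A B d Q R q r \<tau> W h wbar =
     (SOME w. trunc_opt P T A B d Q R q r \<tau> W h wbar w) \<tau> h"

primrec spc :: "(nat \<Rightarrow> 'a) pmf \<Rightarrow> nat \<Rightarrow> ('a \<Rightarrow> real^'x^'x) \<Rightarrow> ('a \<Rightarrow> real^'u^'x)
    \<Rightarrow> ('a \<Rightarrow> real^'x) \<Rightarrow> ('a \<Rightarrow> real^'x^'x) \<Rightarrow> ('a \<Rightarrow> real^'u^'u) \<Rightarrow> ('a \<Rightarrow> real^'x)
    \<Rightarrow> ('a \<Rightarrow> real^'u) \<Rightarrow> nat \<Rightarrow> (real^'x) \<times> (real^'u) \<Rightarrow> nat \<Rightarrow> (nat \<Rightarrow> 'a)
    \<Rightarrow> (real^'x) \<times> (real^'u)" where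
  "spc P T A B d Q R q r W wbar 0 \<zeta> = spc_first P T A B d Q R q r 0 W (pre \<zeta> 0) wbar"
| "spc P T A B d Q R q r W wbar (Suc t) \<zeta> =
     spc_first P T A B d Q R q r (Suc t) W (pre \<zeta> (Suc t)) (spc P T A B d Q R q r W wbar t \<zeta>)"

definition L_H :: "real \<Rightarrow> real" where "L_H L = 2 * L + 1"
definition gamma_F :: "real \<Rightarrow> real \<Rightarrow> real" where
  "gamma_F L \<alpha> = (1 - \<alpha>)^2 / ((1 + L)^2 * L^2)"
definition gamma_G :: "real \<Rightarrow> real \<Rightarrow> real \<Rightarrow> real" where
  "gamma_G L \<alpha> \<gamma> = \<gamma> * (1 - \<alpha>)^2 / (2 * (1 + L)^2 * L^4)"
definition mu_bar :: "real \<Rightarrow> real \<Rightarrow> real \<Rightarrow> real" where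
  "mu_bar L \<alpha> \<gamma> = (2 * (L_H L)^2 / gamma_G L \<alpha> \<gamma> + gamma_G L \<alpha> \<gamma> + L_H L) / gamma_F L \<alpha>"
definition gamma_H :: "real \<Rightarrow> real \<Rightarrow> real \<Rightarrow> real" where
  "gamma_H L \<alpha> \<gamma> = inverse (2 / gamma_G L \<alpha> \<gamma>
     + (1 + 4 * L_H L / gamma_G L \<alpha> \<gamma> + 4 * (L_H L)^2 / (gamma_G L \<alpha> \<gamma>)^2)
       * (L_H L * (1 + mu_bar L \<alpha> \<gamma> * L_H L) / gamma_F L \<alpha>)
     + mu_bar L \<alpha> \<gamma>)"
definition rho_c :: "real \<Rightarrow> real \<Rightarrow> real \<Rightarrow> real" where
  "rho_c L \<alpha> \<gamma> = sqrt (((L_H L)^2 - (gamma_H L \<alpha> \<gamma>)^2) / ((L_H L)^2 + (gamma_H L \<alpha> \<gamma>)^2))"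
definition c1 :: "real \<Rightarrow> real \<Rightarrow> real \<Rightarrow> real" where
  "c1 L \<alpha> \<gamma> = L_H L / ((gamma_H L \<alpha> \<gamma>)^2 * rho_c L \<alpha> \<gamma>)"
definition W_bar :: "real \<Rightarrow> real \<Rightarrow> real \<Rightarrow> real" where
  "W_bar L \<alpha> \<gamma> = ln ((sqrt \<alpha> - \<alpha>) / (4 * (c1 L \<alpha> \<gamma>)^2 * L^3)) / (2 * ln (rho_c L \<alpha> \<gamma>))"
definition c2 :: "real \<Rightarrow> real \<Rightarrow> real \<Rightarrow> real" where
  "c2 L \<alpha> \<gamma> = 2 * (c1 L \<alpha> \<gamma>)^2 * L / (rho_c L \<alpha> \<gamma> * (1 - rho_c L \<alpha> \<gamma> powr (3/2)))"

end

theory Submission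
  imports Defs
begin

text \<open>A solution \<open>z\<close> of a truncated problem
  is characterised by the vanishing of the first variation on all adapted test processes that follow the
  homogeneous dynamics from a zero state. Testing with a stabilized correction of \<open>c\<^sup>2 z\<close>, for weights
  \<open>c\<close> that vary slowly in time, and using detectability to recover the full norm from the running cost
  gives a weighted energy estimate; with \<open>c t' = b ^ \<bar>t - t'\<bar>\<close> it says that the influence of the
  data at time \<open>t'\<close> on \<open>z\<close> at time \<open>t\<close> decays exponentially in both directions.

  The closed loop is telescoped over consecutive predictions: the predictions made at times \<open>s\<close> and
  \<open>s + 1\<close> agree in state at \<open>s + 1\<close> and differ only in the data at \<open>s + W + 1\<close>, so their difference at
  time \<open>t\<close> is of order \<open>b ^ (s + W + 1 - t)\<close> times the size of the old prediction at its horizon, which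
  itself carries a factor \<open>b ^ W\<close>. For \<open>W\<close> beyond the threshold the resulting recursion is a
  contraction. The constants of the theorem leave ample room: the rate \<open>b = \<rho> ^ 3\<close> is admissible, and
  \<open>1 / \<gamma>\<^sub>H\<close> dominates the constant \<open>CC\<close> of the energy estimate.\<close>

section \<open>Linear recursions along a trajectory\<close>

text \<open>Two obstacles shape the estimate. The running cost sees \<open>u\<close> but only
  \<open>Q^(1/2) x\<close>, and multiplying a solution by a weight that varies in time destroys its
  dynamics. The second is harmless only for slow weights: if squared weights change by a relative
  amount of at most \<open>1 / CC\<close> per step, the violation of the dynamics has relative size
  \<open>1 / CC\<close>, up to the data, and \<open>CC\<close> is taken so large that the resulting
  error is absorbed into the left side. Multipliers are avoided altogether; the correction qualifies
  as a test process because the stabilizing gain at each time reads only the prefix.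

  All rates are powers of \<open>\<kappa> = sqrt \<rho>\<close>. Predictions decay like
  \<open>\<kappa> ^ 6\<close>, the claim asks for \<open>\<kappa>\<close> only, and the influence of
  one prediction reaches over at most \<open>W + 1\<close> stages. The surplus leaves a factor
  \<open>\<kappa> ^ (4 * W) = \<rho> ^ (2 * W)\<close> in the recursion, and this is the power whose
  logarithm defines \<open>W_bar\<close>.\<close>

lemma norm_mult_vec_le:
  fixes M :: "real^'n^'m"
  assumes "mnorm M \<le> L"
  shows "norm (M *v v) \<le> L * norm v"
proof -
  have "norm (M *v v) \<le> mnorm M * norm v"
    unfolding mnorm_def by (rule onorm[OF matrix_vector_mul_bounded_linear])
  also have "\<dots> \<le> L * norm v" using assms by (intro mult_right_mono) auto
  finally show ?thesis .
qed

lemma tprod_self [simp]: "tprod M t t = mat 1"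
  by (cases t) auto

lemma tprod_cong:
  assumes "\<And>i. 0 < i \<Longrightarrow> i \<le> t \<Longrightarrow> M i = N i"
  shows "tprod M t' t = tprod N t' t"
  using assms by (induction t) auto

text \<open>Variation of constants. The initial value is entered as \<open>g s\<close>, so that an
  initial state and a disturbance are data of the same kind; all later estimates keep this
  convention.\<close>

lemma linear_recursion_solution:
  fixes M :: "nat \<Rightarrow> real^'n^'n" and f g :: "nat \<Rightarrow> real^'n"
  assumes start: "f s = g s"
    and step: "\<And>t. s \<le> t \<Longrightarrow> t < n \<Longrightarrow> f (Suc t) = M (Suc t) *v f t + g (Suc t)"
    and "s \<le> t" "t \<le> n"
  shows "f t = (\<Sum>t'=s..t. tprod M t' t *v g t')"
  using assms(3,4)
proof (induction t rule: dec_induct)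
  case base
  show ?case using start by simp
next
  case (step t)
  have "f (Suc t) = M (Suc t) *v (\<Sum>t'=s..t. tprod M t' t *v g t') + g (Suc t)"
    using step assms(2) by simp
  also have "M (Suc t) *v (\<Sum>t'=s..t. tprod M t' t *v g t')
      = (\<Sum>t'=s..t. tprod M t' (Suc t) *v g t')"
    unfolding linear_sum[OF matrix_vector_mul_linear]
    by (rule sum.cong) (auto simp: matrix_vector_mul_assoc)
  finally show ?case using step by simp
qed

lemma linear_recursion_bound:
  fixes M :: "nat \<Rightarrow> real^'n^'n" and f g :: "nat \<Rightarrow> real^'n"
  assumes start: "f s = g s"
    and step: "\<And>t. s \<le> t \<Longrightarrow> t < n \<Longrightarrow> f (Suc t) = M (Suc t) *v f t + g (Suc t)"
    and stab: "\<And>t' t. t' < t \<Longrightarrow> t \<le> n \<Longrightarrow> mnorm (tprod M t' t) \<le> L * \<alpha> ^ (t - t')"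
    and "1 \<le> L" "s \<le> t" "t \<le> n"
  shows "norm (f t) \<le> L * (\<Sum>t'=s..t. \<alpha> ^ (t - t') * norm (g t'))"
proof -
  have "norm (f t) \<le> (\<Sum>t'=s..t. norm (tprod M t' t *v g t'))"
    unfolding linear_recursion_solution[OF start step \<open>s \<le> t\<close> \<open>t \<le> n\<close>, simplified]
    by (rule norm_sum)
  also have "\<dots> \<le> (\<Sum>t'=s..t. L * \<alpha> ^ (t - t') * norm (g t'))"
  proof (rule sum_mono)
    fix t' assume t': "t' \<in> {s..t}"
    show "norm (tprod M t' t *v g t') \<le> L * \<alpha> ^ (t - t') * norm (g t')"
    proof (cases "t' = t")
      \<comment> \<open>The stability bound covers \<open>t' < t\<close> only; the diagonal product
        is the identity and is paid for by 1 \<le> L.\<close>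
      case True
      then show ?thesis using \<open>1 \<le> L\<close> mult_right_mono[of 1 L "norm (g t)"] by simp
    next
      case False
      then have "mnorm (tprod M t' t) \<le> L * \<alpha> ^ (t - t')" using t' assms by auto
      then show ?thesis by (rule norm_mult_vec_le)
    qed
  qed
  finally show ?thesis by (simp add: sum_distrib_left mult.assoc)
qed

definition tdist :: "nat \<Rightarrow> nat \<Rightarrow> nat" where
  "tdist t t' = (t - t') + (t' - t)"

text \<open>Injectivity of the exponent is all that the comparison with the full series asks, so one
  bound serves row sums, column sums and sums over prediction stages.\<close>

lemma geometric_sum_le:
  fixes \<beta> :: real
  assumes "0 \<le> \<beta>" "\<beta> < 1" "finite I" "inj_on f I"
  shows "(\<Sum>i\<in>I. \<beta> ^ f i) \<le> 1 / (1 - \<beta>)"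
proof -
  have "(\<Sum>i\<in>I. \<beta> ^ f i) = (\<Sum>j\<in>f ` I. \<beta> ^ j)" using assms(4) by (simp add: sum.reindex)
  also have "\<dots> \<le> (\<Sum>j. \<beta> ^ j)"
    using assms by (intro sum_le_suminf) (auto intro: summable_geometric)
  also have "\<dots> = 1 / (1 - \<beta>)" using assms by (intro suminf_geometric) auto
  finally show ?thesis .
qed

text \<open>Schur test for the kernel \<open>\<beta> ^ (t - t')\<close>, applied to the weighted sequences.\<close>

lemma weighted_convolution_bound:
  fixes f g c :: "nat \<Rightarrow> real"
  assumes f: "\<And>t. s \<le> t \<Longrightarrow> t \<le> n \<Longrightarrow> 0 \<le> f t \<and> f t \<le> L * (\<Sum>t'=s..t. \<alpha> ^ (t - t') * g t')"
    and g: "\<And>t. 0 \<le> g t" and c: "\<And>t. 0 < c t"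
    and ratio: "\<And>t. s \<le> t \<Longrightarrow> t < n \<Longrightarrow> \<alpha> * c (Suc t) \<le> \<beta> * c t"
    and \<beta>: "0 \<le> \<beta>" "\<beta> < 1" and "0 \<le> \<alpha>" "0 \<le> L"
  shows "(\<Sum>t=s..n. (c t * f t)\<^sup>2) \<le> (L / (1 - \<beta>))\<^sup>2 * (\<Sum>t=s..n. (c t * g t)\<^sup>2)"
proof -
  \<comment> \<open>The weight is moved from \<open>t\<close> to \<open>t'\<close>; the
    \<open>t - t'\<close> steps cost a degradation of the kernel from \<alpha> to \<beta>.\<close>
  have w: "\<alpha> ^ (t - t') * c t \<le> \<beta> ^ (t - t') * c t'" if "s \<le> t'" "t' \<le> t" "t \<le> n" for t t'
    using that(2,3)
  proof (induction t rule: dec_induct)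
    case (step t)
    have "\<alpha> ^ (Suc t - t') * c (Suc t) = \<alpha> ^ (t - t') * (\<alpha> * c (Suc t))"
      using step by (simp add: Suc_diff_le)
    also have "\<dots> \<le> \<alpha> ^ (t - t') * (\<beta> * c t)"
      using step that \<open>0 \<le> \<alpha>\<close> by (intro mult_left_mono ratio) auto
    also have "\<dots> = \<beta> * (\<alpha> ^ (t - t') * c t)" by simp
    also have "\<dots> \<le> \<beta> * (\<beta> ^ (t - t') * c t')"
      using step \<beta> by (intro mult_left_mono) auto
    finally show ?case using step by (simp add: Suc_diff_le mult.assoc)
  qed simp
  have sq: "(c t * f t)\<^sup>2 \<le> L\<^sup>2 / (1 - \<beta>) * (\<Sum>t'=s..t. \<beta> ^ (t - t') * (c t' * g t')\<^sup>2)"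
    if t: "s \<le> t" "t \<le> n" for t
  proof -
    have "c t * f t \<le> c t * (L * (\<Sum>t'=s..t. \<alpha> ^ (t - t') * g t'))"
      using f[OF t] c[of t] by (intro mult_left_mono) auto
    also have "\<dots> = L * (\<Sum>t'=s..t. \<alpha> ^ (t - t') * c t * g t')"
      by (simp add: sum_distrib_left ac_simps)
    also have "\<dots> \<le> L * (\<Sum>t'=s..t. \<beta> ^ (t - t') * c t' * g t')"
      using t \<open>0 \<le> L\<close> g by (intro mult_left_mono sum_mono mult_right_mono w) auto
    finally have "(c t * f t)\<^sup>2 \<le> (L * (\<Sum>t'=s..t. \<beta> ^ (t - t') * c t' * g t'))\<^sup>2"
      using f[OF t] c[of t] by (intro power_mono) auto
    \<comment> \<open>The kernel is split into two square roots: one factor gives its row sum, the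
      other keeps the kernel in front of the squared data.\<close>
    also have "\<dots> = L\<^sup>2 * (\<Sum>t'=s..t. sqrt (\<beta> ^ (t - t')) * (sqrt (\<beta> ^ (t - t')) * (c t' * g t')))\<^sup>2"
      using \<beta> by (simp add: power_mult_distrib mult.assoc[symmetric])
    also have "\<dots> \<le> L\<^sup>2 * ((\<Sum>t'=s..t. (sqrt (\<beta> ^ (t - t')))\<^sup>2) *
        (\<Sum>t'=s..t. (sqrt (\<beta> ^ (t - t')) * (c t' * g t'))\<^sup>2))"
      by (intro mult_left_mono Cauchy_Schwarz_ineq_sum) auto
    also have "\<dots> = L\<^sup>2 * ((\<Sum>t'=s..t. \<beta> ^ (t - t')) * (\<Sum>t'=s..t. \<beta> ^ (t - t') * (c t' * g t')\<^sup>2))"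
      using \<beta> by (simp add: power_mult_distrib)
    also have "\<dots> \<le> L\<^sup>2 * (1 / (1 - \<beta>) * (\<Sum>t'=s..t. \<beta> ^ (t - t') * (c t' * g t')\<^sup>2))"
      using \<beta> by (intro mult_left_mono mult_right_mono geometric_sum_le)
        (auto intro!: sum_nonneg inj_onI)
    finally show ?thesis by simp
  qed
  have "(\<Sum>t=s..n. (c t * f t)\<^sup>2)
      \<le> (\<Sum>t=s..n. L\<^sup>2 / (1 - \<beta>) * (\<Sum>t'=s..t. \<beta> ^ (t - t') * (c t' * g t')\<^sup>2))"
    by (intro sum_mono sq) auto
  also have "\<dots> = L\<^sup>2 / (1 - \<beta>) * (\<Sum>t=s..n. \<Sum>t'=s..t. \<beta> ^ (t - t') * (c t' * g t')\<^sup>2)"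
    by (simp add: sum_distrib_left)
  \<comment> \<open>After exchanging the sums, the column sums contribute the second factor
    \<open>1 / (1 - \<beta>)\<close>.\<close>
  also have "(\<Sum>t=s..n. \<Sum>t'=s..t. \<beta> ^ (t - t') * (c t' * g t')\<^sup>2)
      = (\<Sum>t'=s..n. \<Sum>t=t'..n. \<beta> ^ (t - t') * (c t' * g t')\<^sup>2)"
    by (subst sum.Sigma, simp, simp, subst sum.Sigma, simp, simp,
        rule sum.reindex_bij_witness[where i="\<lambda>(a,b). (b,a)" and j="\<lambda>(a,b). (b,a)"]) auto
  also have "L\<^sup>2 / (1 - \<beta>) * \<dots> \<le> L\<^sup>2 / (1 - \<beta>) * (\<Sum>t'=s..n. 1 / (1 - \<beta>) * (c t' * g t')\<^sup>2)"
    unfolding sum_distrib_right[symmetric] using \<beta>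
    by (intro mult_left_mono sum_mono mult_right_mono geometric_sum_le) (auto intro!: inj_onI)
  finally show ?thesis by (simp add: sum_distrib_left power2_eq_square)
qed

section \<open>The pathwise weighted energy estimate\<close>

text \<open>The factor \<open>L / (1 - \<beta>)\<close> of the convolution bound at \<beta> = (1 +
  \<alpha>) / 2, the midpoint between the given decay rate and 1.\<close>

definition kC :: "real \<Rightarrow> real \<Rightarrow> real" where
  "kC L \<alpha> = 2 * L / (1 - \<alpha>)"

text \<open>The price of recovering a solution from its running cost: the state contributes 6 (3 for
  squaring three terms, times 2 for shifting a weight by one step), the control 1.\<close>

definition MC :: "real \<Rightarrow> real \<Rightarrow> real \<Rightarrow> real" where
  "MC L \<alpha> \<gamma> = 7 * (kC L \<alpha>)\<^sup>2 * L\<^sup>2 / \<gamma>"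

text \<open>The 13 closes the absorption argument: 10/169 together with 1/4 stays below 1/2, and the
  data coefficient 2 * 43 stays below 169.\<close>

definition CC :: "real \<Rightarrow> real \<Rightarrow> real \<Rightarrow> real" where
  "CC L \<alpha> \<gamma> = 13 * MC L \<alpha> \<gamma> * L\<^sup>2 * kC L \<alpha>"

lemma young:
  fixes a b \<delta> :: real
  assumes "0 < \<delta>"
  shows "a * b \<le> (\<delta> * a\<^sup>2 + b\<^sup>2 / \<delta>) / 2"
proof -
  have "0 \<le> (\<delta> * a - b)\<^sup>2 / \<delta>" using assms by simp
  also have "\<dots> = \<delta> * a\<^sup>2 + b\<^sup>2 / \<delta> - 2 * (a * b)"
    using assms by (simp add: power2_eq_square field_simps)
  finally show ?thesis by simp
qed

lemma sum_shift_le: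
  fixes F :: "nat \<Rightarrow> real"
  assumes "\<And>t. 0 \<le> F t"
  shows "(\<Sum>t=s..n. if t = s then 0 else F (t - 1)) \<le> (\<Sum>t=s..n. F t)"
proof -
  have "(\<Sum>t=s..n. if t = s then 0 else F (t - 1)) = (\<Sum>t\<in>{s<..n}. F (t - 1))"
    by (rule sum.mono_neutral_cong_right) auto
  also have "\<dots> = (\<Sum>t\<in>{s..<n}. F t)"
    by (rule sum.reindex_bij_witness[where i=Suc and j="\<lambda>t. t - 1"]) auto
  also have "\<dots> \<le> (\<Sum>t=s..n. F t)" using assms by (intro sum_mono2) auto
  finally show ?thesis .
qed

text \<open>At \<open>s\<close> the weight counts as its own predecessor. The defect there is then
  exactly \<open>- (c s)\<^sup>2 d s\<close>, which makes the test state vanish at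
  \<open>s\<close>.\<close>

definition weight_prev :: "(nat \<Rightarrow> real) \<Rightarrow> nat \<Rightarrow> nat \<Rightarrow> real" where
  "weight_prev c s t = (if t = s then (c s)\<^sup>2 else (c (t - 1))\<^sup>2)"

text \<open>The test direction of the energy estimate is \<open>(c\<^sup>2 x + e, c\<^sup>2 u - K e)\<close>, where the correction \<open>e\<close>,
  steered by the stabilizing feedback and driven by \<open>lq_defect\<close>, absorbs the failure of \<open>c\<^sup>2 x\<close> to
  satisfy the homogeneous dynamics with zero initial state.\<close>

definition lq_defect :: "(nat \<Rightarrow> real) \<Rightarrow> nat \<Rightarrow> (nat \<Rightarrow> 'v::real_vector) \<Rightarrow> (nat \<Rightarrow> 'v) \<Rightarrow> nat \<Rightarrow> 'v" where
  "lq_defect c s x d t = - (((c t)\<^sup>2 - weight_prev c s t) *\<^sub>R x t + weight_prev c s t *\<^sub>R d t)"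

definition lq_test_x :: "(nat \<Rightarrow> real) \<Rightarrow> (nat \<Rightarrow> 'v::real_vector) \<Rightarrow> (nat \<Rightarrow> 'v) \<Rightarrow> nat \<Rightarrow> 'v" where
  "lq_test_x c x e t = (c t)\<^sup>2 *\<^sub>R x t + e t"

definition lq_test_u :: "(nat \<Rightarrow> real) \<Rightarrow> (nat \<Rightarrow> real^'x^'u) \<Rightarrow> (nat \<Rightarrow> real^'u) \<Rightarrow> (nat \<Rightarrow> real^'x) \<Rightarrow> nat \<Rightarrow> real^'u" where
  "lq_test_u c K u e t = (c t)\<^sup>2 *\<^sub>R u t - K t *v e t"

text \<open>The derivative of the stage cost at \<open>w\<close> in direction \<open>v\<close> when
  \<open>Q\<close> and \<open>R\<close> are symmetric.\<close>

definition variation :: "real^'x^'x \<Rightarrow> real^'u^'u \<Rightarrow> real^'x \<Rightarrow> real^'u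
    \<Rightarrow> (real^'x) \<times> (real^'u) \<Rightarrow> (real^'x) \<times> (real^'u) \<Rightarrow> real" where
  "variation Q R q r w v = (Q *v fst w) \<bullet> fst v + (R *v snd w) \<bullet> snd v - q \<bullet> fst v - r \<bullet> snd v"

text \<open>One frozen scenario. \<open>Cm\<close> represents the square root of \<open>Q\<close>
  and enters through its quadratic form alone; \<open>stab\<close> and \<open>det\<close> are the
  decay bounds under feedback and under output injection.\<close>

locale lq_path =
  fixes A :: "nat \<Rightarrow> real^'x^'x" and B :: "nat \<Rightarrow> real^'u^'x"
    and Q :: "nat \<Rightarrow> real^'x^'x" and R :: "nat \<Rightarrow> real^'u^'u"
    and K :: "nat \<Rightarrow> real^'x^'u" and Kd :: "nat \<Rightarrow> real^'m^'x" and Cm :: "nat \<Rightarrow> real^'x^'m"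
    and T :: nat and L \<alpha> \<gamma> :: real
  assumes L: "1 \<le> L" and alpha: "0 < \<alpha>" "\<alpha> < 1" and gamma: "0 < \<gamma>" "\<gamma> \<le> 1"
    and B: "t \<le> T \<Longrightarrow> mnorm (B t) \<le> L"
    and Q: "t \<le> T \<Longrightarrow> mnorm (Q t) \<le> L"
    and R: "t \<le> T \<Longrightarrow> mnorm (R t) \<le> L"
    and K: "t \<le> T \<Longrightarrow> mnorm (K t) \<le> L"
    and Kd: "1 \<le> t \<Longrightarrow> t \<le> T \<Longrightarrow> mnorm (Kd t) \<le> L"
    and Cm: "t \<le> T \<Longrightarrow> (norm (Cm t *v x))\<^sup>2 = x \<bullet> (Q t *v x)"
    and R_pos: "t \<le> T \<Longrightarrow> \<gamma> * (norm v)\<^sup>2 \<le> v \<bullet> (R t *v v)"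
    and stab: "t' < t \<Longrightarrow> t \<le> T \<Longrightarrow>
      mnorm (tprod (\<lambda>t. A t - B t ** K (t - 1)) t' t) \<le> L * \<alpha> ^ (t - t')"
    and det: "t' < t \<Longrightarrow> t \<le> T \<Longrightarrow>
      mnorm (tprod (\<lambda>t. A t - Kd t ** Cm (t - 1)) t' t) \<le> L * \<alpha> ^ (t - t')"
begin

abbreviation "k \<equiv> kC L \<alpha>"
abbreviation "M \<equiv> MC L \<alpha> \<gamma>"
abbreviation "C \<equiv> CC L \<alpha> \<gamma>"

lemma k_ge: "2 * L \<le> k" "2 \<le> k" "2 / (1 - \<alpha>) \<le> k"
proof -
  show 1: "2 * L \<le> k" using L alpha by (simp add: kC_def field_simps)
  show "2 \<le> k" using 1 L by simp
  show "2 / (1 - \<alpha>) \<le> k" unfolding kC_def using L alpha by (intro divide_right_mono) auto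
qed

lemma M_ge: "1 \<le> M"
proof -
  have "1 \<le> k\<^sup>2" "1 \<le> L\<^sup>2" using k_ge L by (simp_all add: one_le_power)
  then have "1 * 1 \<le> k\<^sup>2 * L\<^sup>2" by (intro mult_mono) auto
  moreover have "\<gamma> \<le> 1" by (rule gamma)
  ultimately show ?thesis using gamma by (simp add: MC_def field_simps)
qed

lemma C_ge: "k \<le> C" "1 \<le> C"
proof -
  have "1 \<le> L\<^sup>2" using L by (simp add: one_le_power)
  then have "1 * 1 \<le> M * L\<^sup>2" using M_ge by (intro mult_mono) auto
  then have "1 * k \<le> (13 * (M * L\<^sup>2)) * k" using k_ge by (intro mult_right_mono) auto
  then show "k \<le> C" by (simp add: CC_def)
  then show "1 \<le> C" using k_ge by simp
qed

text \<open>\<open>1 / C\<close> is the admissible relative change of a squared weight per step. At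
  this speed a weighted \<alpha>-stable recursion loses at most half of the gap between \<alpha> and
  1, because \<open>C\<close> is at least \<open>2 / (1 - \<alpha>)\<close>.\<close>

lemma eps: "0 < 1 / C" "1 / C \<le> 1" "\<alpha> * (1 + 1 / C) \<le> (1 + \<alpha>) / 2"
proof -
  show "0 < 1 / C" "1 / C \<le> 1" using C_ge by auto
  have "2 / (1 - \<alpha>) \<le> C" using k_ge C_ge by linarith
  then have "2 \<le> C * (1 - \<alpha>)" using alpha by (simp add: field_simps)
  then have "\<alpha> * 2 \<le> 1 * (C * (1 - \<alpha>))" using alpha by (intro mult_mono) auto
  then have "\<alpha> / C \<le> (1 - \<alpha>) / 2" using C_ge by (simp add: field_simps)
  then show "\<alpha> * (1 + 1 / C) \<le> (1 + \<alpha>) / 2" by (simp add: field_simps)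
qed

lemma alpha_ratio:
  assumes "(c'::real)\<^sup>2 \<le> (1 + 1 / C) * c\<^sup>2" "0 < c" "0 < c'"
  shows "\<alpha> * c' \<le> (1 + \<alpha>) / 2 * c"
proof (rule power2_le_imp_le)
  have "(\<alpha> * c')\<^sup>2 \<le> \<alpha>\<^sup>2 * ((1 + 1 / C) * c\<^sup>2)"
    unfolding power_mult_distrib using assms by (intro mult_left_mono) auto
  also have "\<dots> \<le> \<alpha>\<^sup>2 * ((1 + 1 / C)\<^sup>2 * c\<^sup>2)"
    using self_le_power[of "1 + 1 / C" 2] eps by (intro mult_left_mono mult_right_mono) auto
  also have "\<dots> = (\<alpha> * (1 + 1 / C))\<^sup>2 * c\<^sup>2" by (simp add: power_mult_distrib)
  also have "\<dots> \<le> ((1 + \<alpha>) / 2)\<^sup>2 * c\<^sup>2"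
    using eps alpha C_ge by (intro mult_right_mono power_mono) auto
  finally show "(\<alpha> * c')\<^sup>2 \<le> ((1 + \<alpha>) / 2 * c)\<^sup>2" by (simp only: power_mult_distrib)
qed (use assms alpha in auto)

lemma L_beta: "L / (1 - (1 + \<alpha>) / 2) = k"
  using alpha by (simp add: kC_def field_simps)

context
  fixes s n :: nat and x d q :: "nat \<Rightarrow> real^'x" and u r :: "nat \<Rightarrow> real^'u" and c :: "nat \<Rightarrow> real"
  assumes n: "n \<le> T"
    and start: "x s = d s"
    and dynamics: "\<And>t. s \<le> t \<Longrightarrow> t < n \<Longrightarrow> x (Suc t) = A (Suc t) *v x t + B (Suc t) *v u t + d (Suc t)"
    and c_pos: "\<And>t. 0 < c t"
    and c_up: "\<And>t. s \<le> t \<Longrightarrow> t < n \<Longrightarrow> (c (Suc t))\<^sup>2 \<le> (1 + 1 / C) * (c t)\<^sup>2"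
    and c_down: "\<And>t. s \<le> t \<Longrightarrow> t < n \<Longrightarrow> (c t)\<^sup>2 \<le> (1 + 1 / C) * (c (Suc t))\<^sup>2"
begin

definition "energy t = x t \<bullet> (Q t *v x t) + u t \<bullet> (R t *v u t)"

lemma energy_ge:
  assumes "t \<le> T"
  shows "\<gamma> * ((norm (Cm t *v x t))\<^sup>2 + (norm (u t))\<^sup>2) \<le> energy t"
    "(norm (u t))\<^sup>2 \<le> energy t / \<gamma>" "0 \<le> energy t"
proof -
  have 1: "\<gamma> * (norm (Cm t *v x t))\<^sup>2 \<le> 1 * (norm (Cm t *v x t))\<^sup>2"
    using gamma by (intro mult_right_mono) auto
  show 2: "\<gamma> * ((norm (Cm t *v x t))\<^sup>2 + (norm (u t))\<^sup>2) \<le> energy t"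
    using 1 R_pos[OF assms, of "u t"] Cm[OF assms, of "x t"]
    by (simp add: energy_def distrib_left)
  have "\<gamma> * (norm (u t))\<^sup>2 \<le> energy t" 
    using 2 mult_nonneg_nonneg[of \<gamma> "(norm (Cm t *v x t))\<^sup>2"] gamma
    unfolding distrib_left by (smt (verit) zero_le_power2)
  then show "(norm (u t))\<^sup>2 \<le> energy t / \<gamma>" using gamma by (simp add: field_simps)
  show "0 \<le> energy t" using 2 gamma
    by (meson add_nonneg_nonneg less_imp_le mult_nonneg_nonneg order_trans zero_le_power2)
qed

section \<open>Recovering the full norm from the energy\<close>

abbreviation "X2 \<equiv> \<Sum>t=s..n. (c t)\<^sup>2 * ((norm (x t))\<^sup>2 + (norm (u t))\<^sup>2)"
abbreviation "D2 \<equiv> \<Sum>t=s..n. (c t)\<^sup>2 * (norm (d t))\<^sup>2"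
abbreviation "P2 \<equiv> \<Sum>t=s..n. (c t)\<^sup>2 * ((norm (q t))\<^sup>2 + (norm (r t))\<^sup>2)"
abbreviation "N2 \<equiv> \<Sum>t=s..n. (c t)\<^sup>2 * energy t"

text \<open>Output injection: adding and subtracting \<open>Kd C x\<close> turns the dynamics into
  the stable recursion of \<open>det\<close> with input \<open>Kd C x + B u + d\<close>. The first
  two terms are controlled by the energy one step earlier, the last is data.\<close>

lemma observability: "X2 \<le> 3 * k\<^sup>2 * D2 + M * N2"
proof -
  define g where "g t = (if t = s then d s else
      Kd t *v (Cm (t - 1) *v x (t - 1)) + B t *v u (t - 1) + d t)" for t
  \<comment> \<open>The energy is known to be nonnegative up to \<open>T\<close> only; the absolute
    value makes \<open>F\<close> nonnegative at every index, as the shift of the sum asks.\<close>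
  define F where "F t = 6 * (L\<^sup>2 / \<gamma>) * ((c t)\<^sup>2 * \<bar>energy t\<bar>)" for t
  have F0: "0 \<le> F t" for t unfolding F_def using gamma by simp
  have g_le: "(c t * norm (g t))\<^sup>2 \<le> 3 * ((c t)\<^sup>2 * (norm (d t))\<^sup>2) + (if t = s then 0 else F (t - 1))"
    if st: "s \<le> t" "t \<le> n" for t
  proof (cases "t = s")
    case True
    then show ?thesis by (simp add: g_def power_mult_distrib)
  next
    case False
    then obtain i where i: "t = Suc i" "s \<le> i" "i < n" using st by (cases t) auto
    let ?a = "norm (Cm i *v x i)" let ?b = "norm (u i)" let ?d = "norm (d t)"
    have "norm (g t) \<le> norm (Kd t *v (Cm i *v x i)) + norm (B t *v u i) + ?d"
      unfolding g_def using i norm_triangle_ineq by (simp add: norm_triangle_le)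
    also have "\<dots> \<le> L * ?a + L * ?b + ?d"
      using Kd[of t] B[of t] i n by (intro add_mono norm_mult_vec_le) auto
    finally have "(norm (g t))\<^sup>2 \<le> (L * ?a + L * ?b + ?d)\<^sup>2" by (intro power_mono) auto
    also have "\<dots> \<le> 3 * ((L * ?a)\<^sup>2 + (L * ?b)\<^sup>2 + ?d\<^sup>2)"
      using zero_le_power2[of "L * ?a - L * ?b"] zero_le_power2[of "L * ?a - ?d"]
        zero_le_power2[of "L * ?b - ?d"] by (simp add: power2_eq_square algebra_simps)
    also have "\<dots> = 3 * L\<^sup>2 * (?a\<^sup>2 + ?b\<^sup>2) + 3 * ?d\<^sup>2"
      by (simp add: power_mult_distrib distrib_left)
    also have "?a\<^sup>2 + ?b\<^sup>2 \<le> \<bar>energy i\<bar> / \<gamma>"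
      using energy_ge[of i] i n gamma by (simp add: field_simps)
    finally have "(norm (g t))\<^sup>2 \<le> 3 * L\<^sup>2 * (\<bar>energy i\<bar> / \<gamma>) + 3 * ?d\<^sup>2"
      by (simp add: mult_left_mono)
    then have "(c t * norm (g t))\<^sup>2 \<le> (c t)\<^sup>2 * (3 * L\<^sup>2 * (\<bar>energy i\<bar> / \<gamma>) + 3 * ?d\<^sup>2)"
      by (simp add: power_mult_distrib mult_left_mono)
    also have "\<dots> = 3 * ((c t)\<^sup>2 * ?d\<^sup>2) + (c t)\<^sup>2 * (3 * L\<^sup>2 * (\<bar>energy i\<bar> / \<gamma>))"
      by (simp add: algebra_simps)
    also have "(c t)\<^sup>2 * (3 * L\<^sup>2 * (\<bar>energy i\<bar> / \<gamma>)) \<le> (2 * (c i)\<^sup>2) * (3 * L\<^sup>2 * (\<bar>energy i\<bar> / \<gamma>))"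
    proof (rule mult_right_mono)
      have "(c t)\<^sup>2 \<le> (1 + 1 / C) * (c i)\<^sup>2" using c_up[of i] i by simp
      also have "\<dots> \<le> 2 * (c i)\<^sup>2" using eps by (intro mult_right_mono) auto
      finally show "(c t)\<^sup>2 \<le> 2 * (c i)\<^sup>2" .
    qed (use gamma in auto)
    also have "(2 * (c i)\<^sup>2) * (3 * L\<^sup>2 * (\<bar>energy i\<bar> / \<gamma>)) = F i" by (simp add: F_def)
    finally show ?thesis using i by simp
  qed
  have "(\<Sum>t=s..n. (c t * norm (x t))\<^sup>2) \<le> (L / (1 - (1 + \<alpha>) / 2))\<^sup>2 * (\<Sum>t=s..n. (c t * norm (g t))\<^sup>2)"
  proof (rule weighted_convolution_bound[where \<alpha> = \<alpha>])
    fix t assume t: "s \<le> t" "t \<le> n"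
    have "norm (x t) \<le> L * (\<Sum>t'=s..t. \<alpha> ^ (t - t') * norm (g t'))"
    proof (rule linear_recursion_bound[where M = "\<lambda>t. A t - Kd t ** Cm (t - 1)" and n = n])
      show "x s = g s" by (simp add: g_def start)
    next
      fix t assume "s \<le> t" "t < n"
      then show "x (Suc t) = (A (Suc t) - Kd (Suc t) ** Cm (Suc t - 1)) *v x t + g (Suc t)"
        by (simp add: g_def dynamics matrix_vector_mult_diff_rdistrib matrix_vector_mul_assoc)
    qed (use det n L t in auto)
    then show "0 \<le> norm (x t) \<and> norm (x t) \<le> L * (\<Sum>t'=s..t. \<alpha> ^ (t - t') * norm (g t'))" by simp
  next
    fix t assume "s \<le> t" "t < n"
    then show "\<alpha> * c (Suc t) \<le> (1 + \<alpha>) / 2 * c t"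
      using c_up c_pos by (intro alpha_ratio) auto
  qed (use alpha L c_pos in auto)
  also have "\<dots> = k\<^sup>2 * (\<Sum>t=s..n. (c t * norm (g t))\<^sup>2)" by (simp only: L_beta)
  also have "\<dots> \<le> k\<^sup>2 * (\<Sum>t=s..n. 3 * ((c t)\<^sup>2 * (norm (d t))\<^sup>2) + (if t = s then 0 else F (t - 1)))"
    by (intro mult_left_mono sum_mono g_le) auto
  also have "\<dots> \<le> k\<^sup>2 * (3 * D2 + (\<Sum>t=s..n. F t))"
    unfolding sum.distrib sum_distrib_left[symmetric] using sum_shift_le[of F s n, OF F0]
    by (intro mult_left_mono add_left_mono) auto
  also have "(\<Sum>t=s..n. F t) = 6 * (L\<^sup>2 / \<gamma>) * N2"
    unfolding F_def sum_distrib_left[symmetric] using energy_ge n by auto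
  finally have x: "(\<Sum>t=s..n. (c t)\<^sup>2 * (norm (x t))\<^sup>2) \<le> k\<^sup>2 * (3 * D2 + 6 * (L\<^sup>2 / \<gamma>) * N2)"
    by (simp only: power_mult_distrib)
  have N0: "0 \<le> N2" using energy_ge n by (intro sum_nonneg) auto
  have "(\<Sum>t=s..n. (c t)\<^sup>2 * (norm (u t))\<^sup>2) \<le> (\<Sum>t=s..n. (c t)\<^sup>2 * (energy t / \<gamma>))"
    using energy_ge n by (intro sum_mono mult_left_mono) auto
  also have "\<dots> = N2 / \<gamma>" by (simp add: sum_divide_distrib)
  also have "\<dots> \<le> k\<^sup>2 * (L\<^sup>2 / \<gamma>) * N2"
  proof -
    have "1 * 1 \<le> k\<^sup>2 * L\<^sup>2" using k_ge L by (intro mult_mono one_le_power) auto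
    then have "1 * (N2 / \<gamma>) \<le> k\<^sup>2 * L\<^sup>2 * (N2 / \<gamma>)" using N0 gamma by (intro mult_right_mono) auto
    then show ?thesis by simp
  qed
  finally have u: "(\<Sum>t=s..n. (c t)\<^sup>2 * (norm (u t))\<^sup>2) \<le> k\<^sup>2 * (L\<^sup>2 / \<gamma>) * N2" .
  have "X2 = (\<Sum>t=s..n. (c t)\<^sup>2 * (norm (x t))\<^sup>2) + (\<Sum>t=s..n. (c t)\<^sup>2 * (norm (u t))\<^sup>2)"
    by (simp add: distrib_left sum.distrib)
  also have "\<dots> \<le> k\<^sup>2 * (3 * D2 + 6 * (L\<^sup>2 / \<gamma>) * N2) + k\<^sup>2 * (L\<^sup>2 / \<gamma>) * N2"
    using x u by linarith
  also have "\<dots> = 3 * k\<^sup>2 * D2 + M * N2" by (simp add: MC_def field_simps)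
  finally show ?thesis .
qed

section \<open>The stabilized correction and the resulting test direction\<close>

abbreviation "wprev \<equiv> weight_prev c s"
abbreviation "defect \<equiv> lq_defect c s x d"

context
  fixes e :: "nat \<Rightarrow> real^'x"
  assumes e_start: "e s = defect s"
    and e_step: "\<And>t. s \<le> t \<Longrightarrow> t < n \<Longrightarrow>
      e (Suc t) = (A (Suc t) - B (Suc t) ** K t) *v e t + defect (Suc t)"
begin

abbreviation "Z2 \<equiv> \<Sum>t=s..n. (1 / c t * norm (e t))\<^sup>2"

text \<open>The defect has size at most \<open>c\<^sup>2 |x| / C + 2 c\<^sup>2 |d|\<close>, so it is
  naturally measured with the inverse weight \<open>1 / c\<close>, and \<open>c_down\<close> makes
  the reciprocal weights slow enough. The factor \<open>(1 / C)\<^sup>2\<close> at \<open>X2\<close>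
  is the smallness on which the final absorption rests.\<close>

lemma correction_bound: "Z2 \<le> k\<^sup>2 * (2 * (1 / C)\<^sup>2 * X2 + 8 * D2)"
proof -
  have d_le: "(1 / c t * norm (defect t))\<^sup>2 \<le> 2 * (1 / C)\<^sup>2 * ((c t)\<^sup>2 * (norm (x t))\<^sup>2) + 8 * ((c t)\<^sup>2 * (norm (d t))\<^sup>2)"
    if t: "s \<le> t" "t \<le> n" for t
  proof -
    have w: "\<bar>(c t)\<^sup>2 - wprev t\<bar> \<le> (1 / C) * (c t)\<^sup>2 \<and> 0 \<le> wprev t \<and> wprev t \<le> 2 * (c t)\<^sup>2"
    proof (cases "t = s")
      case True
      then show ?thesis using C_ge by (simp add: weight_prev_def)
    next
      case False
      then obtain i where i: "t = Suc i" "s \<le> i" "i < n" using t by (cases t) auto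
      have 1: "(c t)\<^sup>2 - (c i)\<^sup>2 \<le> (1 / C) * (c i)\<^sup>2" using c_up[of i] i by (simp add: algebra_simps)
      have 2: "(c i)\<^sup>2 - (c t)\<^sup>2 \<le> (1 / C) * (c t)\<^sup>2" using c_down[of i] i by (simp add: algebra_simps)
      \<comment> \<open>\<open>c_up\<close> compares with the older weight
        \<open>(c i)\<^sup>2\<close>. If the weight has grown, this is at most
        \<open>(c t)\<^sup>2\<close>; otherwise the left side is negative.\<close>
      have 3: "(c t)\<^sup>2 - (c i)\<^sup>2 \<le> (1 / C) * (c t)\<^sup>2"
      proof (cases "(c i)\<^sup>2 \<le> (c t)\<^sup>2")
        case True
        then have "(1 / C) * (c i)\<^sup>2 \<le> (1 / C) * (c t)\<^sup>2" using eps by (intro mult_left_mono) auto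
        then show ?thesis using 1 by linarith
      next
        case False
        moreover have "0 \<le> (1 / C) * (c t)\<^sup>2" using eps by (intro mult_nonneg_nonneg) auto
        ultimately show ?thesis by linarith
      qed
      have "(1 / C) * (c t)\<^sup>2 \<le> 1 * (c t)\<^sup>2" using eps by (intro mult_right_mono) auto
      then show ?thesis using 2 3 i by (auto simp: weight_prev_def abs_le_iff)
    qed
    have "norm (defect t) \<le> \<bar>(c t)\<^sup>2 - wprev t\<bar> * norm (x t) + wprev t * norm (d t)"
      unfolding lq_defect_def norm_minus_cancel using w norm_triangle_ineq
      by (metis abs_of_nonneg norm_scaleR)
    also have "\<dots> \<le> ((1 / C) * (c t)\<^sup>2) * norm (x t) + (2 * (c t)\<^sup>2) * norm (d t)"
      using w by (intro add_mono mult_right_mono) auto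
    finally have "1 / c t * norm (defect t) \<le> 1 / c t * (((1 / C) * (c t)\<^sup>2) * norm (x t) + (2 * (c t)\<^sup>2) * norm (d t))"
      using c_pos[of t] by (intro mult_left_mono) auto
    also have "\<dots> = (1 / C) * (c t * norm (x t)) + 2 * (c t * norm (d t))"
      using c_pos[of t] by (simp add: power2_eq_square field_simps)
    finally have "(1 / c t * norm (defect t))\<^sup>2 \<le> ((1 / C) * (c t * norm (x t)) + 2 * (c t * norm (d t)))\<^sup>2"
      using c_pos[of t] by (intro power_mono) auto
    also have "\<dots> \<le> 2 * ((1 / C) * (c t * norm (x t)))\<^sup>2 + 2 * (2 * (c t * norm (d t)))\<^sup>2"
      using zero_le_power2[of "(1 / C) * (c t * norm (x t)) - 2 * (c t * norm (d t))"]
      by (simp add: power2_sum power2_diff)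
    finally show ?thesis by (simp add: power_mult_distrib power_divide)
  qed
  have "Z2 \<le> (L / (1 - (1 + \<alpha>) / 2))\<^sup>2 * (\<Sum>t=s..n. (1 / c t * norm (defect t))\<^sup>2)"
  proof (rule weighted_convolution_bound[where \<alpha> = \<alpha>])
    fix t assume t: "s \<le> t" "t \<le> n"
    have "norm (e t) \<le> L * (\<Sum>t'=s..t. \<alpha> ^ (t - t') * norm (defect t'))"
    proof (rule linear_recursion_bound[where M = "\<lambda>t. A t - B t ** K (t - 1)" and n = n])
      fix t assume "s \<le> t" "t < n"
      then show "e (Suc t) = (A (Suc t) - B (Suc t) ** K (Suc t - 1)) *v e t + defect (Suc t)"
        by (simp add: e_step)
    qed (use stab n L t e_start in auto)
    then show "0 \<le> norm (e t) \<and> norm (e t) \<le> L * (\<Sum>t'=s..t. \<alpha> ^ (t - t') * norm (defect t'))" by simp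
  next
    fix t assume t: "s \<le> t" "t < n"
    have "\<alpha> * c t \<le> (1 + \<alpha>) / 2 * c (Suc t)"
      using c_down t c_pos by (intro alpha_ratio) auto
    then show "\<alpha> * (1 / c (Suc t)) \<le> (1 + \<alpha>) / 2 * (1 / c t)"
      using c_pos[of t] c_pos[of "Suc t"] by (simp add: field_simps)
  qed (use alpha L c_pos in auto)
  also have "\<dots> = k\<^sup>2 * (\<Sum>t=s..n. (1 / c t * norm (defect t))\<^sup>2)" by (simp only: L_beta)
  also have "\<dots> \<le> k\<^sup>2 * (\<Sum>t=s..n. 2 * (1 / C)\<^sup>2 * ((c t)\<^sup>2 * (norm (x t))\<^sup>2) + 8 * ((c t)\<^sup>2 * (norm (d t))\<^sup>2))"
    by (intro mult_left_mono sum_mono d_le) auto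
  also have "\<dots> = k\<^sup>2 * (2 * (1 / C)\<^sup>2 * (\<Sum>t=s..n. (c t)\<^sup>2 * (norm (x t))\<^sup>2) + 8 * D2)"
    by (simp only: sum.distrib sum_distrib_left)
  also have "\<dots> \<le> k\<^sup>2 * (2 * (1 / C)\<^sup>2 * X2 + 8 * D2)"
    by (intro mult_left_mono add_right_mono sum_mono) auto
  finally show ?thesis .
qed

abbreviation "test_x \<equiv> lq_test_x c x e"
abbreviation "test_u \<equiv> lq_test_u c K u e"
abbreviation "lin t \<equiv> variation (Q t) (R t) (q t) (r t) (x t, u t) (test_x t, test_u t)"

lemma test_start: "test_x s = 0"
  by (simp add: lq_test_x_def e_start lq_defect_def weight_prev_def start)

text \<open>With varying weights \<open>c\<^sup>2 x\<close> misses the homogeneous dynamics at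
  \<open>Suc t\<close> by \<open>((c (Suc t))\<^sup>2 - (c t)\<^sup>2) x + (c t)\<^sup>2 d\<close>;
  the forcing of \<open>e\<close> is the negative of this, and the control \<open>- K e\<close> puts
  \<open>e\<close> in closed loop.\<close>

lemma test_step:
  assumes "s \<le> t" "t < n"
  shows "test_x (Suc t) = A (Suc t) *v test_x t + B (Suc t) *v test_u t"
proof -
  have "e (Suc t) = A (Suc t) *v e t - B (Suc t) *v (K t *v e t)
      - (((c (Suc t))\<^sup>2 - (c t)\<^sup>2) *\<^sub>R x (Suc t) + (c t)\<^sup>2 *\<^sub>R d (Suc t))"
    using assms by (simp add: e_step lq_defect_def weight_prev_def matrix_vector_mult_diff_rdistrib matrix_vector_mul_assoc)
  moreover have "d (Suc t) = x (Suc t) - (A (Suc t) *v x t + B (Suc t) *v u t)"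
    using dynamics[OF assms] by simp
  ultimately show ?thesis
    by (simp add: lq_test_x_def lq_test_u_def matrix_vector_right_distrib
        matrix_vector_mult_diff_distrib matrix_vector_mult_scaleR algebra_simps)
qed

text \<open>The direction \<open>c\<^sup>2 (x, u)\<close> alone would give the weighted energy and
  the linear cost terms. The remaining terms pair the solution or the data with \<open>e\<close>;
  writing such a product with factors weighted by \<open>c\<close> and \<open>1 / c\<close> before
  Young's inequality produces the weights of \<open>X2\<close>, \<open>P2\<close> and
  \<open>Z2\<close>.\<close>

lemma energy_bound_pointwise:
  assumes t: "t \<le> T" and \<delta>: "0 < \<delta>" "0 < \<delta>'"
  shows "(c t)\<^sup>2 * energy t \<le> lin t
     + (L\<^sup>2 * \<delta> / 2 + \<delta>' / 2) * ((c t)\<^sup>2 * ((norm (x t))\<^sup>2 + (norm (u t))\<^sup>2))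
     + (L\<^sup>2 / \<delta> + L) * (1 / c t * norm (e t))\<^sup>2
     + (1 / (2 * \<delta>') + L / 2) * ((c t)\<^sup>2 * ((norm (q t))\<^sup>2 + (norm (r t))\<^sup>2))"
proof -
  define a where "a = c t * norm (x t)"
  define b where "b = c t * norm (u t)"
  define z where "z = 1 / c t * norm (e t)"
  define p where "p = c t * norm (q t)"
  define p' where "p' = c t * norm (r t)"
  note cp = c_pos[of t]
  have LL: "L \<le> L\<^sup>2" using L by (simp add: power2_eq_square)
  have Ke: "norm (K t *v e t) \<le> L * norm (e t)" by (rule norm_mult_vec_le[OF K[OF t]])
  have 1: "- ((Q t *v x t) \<bullet> e t) \<le> L\<^sup>2 * ((\<delta> * a\<^sup>2 + z\<^sup>2 / \<delta>) / 2)"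
  proof -
    have "- ((Q t *v x t) \<bullet> e t) \<le> norm (Q t *v x t) * norm (e t)"
      by (metis norm_cauchy_schwarz inner_minus_left norm_minus_cancel)
    also have "\<dots> \<le> (L * norm (x t)) * norm (e t)"
      by (intro mult_right_mono norm_mult_vec_le Q t) auto
    also have "\<dots> = L * (a * z)" using cp by (simp add: a_def z_def)
    also have "\<dots> \<le> L\<^sup>2 * (a * z)" using LL cp by (intro mult_right_mono) (auto simp: a_def z_def)
    also have "\<dots> \<le> L\<^sup>2 * ((\<delta> * a\<^sup>2 + z\<^sup>2 / \<delta>) / 2)" by (intro mult_left_mono young \<delta>) auto
    finally show ?thesis .
  qed
  have 2: "(R t *v u t) \<bullet> (K t *v e t) \<le> L\<^sup>2 * ((\<delta> * b\<^sup>2 + z\<^sup>2 / \<delta>) / 2)"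
  proof -
    have "(R t *v u t) \<bullet> (K t *v e t) \<le> norm (R t *v u t) * norm (K t *v e t)"
      by (rule norm_cauchy_schwarz)
    also have "\<dots> \<le> (L * norm (u t)) * (L * norm (e t))"
      using L by (intro mult_mono norm_mult_vec_le R Ke t) auto
    also have "\<dots> = L\<^sup>2 * (b * z)" using cp by (simp add: b_def z_def power2_eq_square)
    also have "\<dots> \<le> L\<^sup>2 * ((\<delta> * b\<^sup>2 + z\<^sup>2 / \<delta>) / 2)" by (intro mult_left_mono young \<delta>) auto
    finally show ?thesis .
  qed
  have 3: "(c t)\<^sup>2 * (q t \<bullet> x t) \<le> (\<delta>' * a\<^sup>2 + p\<^sup>2 / \<delta>') / 2"
  proof -
    have "(c t)\<^sup>2 * (q t \<bullet> x t) \<le> (c t)\<^sup>2 * (norm (q t) * norm (x t))"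
      by (intro mult_left_mono norm_cauchy_schwarz) auto
    also have "\<dots> = a * p" by (simp add: a_def p_def power2_eq_square)
    also have "\<dots> \<le> (\<delta>' * a\<^sup>2 + p\<^sup>2 / \<delta>') / 2" by (rule young[OF \<delta>(2)])
    finally show ?thesis .
  qed
  have 4: "(c t)\<^sup>2 * (r t \<bullet> u t) \<le> (\<delta>' * b\<^sup>2 + p'\<^sup>2 / \<delta>') / 2"
  proof -
    have "(c t)\<^sup>2 * (r t \<bullet> u t) \<le> (c t)\<^sup>2 * (norm (r t) * norm (u t))"
      by (intro mult_left_mono norm_cauchy_schwarz) auto
    also have "\<dots> = b * p'" by (simp add: b_def p'_def power2_eq_square)
    also have "\<dots> \<le> (\<delta>' * b\<^sup>2 + p'\<^sup>2 / \<delta>') / 2" by (rule young[OF \<delta>(2)])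
    finally show ?thesis .
  qed
  have 5: "q t \<bullet> e t \<le> L * ((p\<^sup>2 + z\<^sup>2) / 2)"
  proof -
    have "q t \<bullet> e t \<le> norm (q t) * norm (e t)" by (rule norm_cauchy_schwarz)
    also have "\<dots> = p * z" using cp by (simp add: p_def z_def)
    also have "\<dots> \<le> (p\<^sup>2 + z\<^sup>2) / 2" using young[of 1 p z] by simp
    also have "\<dots> \<le> L * ((p\<^sup>2 + z\<^sup>2) / 2)" using mult_right_mono[OF L, of "(p\<^sup>2 + z\<^sup>2) / 2"] by simp
    finally show ?thesis .
  qed
  have 6: "- (r t \<bullet> (K t *v e t)) \<le> L * ((p'\<^sup>2 + z\<^sup>2) / 2)"
  proof -
    have "- (r t \<bullet> (K t *v e t)) \<le> norm (r t) * norm (K t *v e t)"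
      by (metis norm_cauchy_schwarz inner_minus_left norm_minus_cancel)
    also have "\<dots> \<le> norm (r t) * (L * norm (e t))" by (intro mult_left_mono Ke) auto
    also have "\<dots> = L * (p' * z)" using cp by (simp add: p'_def z_def)
    also have "\<dots> \<le> L * ((p'\<^sup>2 + z\<^sup>2) / 2)" using young[of 1 p' z] L by (intro mult_left_mono) auto
    finally show ?thesis .
  qed
  have "(c t)\<^sup>2 * energy t = lin t + (- ((Q t *v x t) \<bullet> e t)) + (R t *v u t) \<bullet> (K t *v e t)
      + (c t)\<^sup>2 * (q t \<bullet> x t) + (c t)\<^sup>2 * (r t \<bullet> u t) + q t \<bullet> e t + (- (r t \<bullet> (K t *v e t)))"
    by (simp add: energy_def variation_def lq_test_x_def lq_test_u_def inner_add_right inner_diff_right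
        distrib_left inner_commute[of _ "Q t *v x t"] inner_commute[of _ "R t *v u t"])
  also have "\<dots> \<le> lin t + L\<^sup>2 * ((\<delta> * a\<^sup>2 + z\<^sup>2 / \<delta>) / 2) + L\<^sup>2 * ((\<delta> * b\<^sup>2 + z\<^sup>2 / \<delta>) / 2)
      + (\<delta>' * a\<^sup>2 + p\<^sup>2 / \<delta>') / 2 + (\<delta>' * b\<^sup>2 + p'\<^sup>2 / \<delta>') / 2
      + L * ((p\<^sup>2 + z\<^sup>2) / 2) + L * ((p'\<^sup>2 + z\<^sup>2) / 2)"
    using 1 2 3 4 5 6 by (intro add_mono order_refl)
  also have "\<dots> = lin t + (L\<^sup>2 * \<delta> / 2 + \<delta>' / 2) * (a\<^sup>2 + b\<^sup>2) + (L\<^sup>2 / \<delta> + L) * z\<^sup>2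
      + (1 / (2 * \<delta>') + L / 2) * (p\<^sup>2 + p'\<^sup>2)"
    using \<delta> by (simp add: field_simps)
  also have "a\<^sup>2 + b\<^sup>2 = (c t)\<^sup>2 * ((norm (x t))\<^sup>2 + (norm (u t))\<^sup>2)"
    by (simp add: a_def b_def power_mult_distrib distrib_left)
  also have "p\<^sup>2 + p'\<^sup>2 = (c t)\<^sup>2 * ((norm (q t))\<^sup>2 + (norm (r t))\<^sup>2)"
    by (simp add: p_def p'_def power_mult_distrib distrib_left)
  finally show ?thesis by (simp only: z_def)
qed

text \<open>\<open>observability\<close> bounds \<open>X2\<close> by the energy, and the energy is
  bounded by a small multiple of \<open>X2\<close> plus data. The coefficient of \<open>X2\<close>
  on the right comes to 1/4 + 10/169 and is absorbed. The variation is carried along, since it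
  vanishes only after averaging over scenarios.\<close>

theorem weighted_estimate: "X2 \<le> C\<^sup>2 * (D2 + P2) + 2 * M * (\<Sum>t=s..n. lin t)"
proof -
  \<comment> \<open>Both Young parameters are tuned so that, after multiplication by
    \<open>M\<close>, each contributes 1/8 of \<open>X2\<close>.\<close>
  define \<delta> where "\<delta> = 1 / (4 * M * L\<^sup>2)"
  define \<delta>' where "\<delta>' = 1 / (4 * M)"
  let ?S = "\<Sum>t=s..n. lin t"
  have M1: "1 \<le> M" by (rule M_ge)
  have L2: "1 \<le> L\<^sup>2" using L by (simp add: one_le_power)
  have k2: "1 \<le> k\<^sup>2" using k_ge by (simp add: one_le_power)
  have pos: "0 < \<delta>" "0 < \<delta>'" using M1 L by (auto simp: \<delta>_def \<delta>'_def)
  have nn: "0 \<le> X2" "0 \<le> D2" "0 \<le> P2" by (auto intro!: sum_nonneg)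
  have N: "N2 \<le> ?S + (L\<^sup>2 * \<delta> / 2 + \<delta>' / 2) * X2 + (L\<^sup>2 / \<delta> + L) * Z2 + (1 / (2 * \<delta>') + L / 2) * P2"
    unfolding sum_distrib_left sum.distrib[symmetric]
    using n by (intro sum_mono energy_bound_pointwise pos) auto
  have split: "M * (S + a * x2 + b * z2 + c' * p2) = M * S + (M * a) * x2 + (M * b) * z2 + (M * c') * p2"
    for S a b c' x2 z2 p2 by (simp add: distrib_left)
  have "M * N2 \<le> M * (?S + (L\<^sup>2 * \<delta> / 2 + \<delta>' / 2) * X2 + (L\<^sup>2 / \<delta> + L) * Z2 + (1 / (2 * \<delta>') + L / 2) * P2)"
    using N M1 by (intro mult_left_mono) auto
  also have "\<dots> = M * ?S + (M * (L\<^sup>2 * \<delta> / 2 + \<delta>' / 2)) * X2 + (M * (L\<^sup>2 / \<delta> + L)) * Z2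
      + (M * (1 / (2 * \<delta>') + L / 2)) * P2"
    by (rule split)
  also have "M * (L\<^sup>2 * \<delta> / 2 + \<delta>' / 2) = 1 / 4"
    using M1 L by (simp add: \<delta>_def \<delta>'_def field_simps)
  also have "M * (L\<^sup>2 / \<delta> + L) * Z2 \<le> (5 * (M * L\<^sup>2)\<^sup>2) * (k\<^sup>2 * (2 * (1 / C)\<^sup>2 * X2 + 8 * D2))"
  proof (rule mult_mono[OF _ correction_bound])
    \<comment> \<open>\<open>L\<^sup>2 / \<delta>\<close> accounts for four of the five units of
      \<open>(M * L\<^sup>2)\<^sup>2\<close>, a crude bound of \<open>L\<close> for the
      fifth.\<close>
    have "L \<le> L\<^sup>2 * L\<^sup>2" using L L2 by (smt (verit) mult_le_cancel_left1 power2_eq_square)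
    also have "\<dots> \<le> M * (L\<^sup>2 * L\<^sup>2)" using M1 mult_right_mono[of 1 M "L\<^sup>2 * L\<^sup>2"] by simp
    finally have "M * (L\<^sup>2 / \<delta> + L) \<le> M * (L\<^sup>2 / \<delta> + M * (L\<^sup>2 * L\<^sup>2))"
      using M1 by (intro mult_left_mono add_left_mono) auto
    also have "\<dots> = 5 * (M * L\<^sup>2)\<^sup>2"
      by (simp add: \<delta>_def power2_eq_square algebra_simps)
    finally show "M * (L\<^sup>2 / \<delta> + L) \<le> 5 * (M * L\<^sup>2)\<^sup>2" .
  qed (auto intro!: sum_nonneg)
  also have "(5 * (M * L\<^sup>2)\<^sup>2) * (k\<^sup>2 * (2 * (1 / C)\<^sup>2 * X2 + 8 * D2)) =
      10 * ((M * L\<^sup>2 * k)\<^sup>2 * (1 / C)\<^sup>2) * X2 + 40 * (M * L\<^sup>2 * k)\<^sup>2 * D2"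
    by (simp only: power_mult_distrib) algebra
  also have "(M * L\<^sup>2 * k)\<^sup>2 * (1 / C)\<^sup>2 = 1 / 169"
    using M1 L k_ge by (simp add: CC_def power_mult_distrib field_simps)
  also have "M * (1 / (2 * \<delta>') + L / 2) * P2 \<le> (3 * (M * L\<^sup>2 * k)\<^sup>2) * P2"
  proof (rule mult_right_mono)
    have LM: "L \<le> L\<^sup>2 * M"
      using L M1 by (smt (verit) mult_le_cancel_left1 power2_eq_square)
    have "M * (1 / (2 * \<delta>') + L / 2) = 2 * M\<^sup>2 + M * (L / 2)"
      using M1 by (simp add: \<delta>'_def power2_eq_square algebra_simps)
    also have "\<dots> \<le> 2 * M\<^sup>2 * L\<^sup>2 + M * (L\<^sup>2 * M)"
      using M1 L2 LM L mult_left_mono[OF L2, of "2 * M\<^sup>2"]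
      by (intro add_mono mult_left_mono) auto
    also have "\<dots> = 3 * (M\<^sup>2 * L\<^sup>2)" by (simp add: power2_eq_square)
    also have "\<dots> \<le> 3 * ((M\<^sup>2 * L\<^sup>2) * (L\<^sup>2 * k\<^sup>2))"
      using mult_mono[OF L2 k2] mult_left_mono[of 1 "L\<^sup>2 * k\<^sup>2" "M\<^sup>2 * L\<^sup>2"] by simp
    also have "\<dots> = 3 * (M * L\<^sup>2 * k)\<^sup>2" by (simp add: power_mult_distrib power2_eq_square)
    finally show "M * (1 / (2 * \<delta>') + L / 2) \<le> 3 * (M * L\<^sup>2 * k)\<^sup>2" .
  qed (use nn in auto)
  finally have MN: "M * N2 \<le> M * ?S + X2 / 4 + 10 / 169 * X2 + 40 * (M * L\<^sup>2 * k)\<^sup>2 * D2 + 3 * (M * L\<^sup>2 * k)\<^sup>2 * P2"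
    by simp
  have k3: "3 * k\<^sup>2 * D2 \<le> 3 * (M * L\<^sup>2 * k)\<^sup>2 * D2"
  proof -
    have "1 \<le> (M * L\<^sup>2)\<^sup>2" using M1 L2 by (smt (verit) mult_le_cancel_left1 one_le_power)
    then have "1 * (k\<^sup>2 * D2) \<le> (M * L\<^sup>2)\<^sup>2 * (k\<^sup>2 * D2)"
      using nn by (intro mult_right_mono) auto
    then show ?thesis by (simp add: power_mult_distrib)
  qed
  define Y where "Y = (M * L\<^sup>2 * k)\<^sup>2"
  have Y: "0 \<le> Y" "C\<^sup>2 = 169 * Y" by (auto simp: Y_def CC_def power_mult_distrib)
  have YD: "0 \<le> Y * D2" "0 \<le> Y * P2" using nn Y by auto
  have "X2 / 2 \<le> 43 * (Y * D2) + 3 * (Y * P2) + M * ?S"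
    using observability MN k3 nn unfolding Y_def[symmetric] by (simp add: mult.assoc)
  then have "X2 \<le> 169 * (Y * D2) + 169 * (Y * P2) + 2 * (M * ?S)" using YD by simp
  then show ?thesis by (simp only: Y distrib_left mult.assoc)
qed

end
end
end

section \<open>The square root of a positive semidefinite matrix\<close>

lemma blinfun_eq_iff: "f = g \<longleftrightarrow> (\<forall>v. blinfun_apply f v = blinfun_apply g v)"
  by (auto intro: blinfun_eqI)

text \<open>The iteration \<open>Y \<mapsto> (X + Y\<^sup>2) / 2\<close> converges to a solution of \<open>(1 - Y)\<^sup>2 = 1 - X\<close>; its increments
  are dominated in norm by those of its scalar instance \<open>X = 1\<close>, which is monotone and bounded by 1.\<close>

primrec sqrt_iter_scalar :: "nat \<Rightarrow> real" where
  "sqrt_iter_scalar 0 = 0"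
| "sqrt_iter_scalar (Suc n) = (1 + (sqrt_iter_scalar n)\<^sup>2) / 2"

primrec sqrt_iter :: "'v \<Rightarrow>\<^sub>L 'v \<Rightarrow> nat \<Rightarrow> 'v::real_normed_vector \<Rightarrow>\<^sub>L 'v" where
  "sqrt_iter X 0 = 0"
| "sqrt_iter X (Suc n) = (1/2) *\<^sub>R (X + (sqrt_iter X n o\<^sub>L sqrt_iter X n))"

lemma sqrt_iter_scalar_bounds: "0 \<le> sqrt_iter_scalar n \<and> sqrt_iter_scalar n \<le> 1"
proof (induction n)
  case (Suc n)
  then have "(sqrt_iter_scalar n)\<^sup>2 \<le> 1" by (simp add: power_le_one)
  then show ?case by simp
qed simp

lemma sqrt_iter_scalar_step: "sqrt_iter_scalar n \<le> sqrt_iter_scalar (Suc n)"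
  using zero_le_power2[of "1 - sqrt_iter_scalar n"] by (simp add: power2_diff)

lemma sqrt_iter_norm:
  assumes "norm X \<le> 1"
  shows "norm (sqrt_iter X n) \<le> sqrt_iter_scalar n"
proof (induction n)
  case (Suc n)
  have "norm (X + (sqrt_iter X n o\<^sub>L sqrt_iter X n)) \<le> norm X + norm (sqrt_iter X n) * norm (sqrt_iter X n)"
    by (rule norm_triangle_mono[OF order_refl norm_blinfun_compose])
  also have "\<dots> \<le> 1 + (sqrt_iter_scalar n)\<^sup>2"
    unfolding power2_eq_square using Suc assms by (intro add_mono mult_mono) (auto intro: order_trans[OF norm_ge_zero])
  finally show ?case by simp
qed simp

lemma sqrt_iter_norm_step:
  assumes "norm X \<le> 1"
  shows "norm (sqrt_iter X (Suc n) - sqrt_iter X n) \<le> sqrt_iter_scalar (Suc n) - sqrt_iter_scalar n"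
proof (induction n)
  case 0
  then show ?case using assms by simp
next
  case (Suc n)
  let ?Y = "sqrt_iter X n" and ?Z = "sqrt_iter X (Suc n)"
  let ?y = "sqrt_iter_scalar n" and ?z = "sqrt_iter_scalar (Suc n)"
  have "sqrt_iter X (Suc (Suc n)) - ?Z = (1/2) *\<^sub>R ((X + (?Z o\<^sub>L ?Z)) - (X + (?Y o\<^sub>L ?Y)))"
    by (simp only: sqrt_iter.simps(2)[of X "Suc n"] sqrt_iter.simps(2)[of X n] scaleR_diff_right)
  \<comment> \<open>A difference of squares without commutativity: each product keeps one increment
    and one iterate, as in the scalar recursion.\<close>
  also have "(X + (?Z o\<^sub>L ?Z)) - (X + (?Y o\<^sub>L ?Y)) = ((?Z - ?Y) o\<^sub>L ?Z) + (?Y o\<^sub>L (?Z - ?Y))"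
    by (simp del: sqrt_iter.simps add: blinfun_eq_iff blinfun.diff_left blinfun.diff_right blinfun.add_left)
  finally have "norm (sqrt_iter X (Suc (Suc n)) - ?Z) = norm (((?Z - ?Y) o\<^sub>L ?Z) + (?Y o\<^sub>L (?Z - ?Y))) / 2"
    by simp
  also have "norm (((?Z - ?Y) o\<^sub>L ?Z) + (?Y o\<^sub>L (?Z - ?Y))) \<le> norm (?Z - ?Y) * norm ?Z + norm ?Y * norm (?Z - ?Y)"
    by (meson add_mono norm_blinfun_compose norm_triangle_le)
  also have "\<dots> \<le> (?z - ?y) * ?z + ?y * (?z - ?y)"
    using Suc sqrt_iter_norm[OF assms] sqrt_iter_scalar_bounds sqrt_iter_scalar_step
    by (intro add_mono mult_mono) (auto simp del: sqrt_iter.simps sqrt_iter_scalar.simps)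
  also have "\<dots> / 2 = sqrt_iter_scalar (Suc (Suc n)) - ?z"
  proof -
    have "(1 + z\<^sup>2) / 2 - (1 + y\<^sup>2) / 2 = ((z - y) * z + y * (z - y)) / 2" for y z :: real
      by (simp add: power2_eq_square field_simps)
    from this[of ?z ?y] show ?thesis by (simp only: sqrt_iter_scalar.simps)
  qed
  finally show ?case by simp
qed

lemma sqrt_iter_norm_diff:
  assumes "norm X \<le> 1" "m \<le> n"
  shows "norm (sqrt_iter X n - sqrt_iter X m) \<le> sqrt_iter_scalar n - sqrt_iter_scalar m"
  using assms(2)
proof (induction n rule: dec_induct)
  case (step n)
  have "norm (sqrt_iter X (Suc n) - sqrt_iter X m)
      \<le> norm (sqrt_iter X (Suc n) - sqrt_iter X n) + norm (sqrt_iter X n - sqrt_iter X m)"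
    by (rule norm_diff_triangle_le) auto
  then show ?case using step sqrt_iter_norm_step[OF assms(1), of n] by linarith
qed simp

lemma sqrt_iter_convergent:
  fixes X :: "'v::banach \<Rightarrow>\<^sub>L 'v"
  assumes "norm X \<le> 1"
  shows "convergent (sqrt_iter X)"
proof -
  have "incseq sqrt_iter_scalar" by (intro incseq_SucI sqrt_iter_scalar_step)
  then have "convergent sqrt_iter_scalar"
    using incseq_convergent[of sqrt_iter_scalar 1] sqrt_iter_scalar_bounds
    by (metis convergent_def)
  then have *: "Cauchy sqrt_iter_scalar" by (rule convergent_Cauchy)
  have "Cauchy (sqrt_iter X)"
  proof (rule metric_CauchyI)
    fix e :: real assume "0 < e"
    then obtain N where N: "\<And>m n. N \<le> m \<Longrightarrow> N \<le> n \<Longrightarrow> \<bar>sqrt_iter_scalar m - sqrt_iter_scalar n\<bar> < e"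
      using * unfolding Cauchy_def dist_real_def by blast
    show "\<exists>M. \<forall>m\<ge>M. \<forall>n\<ge>M. dist (sqrt_iter X m) (sqrt_iter X n) < e"
    proof (intro exI allI impI)
      fix m n assume mn: "N \<le> m" "N \<le> n"
      show "dist (sqrt_iter X m) (sqrt_iter X n) < e"
        using sqrt_iter_norm_diff[OF assms, of m n] sqrt_iter_norm_diff[OF assms, of n m] N[OF mn]
        by (cases "m \<le> n") (auto simp: dist_norm norm_minus_commute)
    qed
  qed
  then show ?thesis by (simp add: Cauchy_convergent_iff)
qed

text \<open>Nonnegativity of the form is applied at \<open>c v - f v\<close>. The inequality serves
  twice: it makes \<open>1 - f / c\<close> a contraction, and it puts every vector with vanishing
  form into the kernel.\<close>

lemma nonneg_operator_bound:
  fixes f :: "'v::real_inner \<Rightarrow>\<^sub>L 'v"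
  assumes sym: "\<And>v w. blinfun_apply f v \<bullet> w = v \<bullet> blinfun_apply f w"
    and nonneg: "\<And>v. 0 \<le> v \<bullet> blinfun_apply f v" and c: "norm f \<le> c" "0 < c"
  shows "(norm (blinfun_apply f v))\<^sup>2 \<le> c * (v \<bullet> blinfun_apply f v)"
proof -
  let ?w = "blinfun_apply f v"
  have "blinfun_apply f ?w \<bullet> ?w \<le> norm (blinfun_apply f ?w) * norm ?w" by (rule norm_cauchy_schwarz)
  also have "\<dots> \<le> (c * norm ?w) * norm ?w"
    using norm_blinfun[of f ?w] mult_right_mono[OF c(1) norm_ge_zero[of ?w]] by (intro mult_right_mono) auto
  finally have 1: "blinfun_apply f ?w \<bullet> ?w \<le> c * (norm ?w)\<^sup>2" by (simp add: power2_eq_square)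
  have "0 \<le> (c *\<^sub>R v - ?w) \<bullet> blinfun_apply f (c *\<^sub>R v - ?w)" by (rule nonneg)
  also have "\<dots> = c\<^sup>2 * (v \<bullet> ?w) - 2 * c * (norm ?w)\<^sup>2 + blinfun_apply f ?w \<bullet> ?w"
    using sym[of v ?w] unfolding power2_norm_eq_inner
    by (simp add: blinfun.diff_right blinfun.scaleR_right inner_diff_left inner_diff_right
        inner_commute power2_eq_square algebra_simps)
  also have "\<dots> \<le> c\<^sup>2 * (v \<bullet> ?w) - c * (norm ?w)\<^sup>2" using 1 by simp
  finally have "c * (norm ?w)\<^sup>2 \<le> c * (c * (v \<bullet> ?w))" by (simp add: power2_eq_square)
  then show ?thesis using c by simp
qed

text \<open>With \<open>X = 1 - f / c\<close> of norm at most 1, the limit \<open>Y\<close> of the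
  iteration solves \<open>(1 - Y)\<^sup>2 = f / c\<close>. Commutation with everything that commutes
  with \<open>f\<close> is recorded for the sake of uniqueness.\<close>

lemma operator_sqrt_exists:
  fixes f :: "'v::{real_inner,banach} \<Rightarrow>\<^sub>L 'v"
  assumes sym: "\<And>v w. blinfun_apply f v \<bullet> w = v \<bullet> blinfun_apply f w"
    and nonneg: "\<And>v. 0 \<le> v \<bullet> blinfun_apply f v"
  obtains S where "\<And>v w. blinfun_apply S v \<bullet> w = v \<bullet> blinfun_apply S w"
    "\<And>v. 0 \<le> v \<bullet> blinfun_apply S v" "S o\<^sub>L S = f"
    "\<And>Z. Z o\<^sub>L f = f o\<^sub>L Z \<Longrightarrow> Z o\<^sub>L S = S o\<^sub>L Z"
proof -
  \<comment> \<open>The summand 1 keeps \<open>c\<close> positive when \<open>f = 0\<close>.\<close>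
  define c where "c = norm f + 1"
  have c: "0 < c" "norm f \<le> c" by (auto simp: c_def add_nonneg_pos)
  define X where "X = id_blinfun - (1 / c) *\<^sub>R f"
  have Xa: "blinfun_apply X v = v - (1 / c) *\<^sub>R blinfun_apply f v" for v
    by (simp add: X_def blinfun.diff_left blinfun.scaleR_left)
  have X1: "norm X \<le> 1"
  proof (rule norm_blinfun_bound)
    fix v
    have "(norm (blinfun_apply X v))\<^sup>2
        = (norm v)\<^sup>2 - 2 / c * (v \<bullet> blinfun_apply f v) + (1 / c)\<^sup>2 * (norm (blinfun_apply f v))\<^sup>2"
      unfolding power2_norm_eq_inner Xa
      by (simp add: inner_diff_left inner_diff_right inner_commute power2_eq_square algebra_simps)
    also have "\<dots> \<le> (norm v)\<^sup>2 - 2 / c * (v \<bullet> blinfun_apply f v) + (1 / c)\<^sup>2 * (c * (v \<bullet> blinfun_apply f v))"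
      by (intro add_left_mono mult_left_mono nonneg_operator_bound sym nonneg c) auto
    also have "\<dots> = (norm v)\<^sup>2 - 1 / c * (v \<bullet> blinfun_apply f v)"
      using c by (simp add: power2_eq_square field_simps)
    also have "\<dots> \<le> (norm v)\<^sup>2" using c nonneg[of v] by simp
    finally show "norm (blinfun_apply X v) \<le> 1 * norm v" using power2_le_imp_le by fastforce
  qed simp
  obtain Y where Y: "sqrt_iter X \<longlonglongrightarrow> Y"
    using sqrt_iter_convergent[OF X1] by (auto simp: convergent_def)
  note comp_tendsto = bounded_bilinear.tendsto[OF bounded_bilinear_blinfun_compose]
  have "(\<lambda>n. sqrt_iter X (Suc n)) \<longlonglongrightarrow> (1/2) *\<^sub>R (X + (Y o\<^sub>L Y))"
    unfolding sqrt_iter.simps by (intro tendsto_intros comp_tendsto Y)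
  with LIMSEQ_Suc[OF Y] have fix_eq: "Y = (1/2) *\<^sub>R (X + (Y o\<^sub>L Y))" by (rule LIMSEQ_unique)
  have "2 *\<^sub>R Y = 2 *\<^sub>R ((1/2) *\<^sub>R (X + (Y o\<^sub>L Y)))" using fix_eq by (rule arg_cong)
  then have YY: "Y o\<^sub>L Y = 2 *\<^sub>R Y - X" by (simp add: algebra_simps)
  have "norm (sqrt_iter X n) \<le> 1" for n
    using sqrt_iter_norm[OF X1, of n] sqrt_iter_scalar_bounds[of n] by linarith
  then have Y1: "norm Y \<le> 1" by (intro tendsto_upperbound[OF tendsto_norm[OF Y]]) auto
  have symn: "blinfun_apply (sqrt_iter X n) v \<bullet> w = v \<bullet> blinfun_apply (sqrt_iter X n) w" for n v w
    by (induction n arbitrary: v w)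
      (simp_all add: blinfun.add_left blinfun.scaleR_left inner_add_left inner_add_right Xa
        inner_diff_left inner_diff_right sym)
  have symY: "blinfun_apply Y v \<bullet> w = v \<bullet> blinfun_apply Y w" for v w
  proof (rule LIMSEQ_unique)
    show "(\<lambda>n. blinfun_apply (sqrt_iter X n) v \<bullet> w) \<longlonglongrightarrow> blinfun_apply Y v \<bullet> w"
      by (intro tendsto_intros Y)
    show "(\<lambda>n. blinfun_apply (sqrt_iter X n) v \<bullet> w) \<longlonglongrightarrow> v \<bullet> blinfun_apply Y w"
      unfolding symn by (intro tendsto_intros Y)
  qed
  \<comment> \<open>Every iterate is a polynomial in \<open>X\<close>, and commutation passes to the
    limit.\<close>
  have commY: "Z o\<^sub>L Y = Y o\<^sub>L Z" if "Z o\<^sub>L f = f o\<^sub>L Z" for Z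
  proof -
    have ZX: "Z o\<^sub>L X = X o\<^sub>L Z"
      using that by (auto simp: blinfun_eq_iff Xa blinfun.diff_right blinfun.scaleR_right)
    have "Z o\<^sub>L sqrt_iter X n = sqrt_iter X n o\<^sub>L Z" for n
    proof (induction n)
      case (Suc n)
      then show ?case using ZX
        by (auto simp: blinfun_eq_iff blinfun.add_left blinfun.add_right blinfun.scaleR_left blinfun.scaleR_right)
    qed (simp add: blinfun_eq_iff)
    then have "(\<lambda>n. Z o\<^sub>L sqrt_iter X n) \<longlonglongrightarrow> (Y o\<^sub>L Z)" by (simp only:) (intro comp_tendsto Y tendsto_const)
    moreover have "(\<lambda>n. Z o\<^sub>L sqrt_iter X n) \<longlonglongrightarrow> (Z o\<^sub>L Y)" by (intro comp_tendsto Y tendsto_const)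
    ultimately show ?thesis by (metis LIMSEQ_unique)
  qed
  define S where "S = sqrt c *\<^sub>R (id_blinfun - Y)"
  have Sa: "blinfun_apply S v = sqrt c *\<^sub>R (v - blinfun_apply Y v)" for v
    by (simp add: S_def blinfun.diff_left blinfun.scaleR_left)
  show ?thesis
  proof (rule that[of S])
    show "blinfun_apply S v \<bullet> w = v \<bullet> blinfun_apply S w" for v w
      by (simp add: Sa inner_diff_left inner_diff_right symY)
    show "0 \<le> v \<bullet> blinfun_apply S v" for v
    proof -
      have "v \<bullet> blinfun_apply Y v \<le> norm v * norm (blinfun_apply Y v)" by (rule norm_cauchy_schwarz)
      also have "\<dots> \<le> norm v * (1 * norm v)"
        using norm_blinfun[of Y v] mult_right_mono[OF Y1 norm_ge_zero[of v]] by (intro mult_left_mono) auto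
      also have "\<dots> = v \<bullet> v" by (simp add: norm_eq_sqrt_inner)
      finally show ?thesis using c by (simp add: Sa inner_diff_right)
    qed
    show "S o\<^sub>L S = f"
    proof (rule blinfun_eqI)
      fix v
      have "blinfun_apply (S o\<^sub>L S) v = (sqrt c * sqrt c) *\<^sub>R ((v - blinfun_apply Y v) - blinfun_apply Y (v - blinfun_apply Y v))"
        by (simp add: Sa blinfun.scaleR_right flip: scaleR_diff_right)
      also have "(v - blinfun_apply Y v) - blinfun_apply Y (v - blinfun_apply Y v)
          = v - 2 *\<^sub>R blinfun_apply Y v + blinfun_apply (Y o\<^sub>L Y) v"
        by (simp add: blinfun.diff_right scaleR_2)
      also have "sqrt c * sqrt c = c" using c by simp
      also have "blinfun_apply (Y o\<^sub>L Y) v = 2 *\<^sub>R blinfun_apply Y v - blinfun_apply X v"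
        by (simp only: YY blinfun.diff_left blinfun.scaleR_left)
      also have "v - 2 *\<^sub>R blinfun_apply Y v + (2 *\<^sub>R blinfun_apply Y v - blinfun_apply X v) = v - blinfun_apply X v"
        by (simp only: add_diff_eq diff_add_cancel)
      also have "c *\<^sub>R (v - blinfun_apply X v) = blinfun_apply f v" using c by (simp add: Xa)
      finally show "blinfun_apply (S o\<^sub>L S) v = blinfun_apply f v" .
    qed
    show "Z o\<^sub>L S = S o\<^sub>L Z" if "Z o\<^sub>L f = f o\<^sub>L Z" for Z
      using commY[OF that] by (auto simp: blinfun_eq_iff Sa blinfun.scaleR_right blinfun.diff_right)
  qed
qed

text \<open>By commutation \<open>(S + S') (S - S') = 0\<close>. For \<open>y = (S - S') v\<close>
  the two nonnegative forms sum to 0, so \<open>S y = S' y = 0\<close>, and symmetry turns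
  \<open>y \<bullet> y\<close> into 0.\<close>

lemma sqrt_operator_unique:
  fixes S S' :: "'v::real_inner \<Rightarrow>\<^sub>L 'v"
  assumes S: "\<And>v w. blinfun_apply S v \<bullet> w = v \<bullet> blinfun_apply S w" "\<And>v. 0 \<le> v \<bullet> blinfun_apply S v"
    and S': "\<And>v w. blinfun_apply S' v \<bullet> w = v \<bullet> blinfun_apply S' w" "\<And>v. 0 \<le> v \<bullet> blinfun_apply S' v"
    and sq: "S o\<^sub>L S = S' o\<^sub>L S'" and comm: "S' o\<^sub>L S = S o\<^sub>L S'"
  shows "S = S'"
proof (rule blinfun_eqI)
  fix v
  let ?y = "blinfun_apply S v - blinfun_apply S' v"
  have "blinfun_apply S (blinfun_apply S v) = blinfun_apply S' (blinfun_apply S' v)"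
    "blinfun_apply S' (blinfun_apply S v) = blinfun_apply S (blinfun_apply S' v)"
    using sq comm by (metis blinfun_apply_blinfun_compose)+
  then have "blinfun_apply S ?y + blinfun_apply S' ?y = 0" by (simp add: blinfun.diff_right)
  then have "?y \<bullet> blinfun_apply S ?y + ?y \<bullet> blinfun_apply S' ?y = 0"
    by (metis inner_add_right inner_zero_right)
  then have z: "?y \<bullet> blinfun_apply S ?y = 0" "?y \<bullet> blinfun_apply S' ?y = 0"
    using S(2)[of ?y] S'(2)[of ?y] by linarith+
  have "(norm (blinfun_apply S ?y))\<^sup>2 \<le> (norm S + 1) * (?y \<bullet> blinfun_apply S ?y)"
    by (rule nonneg_operator_bound[OF S]) (auto simp: add_nonneg_pos)
  then have 1: "blinfun_apply S ?y = 0" unfolding z by simp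
  have "(norm (blinfun_apply S' ?y))\<^sup>2 \<le> (norm S' + 1) * (?y \<bullet> blinfun_apply S' ?y)"
    by (rule nonneg_operator_bound[OF S']) (auto simp: add_nonneg_pos)
  then have 2: "blinfun_apply S' ?y = 0" unfolding z by simp
  have "?y \<bullet> ?y = v \<bullet> blinfun_apply S ?y - v \<bullet> blinfun_apply S' ?y"
    by (simp add: inner_diff_left S(1) S'(1))
  then have "?y \<bullet> ?y = 0" by (simp add: 1 2)
  then show "blinfun_apply S v = blinfun_apply S' v" by simp
qed

lemma symmetric_matrix_inner:
  fixes M :: "real^'n^'n"
  assumes "transpose M = M"
  shows "(M *v v) \<bullet> w = v \<bullet> (M *v w)"
  by (metis assms dot_lmul_matrix transpose_matrix_vector)

lemma symmetric_matrixI: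
  fixes M :: "real^'n^'n"
  assumes "\<And>v w. (M *v v) \<bullet> w = v \<bullet> (M *v w)"
  shows "transpose M = M"
proof -
  have "transpose M *v v = M *v v" for v
  proof -
    have "(transpose M *v v) \<bullet> w = (M *v v) \<bullet> w" for w
      by (metis assms dot_lmul_matrix transpose_matrix_vector)
    then show ?thesis by (metis vector_eq_rdot)
  qed
  then show ?thesis by (simp add: matrix_eq)
qed

text \<open>\<open>msqrt\<close> is a definite description, so existence and uniqueness are both
  due. A competing root commutes with its own square \<open>M\<close>, hence with the constructed
  root.\<close>

lemma msqrt_psd:
  fixes M :: "real^'n^'n"
  assumes "psd M"
  shows "psd (msqrt M) \<and> msqrt M ** msqrt M = M"
proof -
  define bl :: "real^'n^'n \<Rightarrow> _" where "bl N = Blinfun ((*v) N)" for N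
  have bl: "blinfun_apply (bl N) = (*v) N" for N
    unfolding bl_def by (rule bounded_linear_Blinfun_apply) (rule matrix_vector_mul_bounded_linear)
  have bl_mult: "bl N o\<^sub>L bl N' = bl (N ** N')" for N N'
    by (simp add: blinfun_eq_iff bl matrix_vector_mul_assoc)
  have bl_inj: "N = N'" if "bl N = bl N'" for N N'
    using that by (metis bl matrix_eq)
  have bl_psd: "(\<forall>v w. blinfun_apply (bl N) v \<bullet> w = v \<bullet> blinfun_apply (bl N) w) \<and>
      (\<forall>v. 0 \<le> v \<bullet> blinfun_apply (bl N) v)" if "psd N" for N
    using that symmetric_matrix_inner by (auto simp: bl psd_def)
  obtain S where S: "\<And>v w. blinfun_apply S v \<bullet> w = v \<bullet> blinfun_apply S w"
    "\<And>v. 0 \<le> v \<bullet> blinfun_apply S v" "S o\<^sub>L S = bl M"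
    "\<And>Z. Z o\<^sub>L bl M = bl M o\<^sub>L Z \<Longrightarrow> Z o\<^sub>L S = S o\<^sub>L Z"
    using operator_sqrt_exists[of "bl M"] bl_psd[OF assms] by blast
  define N where "N = matrix (blinfun_apply S)"
  have SN: "S = bl N"
    by (rule blinfun_eqI) (simp add: bl N_def matrix_works
        bounded_linear.linear[OF blinfun.bounded_linear_right])
  have "transpose N = N"
    by (rule symmetric_matrixI) (use S(1) in \<open>simp add: SN bl\<close>)
  moreover have "0 \<le> v \<bullet> (N *v v)" for v using S(2)[of v] by (simp add: SN bl)
  ultimately have N: "psd N" by (simp add: psd_def)
  have NN: "N ** N = M" by (rule bl_inj) (use S(3) in \<open>simp only: SN bl_mult\<close>)
  have uniq: "N' = N" if "psd N'" "N' ** N' = M" for N'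
  proof -
    have "bl N' o\<^sub>L bl M = bl M o\<^sub>L bl N'"
      unfolding bl_mult that(2)[symmetric] by (simp only: matrix_mul_assoc)
    then have comm: "bl N' o\<^sub>L bl N = bl N o\<^sub>L bl N'" using S(4)[of "bl N'"] by (simp only: SN)
    have sq: "bl N o\<^sub>L bl N = bl N' o\<^sub>L bl N'" by (simp only: NN that(2) bl_mult)
    have "bl N = bl N'"
      by (rule sqrt_operator_unique[OF _ _ _ _ sq comm]) (use bl_psd[OF N] bl_psd[OF that(1)] in blast)+
    then show ?thesis using bl_inj by simp
  qed
  show ?thesis
    unfolding msqrt_def
  proof (rule theI[of "\<lambda>S. psd S \<and> S ** S = M" N])
    show "psd N \<and> N ** N = M" using N NN by blast
    show "N' = N" if "psd N' \<and> N' ** N' = M" for N' using uniq that by blast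
  qed
qed

lemma norm_msqrt_mult:
  fixes M :: "real^'n^'n"
  assumes "psd M"
  shows "(norm (msqrt M *v v))\<^sup>2 = v \<bullet> (M *v v)"
proof -
  have "(norm (msqrt M *v v))\<^sup>2 = v \<bullet> (msqrt M *v (msqrt M *v v))"
    using msqrt_psd[OF assms] symmetric_matrix_inner[of "msqrt M" v "msqrt M *v v"]
    by (simp add: power2_norm_eq_inner psd_def)
  then show ?thesis using msqrt_psd[OF assms] by (simp add: matrix_vector_mul_assoc)
qed

section \<open>Stationary processes on the scenario tree\<close>

lemma length_pre [simp]: "length (pre \<zeta> t) = Suc t"
  by (simp add: pre_def)

lemma pre_nth [simp]: "i \<le> t \<Longrightarrow> pre \<zeta> t ! i = \<zeta> i"
  by (simp add: pre_def del: upt_Suc)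

lemma take_pre [simp]: "i \<le> t \<Longrightarrow> take (Suc i) (pre \<zeta> t) = pre \<zeta> i"
  by (simp add: pre_def take_map take_upt del: upt_Suc)

lemma pre_eq_le: "pre \<zeta> t = pre \<eta> t \<Longrightarrow> i \<le> t \<Longrightarrow> pre \<zeta> i = pre \<eta> i"
  by (metis take_pre)

lemma pre_eq_nth: "pre \<zeta> t = pre \<eta> t \<Longrightarrow> i \<le> t \<Longrightarrow> \<zeta> i = \<eta> i"
  by (metis pre_nth)

text \<open>Finitely many scenarios with positive weights. Processes take the time and the prefix as
  arguments, so being adapted is a matter of type and never a side condition.\<close>

locale lq_tree =
  fixes S :: "(nat \<Rightarrow> 'a) set" and m :: "(nat \<Rightarrow> 'a) \<Rightarrow> real"
    and A :: "'a \<Rightarrow> real^'x^'x" and B :: "'a \<Rightarrow> real^'u^'x"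
    and Q :: "'a \<Rightarrow> real^'x^'x" and R :: "'a \<Rightarrow> real^'u^'u"
    and K :: "nat \<Rightarrow> 'a list \<Rightarrow> real^'x^'u" and Kd :: "nat \<Rightarrow> 'a list \<Rightarrow> real^'x^'x"
    and T :: nat and L \<alpha> \<gamma> :: real
  assumes finite_S: "finite S" and S_nonempty: "S \<noteq> {}"
    and m_pos: "\<zeta> \<in> S \<Longrightarrow> 0 < m \<zeta>"
    and A_bound: "\<zeta> \<in> S \<Longrightarrow> t \<le> T \<Longrightarrow> mnorm (A (\<zeta> t)) \<le> L"
    and path: "\<zeta> \<in> S \<Longrightarrow> lq_path (\<lambda>t. A (\<zeta> t)) (\<lambda>t. B (\<zeta> t)) (\<lambda>t. Q (\<zeta> t)) (\<lambda>t. R (\<zeta> t))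
      (\<lambda>t. K t (pre \<zeta> t)) (\<lambda>t. Kd t (pre \<zeta> t)) (\<lambda>t. msqrt (Q (\<zeta> t))) T L \<alpha> \<gamma>"
begin

section \<open>Weighted L2 norms over the scenarios\<close>

definition l2 :: "((nat \<Rightarrow> 'a) \<Rightarrow> 'v::real_normed_vector) \<Rightarrow> real" where
  "l2 F = L2_set (\<lambda>\<zeta>. sqrt (m \<zeta>) * norm (F \<zeta>)) S"

lemma l2_sq: "(l2 F)\<^sup>2 = (\<Sum>\<zeta>\<in>S. m \<zeta> * (norm (F \<zeta>))\<^sup>2)"
  unfolding l2_def L2_set_def using m_pos
  by (subst real_sqrt_pow2) (auto intro!: sum_nonneg sum.cong simp: power_mult_distrib less_imp_le)

lemma l2_nonneg [simp]: "0 \<le> l2 F"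
  by (simp add: l2_def)

lemma l2_mono:
  assumes "\<And>\<zeta>. \<zeta> \<in> S \<Longrightarrow> norm (F \<zeta>) \<le> norm (G \<zeta>)"
  shows "l2 F \<le> l2 G"
  unfolding l2_def using assms m_pos
  by (intro L2_set_mono mult_left_mono) (auto simp: less_imp_le)

lemma l2_cong:
  assumes "\<And>\<zeta>. \<zeta> \<in> S \<Longrightarrow> F \<zeta> = G \<zeta>"
  shows "l2 F = l2 G"
  using l2_mono[of F G] l2_mono[of G F] assms by simp

lemma l2_add: "l2 (\<lambda>\<zeta>. F \<zeta> + G \<zeta>) \<le> l2 F + l2 G"
proof -
  have "l2 (\<lambda>\<zeta>. F \<zeta> + G \<zeta>) \<le> L2_set (\<lambda>\<zeta>. sqrt (m \<zeta>) * norm (F \<zeta>) + sqrt (m \<zeta>) * norm (G \<zeta>)) S"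
    unfolding l2_def distrib_left[symmetric] using m_pos
    by (intro L2_set_mono mult_left_mono norm_triangle_ineq) (auto simp: less_imp_le)
  also have "\<dots> \<le> l2 F + l2 G" unfolding l2_def by (rule L2_set_triangle_ineq)
  finally show ?thesis .
qed

lemma l2_zero [simp]: "l2 (\<lambda>\<zeta>. 0) = 0"
  by (simp add: l2_def L2_set_def)

lemma l2_scale:
  assumes "0 \<le> a" "\<And>\<zeta>. \<zeta> \<in> S \<Longrightarrow> norm (F \<zeta>) \<le> a * norm (G \<zeta>)"
  shows "l2 F \<le> a * l2 G"
proof -
  have "l2 F \<le> L2_set (\<lambda>\<zeta>. a * (sqrt (m \<zeta>) * norm (G \<zeta>))) S"
    unfolding l2_def using assms m_pos mult_left_mono
    by (intro L2_set_mono) (fastforce simp: less_imp_le mult.left_commute)+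
  also have "\<dots> = a * l2 G" unfolding l2_def using assms(1) by (simp add: L2_set_right_distrib)
  finally show ?thesis .
qed

lemma l2_sum: "l2 (\<lambda>\<zeta>. \<Sum>i\<in>I. F i \<zeta>) \<le> (\<Sum>i\<in>I. l2 (F i))"
proof (induction I rule: infinite_finite_induct)
  case (insert i I)
  then show ?case using l2_add[of "F i" "\<lambda>\<zeta>. \<Sum>i\<in>I. F i \<zeta>"] by simp
qed simp_all

section \<open>Adapted dynamics and the variational equation\<close>

definition obeys :: "nat \<Rightarrow> nat \<Rightarrow> (nat \<Rightarrow> 'a list \<Rightarrow> real^'x) \<Rightarrow> (nat \<Rightarrow> 'a list \<Rightarrow> (real^'x) \<times> (real^'u)) \<Rightarrow> bool" where
  "obeys s n dd z \<longleftrightarrow> (\<forall>\<zeta>\<in>S. fst (z s (pre \<zeta> s)) = dd s (pre \<zeta> s) \<and>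
     (\<forall>t. s \<le> t \<and> t < n \<longrightarrow> fst (z (Suc t) (pre \<zeta> (Suc t))) =
        A (\<zeta> (Suc t)) *v fst (z t (pre \<zeta> t)) + B (\<zeta> (Suc t)) *v snd (z t (pre \<zeta> t)) + dd (Suc t) (pre \<zeta> (Suc t))))"

text \<open>The optimality system in weak form. Testing in place of multipliers keeps the condition
  linear in \<open>z\<close> and the data jointly, hence stable under differences.\<close>

definition stationary :: "nat \<Rightarrow> nat \<Rightarrow> (nat \<Rightarrow> 'a list \<Rightarrow> real^'x) \<Rightarrow> (nat \<Rightarrow> 'a list \<Rightarrow> real^'u) \<Rightarrow>
    (nat \<Rightarrow> 'a list \<Rightarrow> (real^'x) \<times> (real^'u)) \<Rightarrow> bool" where
  "stationary s n qq rr z \<longleftrightarrow> (\<forall>v. obeys s n (\<lambda>_ _. 0) v \<longrightarrow>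
     (\<Sum>\<zeta>\<in>S. m \<zeta> * (\<Sum>t=s..n. variation (Q (\<zeta> t)) (R (\<zeta> t)) (qq t (pre \<zeta> t)) (rr t (pre \<zeta> t))
        (z t (pre \<zeta> t)) (v t (pre \<zeta> t)))) = 0)"

lemma obeys_diff:
  assumes "obeys s n dd z" "obeys s n dd' z'"
  shows "obeys s n (\<lambda>t h. dd t h - dd' t h) (\<lambda>t h. z t h - z' t h)"
  using assms unfolding obeys_def
  by (auto simp: matrix_vector_mult_diff_distrib)

lemma stationary_diff:
  assumes "stationary s n qq rr z" "stationary s n qq' rr' z'"
  shows "stationary s n (\<lambda>t h. qq t h - qq' t h) (\<lambda>t h. rr t h - rr' t h) (\<lambda>t h. z t h - z' t h)"
  unfolding stationary_def
proof (intro allI impI)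
  fix v assume v: "obeys s n (\<lambda>_ _. 0) v"
  have eq: "variation (Q a) (R a) (q - q') (r - r') (w - w') v
      = variation (Q a) (R a) q r w v - variation (Q a) (R a) q' r' w' v"
    for a q q' r r' w w' v
    by (simp add: variation_def matrix_vector_mult_diff_distrib inner_diff_left)
  show "(\<Sum>\<zeta>\<in>S. m \<zeta> * (\<Sum>t=s..n. variation (Q (\<zeta> t)) (R (\<zeta> t)) (qq t (pre \<zeta> t) - qq' t (pre \<zeta> t))
      (rr t (pre \<zeta> t) - rr' t (pre \<zeta> t)) (z t (pre \<zeta> t) - z' t (pre \<zeta> t)) (v t (pre \<zeta> t)))) = 0"
    using assms v unfolding stationary_def eq sum_subtractf right_diff_distrib by simp
qed

text \<open>A direction with state 0 at \<open>Suc s\<close> extends by zero to \<open>s\<close>.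
  Dropping the first stage in this way lets the prediction made at \<open>s\<close> be compared with
  the one made at \<open>s + 1\<close>.\<close>

lemma stationary_Suc:
  assumes "stationary s n qq rr z" "s < n"
  shows "stationary (Suc s) n qq rr z"
  unfolding stationary_def
proof (intro allI impI)
  fix v assume v: "obeys (Suc s) n (\<lambda>_ _. 0) v"
  define v' where "v' t h = (if t \<le> s then 0 else v t h)" for t h
  have "obeys s n (\<lambda>_ _. 0) v'"
    using v unfolding obeys_def v'_def by (auto simp: not_less_eq_eq le_Suc_eq)
  then have "(\<Sum>\<zeta>\<in>S. m \<zeta> * (\<Sum>t=s..n. variation (Q (\<zeta> t)) (R (\<zeta> t)) (qq t (pre \<zeta> t)) (rr t (pre \<zeta> t))
        (z t (pre \<zeta> t)) (v' t (pre \<zeta> t)))) = 0"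
    using assms unfolding stationary_def by blast
  moreover have "(\<Sum>t=s..n. variation (Q (\<zeta> t)) (R (\<zeta> t)) (qq t (pre \<zeta> t)) (rr t (pre \<zeta> t))
        (z t (pre \<zeta> t)) (v' t (pre \<zeta> t))) =
      (\<Sum>t=Suc s..n. variation (Q (\<zeta> t)) (R (\<zeta> t)) (qq t (pre \<zeta> t)) (rr t (pre \<zeta> t))
        (z t (pre \<zeta> t)) (v t (pre \<zeta> t)))" for \<zeta>
    using assms(2) by (simp add: sum.atLeast_Suc_atMost v'_def variation_def)
  ultimately show "(\<Sum>\<zeta>\<in>S. m \<zeta> * (\<Sum>t=Suc s..n. variation (Q (\<zeta> t)) (R (\<zeta> t)) (qq t (pre \<zeta> t)) (rr t (pre \<zeta> t))
        (z t (pre \<zeta> t)) (v t (pre \<zeta> t)))) = 0" by simp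
qed

text \<open>At the added stage the solution and its linear cost data are 0, so every variation there
  vanishes. Two predictions with different horizons thus become solutions over a common
  window.\<close>

lemma stationary_extend:
  assumes "stationary s n qq rr z" "s \<le> n"
    and "\<And>h. z (Suc n) h = 0" "\<And>h. qq (Suc n) h = 0" "\<And>h. rr (Suc n) h = 0"
  shows "stationary s (Suc n) qq rr z"
  unfolding stationary_def
proof (intro allI impI)
  fix v assume "obeys s (Suc n) (\<lambda>_ _. 0) v"
  then have "obeys s n (\<lambda>_ _. 0) v" by (simp add: obeys_def)
  then show "(\<Sum>\<zeta>\<in>S. m \<zeta> * (\<Sum>t=s..Suc n. variation (Q (\<zeta> t)) (R (\<zeta> t)) (qq t (pre \<zeta> t)) (rr t (pre \<zeta> t))
        (z t (pre \<zeta> t)) (v t (pre \<zeta> t)))) = 0"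
    using assms unfolding stationary_def by (simp add: variation_def)
qed

text \<open>The correction \<open>e\<close> of the pathwise argument as an adapted process:
  stripping the last entry of the prefix at \<open>Suc t\<close> gives the prefix at
  \<open>t\<close>, where the gain is evaluated.\<close>

primrec corr :: "(nat \<Rightarrow> 'a list \<Rightarrow> real^'x) \<Rightarrow> nat \<Rightarrow> nat \<Rightarrow> 'a list \<Rightarrow> real^'x" where
  "corr g s 0 h = g 0 h"
| "corr g s (Suc t) h = (if Suc t \<le> s then g (Suc t) h
     else (A (h ! Suc t) - B (h ! Suc t) ** K t (take (Suc t) h)) *v corr g s t (take (Suc t) h) + g (Suc t) h)"

lemma corr_start: "corr g s s h = g s h"
  by (cases s) auto

text \<open>Averaging the pathwise estimate over the tree: the test direction is adapted, so stationarity
  removes the variation term.\<close>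

theorem weighted_estimate:
  assumes z: "obeys s n dd z" "stationary s n qq rr z" and n: "n \<le> T"
    and c_pos: "\<And>t. 0 < c t"
    and c_up: "\<And>t. s \<le> t \<Longrightarrow> t < n \<Longrightarrow> (c (Suc t))\<^sup>2 \<le> (1 + 1 / CC L \<alpha> \<gamma>) * (c t)\<^sup>2"
    and c_down: "\<And>t. s \<le> t \<Longrightarrow> t < n \<Longrightarrow> (c t)\<^sup>2 \<le> (1 + 1 / CC L \<alpha> \<gamma>) * (c (Suc t))\<^sup>2"
  shows "(\<Sum>t=s..n. (c t)\<^sup>2 * (l2 (\<lambda>\<zeta>. z t (pre \<zeta> t)))\<^sup>2) \<le> (CC L \<alpha> \<gamma>)\<^sup>2 *
    (\<Sum>t=s..n. (c t)\<^sup>2 * ((l2 (\<lambda>\<zeta>. dd t (pre \<zeta> t)))\<^sup>2 + (l2 (\<lambda>\<zeta>. (qq t (pre \<zeta> t), rr t (pre \<zeta> t))))\<^sup>2))"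
proof -
  define g where "g t h = - (((c t)\<^sup>2 - weight_prev c s t) *\<^sub>R fst (z t h) + weight_prev c s t *\<^sub>R dd t h)" for t h
  define e where "e = corr g s"
  define v where "v t h = ((c t)\<^sup>2 *\<^sub>R fst (z t h) + e t h, (c t)\<^sup>2 *\<^sub>R snd (z t h) - K t h *v e t h)" for t h
  let ?V = "\<lambda>\<zeta> t. variation (Q (\<zeta> t)) (R (\<zeta> t)) (qq t (pre \<zeta> t)) (rr t (pre \<zeta> t))
        (z t (pre \<zeta> t)) (v t (pre \<zeta> t))"
  let ?X = "\<lambda>\<zeta>. \<Sum>t=s..n. (c t)\<^sup>2 * (norm (z t (pre \<zeta> t)))\<^sup>2"
  let ?D = "\<lambda>\<zeta>. \<Sum>t=s..n. (c t)\<^sup>2 * ((norm (dd t (pre \<zeta> t)))\<^sup>2 + (norm (qq t (pre \<zeta> t), rr t (pre \<zeta> t)))\<^sup>2)"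
  have pw: "?X \<zeta> \<le> (CC L \<alpha> \<gamma>)\<^sup>2 * ?D \<zeta> + 2 * MC L \<alpha> \<gamma> * (\<Sum>t=s..n. ?V \<zeta> t) \<and>
      fst (v s (pre \<zeta> s)) = 0 \<and>
      (\<forall>t. s \<le> t \<and> t < n \<longrightarrow> fst (v (Suc t) (pre \<zeta> (Suc t))) =
        A (\<zeta> (Suc t)) *v fst (v t (pre \<zeta> t)) + B (\<zeta> (Suc t)) *v snd (v t (pre \<zeta> t)))"
    if \<zeta>: "\<zeta> \<in> S" for \<zeta>
  proof -
    interpret lq_path "\<lambda>t. A (\<zeta> t)" "\<lambda>t. B (\<zeta> t)" "\<lambda>t. Q (\<zeta> t)" "\<lambda>t. R (\<zeta> t)"
      "\<lambda>t. K t (pre \<zeta> t)" "\<lambda>t. Kd t (pre \<zeta> t)" "\<lambda>t. msqrt (Q (\<zeta> t))" T L \<alpha> \<gamma>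
      by (rule path[OF \<zeta>])
    define x u d e' where xude: "x t = fst (z t (pre \<zeta> t))" "u t = snd (z t (pre \<zeta> t))"
      "d t = dd t (pre \<zeta> t)" "e' t = e t (pre \<zeta> t)" for t
    have start: "x s = d s" using z(1) \<zeta> by (simp add: obeys_def xude)
    have dyn: "x (Suc t) = A (\<zeta> (Suc t)) *v x t + B (\<zeta> (Suc t)) *v u t + d (Suc t)"
      if "s \<le> t" "t < n" for t
      using z(1) \<zeta> that by (simp add: obeys_def xude)
    have g: "g t (pre \<zeta> t) = lq_defect c s x d t" for t by (simp add: g_def lq_defect_def xude)
    have e_start: "e' s = lq_defect c s x d s" by (simp add: xude(4) e_def corr_start g)
    have e_step: "e' (Suc t) = (A (\<zeta> (Suc t)) - B (\<zeta> (Suc t)) ** K t (pre \<zeta> t)) *v e' t + lq_defect c s x d (Suc t)"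
      if "s \<le> t" "t < n" for t
      using that by (simp add: xude(4) e_def flip: g)
    have v: "v t (pre \<zeta> t) = (lq_test_x c x e' t, lq_test_u c (\<lambda>t. K t (pre \<zeta> t)) u e' t)" for t
      by (simp add: v_def lq_test_x_def lq_test_u_def xude)
    note hyps = n start dyn c_pos c_up c_down e_start e_step
    have "(\<Sum>t=s..n. (c t)\<^sup>2 * ((norm (x t))\<^sup>2 + (norm (u t))\<^sup>2))
      \<le> (CC L \<alpha> \<gamma>)\<^sup>2 * ((\<Sum>t=s..n. (c t)\<^sup>2 * (norm (d t))\<^sup>2) +
        (\<Sum>t=s..n. (c t)\<^sup>2 * ((norm (qq t (pre \<zeta> t)))\<^sup>2 + (norm (rr t (pre \<zeta> t)))\<^sup>2))) +
        2 * MC L \<alpha> \<gamma> * (\<Sum>t=s..n. variation (Q (\<zeta> t)) (R (\<zeta> t)) (qq t (pre \<zeta> t)) (rr t (pre \<zeta> t)) (x t, u t)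
          (lq_test_x c x e' t, lq_test_u c (\<lambda>t. K t (pre \<zeta> t)) u e' t))"
      by (rule weighted_estimate[OF hyps])
    moreover have "(norm (z t (pre \<zeta> t)))\<^sup>2 = (norm (x t))\<^sup>2 + (norm (u t))\<^sup>2" for t
      unfolding xude using norm_Pair[of "fst (z t (pre \<zeta> t))" "snd (z t (pre \<zeta> t))"] by simp
    moreover have "(norm (qq t (pre \<zeta> t), rr t (pre \<zeta> t)))\<^sup>2
        = (norm (qq t (pre \<zeta> t)))\<^sup>2 + (norm (rr t (pre \<zeta> t)))\<^sup>2" for t
      by (simp add: norm_Pair)
    ultimately have "?X \<zeta> \<le> (CC L \<alpha> \<gamma>)\<^sup>2 * ?D \<zeta> + 2 * MC L \<alpha> \<gamma> * (\<Sum>t=s..n. ?V \<zeta> t)"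
      by (simp add: v xude(1-3) distrib_left sum.distrib)
    moreover have "fst (v s (pre \<zeta> s)) = 0"
      unfolding v using test_start[OF hyps] by simp
    moreover have "fst (v (Suc t) (pre \<zeta> (Suc t))) =
        A (\<zeta> (Suc t)) *v fst (v t (pre \<zeta> t)) + B (\<zeta> (Suc t)) *v snd (v t (pre \<zeta> t))"
      if "s \<le> t" "t < n" for t
      unfolding v using test_step[OF hyps that] by simp
    ultimately show ?thesis by blast
  qed
  have "obeys s n (\<lambda>_ _. 0) v" using pw by (simp add: obeys_def)
  then have V: "(\<Sum>\<zeta>\<in>S. m \<zeta> * (\<Sum>t=s..n. ?V \<zeta> t)) = 0"
    using z(2) unfolding stationary_def by blast
  have swap: "(\<Sum>\<zeta>\<in>S. m \<zeta> * (\<Sum>t=s..n. (c t)\<^sup>2 * F t \<zeta>)) = (\<Sum>t=s..n. (c t)\<^sup>2 * (\<Sum>\<zeta>\<in>S. m \<zeta> * F t \<zeta>))"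
    for F :: "nat \<Rightarrow> (nat \<Rightarrow> 'a) \<Rightarrow> real"
    unfolding sum_distrib_left by (subst sum.swap) (simp add: mult.left_commute)
  have "(\<Sum>t=s..n. (c t)\<^sup>2 * (l2 (\<lambda>\<zeta>. z t (pre \<zeta> t)))\<^sup>2) = (\<Sum>\<zeta>\<in>S. m \<zeta> * ?X \<zeta>)"
    unfolding l2_sq swap ..
  also have "\<dots> \<le> (\<Sum>\<zeta>\<in>S. m \<zeta> * ((CC L \<alpha> \<gamma>)\<^sup>2 * ?D \<zeta> + 2 * MC L \<alpha> \<gamma> * (\<Sum>t=s..n. ?V \<zeta> t)))"
    using pw m_pos by (intro sum_mono mult_left_mono) (auto simp: less_imp_le)
  also have "\<dots> = (CC L \<alpha> \<gamma>)\<^sup>2 * (\<Sum>\<zeta>\<in>S. m \<zeta> * ?D \<zeta>) + 2 * MC L \<alpha> \<gamma> * (\<Sum>\<zeta>\<in>S. m \<zeta> * (\<Sum>t=s..n. ?V \<zeta> t))"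
    unfolding sum_distrib_left[of _ _ S] sum.distrib[symmetric] by (rule sum.cong) (auto simp: algebra_simps)
  also have "\<dots> = (CC L \<alpha> \<gamma>)\<^sup>2 * (\<Sum>\<zeta>\<in>S. m \<zeta> * ?D \<zeta>)" unfolding V by simp
  also have "(\<Sum>\<zeta>\<in>S. m \<zeta> * ?D \<zeta>) = (\<Sum>t=s..n. (c t)\<^sup>2 * ((l2 (\<lambda>\<zeta>. dd t (pre \<zeta> t)))\<^sup>2 + (l2 (\<lambda>\<zeta>. (qq t (pre \<zeta> t), rr t (pre \<zeta> t))))\<^sup>2))"
    unfolding swap l2_sq by (simp add: distrib_left sum.distrib)
  finally show ?thesis .
qed

text \<open>The weights equal 1 at \<open>t\<close>, so the wanted term is one summand of the energy
  estimate; the condition on \<open>b\<close> says that weights changing by a factor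
  \<open>b\<close> per step are slow enough in both directions. The square sum of the data is
  relaxed to a plain sum, the form that the recursion over stages uses.\<close>

theorem decay_estimate:
  assumes z: "obeys s n dd z" "stationary s n qq rr z" and n: "n \<le> T"
    and b: "0 < b" "b < 1" "1 \<le> (1 + 1 / CC L \<alpha> \<gamma>) * b\<^sup>2"
    and t: "s \<le> t" "t \<le> n"
  shows "l2 (\<lambda>\<zeta>. z t (pre \<zeta> t)) \<le> CC L \<alpha> \<gamma> * (\<Sum>t'=s..n. b ^ tdist t t' *
    (l2 (\<lambda>\<zeta>. dd t' (pre \<zeta> t')) + l2 (\<lambda>\<zeta>. (qq t' (pre \<zeta> t'), rr t' (pre \<zeta> t')))))"
proof -
  let ?C = "CC L \<alpha> \<gamma>"
  let ?d = "\<lambda>t'. l2 (\<lambda>\<zeta>. dd t' (pre \<zeta> t'))" and ?p = "\<lambda>t'. l2 (\<lambda>\<zeta>. (qq t' (pre \<zeta> t'), rr t' (pre \<zeta> t')))"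
  obtain \<zeta> where "\<zeta> \<in> S" using S_nonempty by blast
  then have C: "1 \<le> ?C" using lq_path.C_ge(2)[OF path] by blast
  define c where "c t' = b ^ tdist t t'" for t'
  have c_pos: "0 < c t'" for t' using b by (simp add: c_def)
  have b_le: "a\<^sup>2 \<le> (1 + 1 / ?C) * (b * a)\<^sup>2" for a
    using mult_right_mono[OF b(3), of "a\<^sup>2"] by (simp add: power_mult_distrib mult.assoc)
  have b_le': "(b * a)\<^sup>2 \<le> (1 + 1 / ?C) * a\<^sup>2" for a
  proof -
    have "b\<^sup>2 \<le> 1" using b by (simp add: power_le_one)
    also have "1 \<le> 1 + 1 / ?C" using C by simp
    finally show ?thesis by (simp add: power_mult_distrib mult_right_mono)
  qed
  have step: "c (Suc i) = b * c i \<or> c i = b * c (Suc i)" for i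
  proof (cases "i < t")
    case True
    then have "tdist t i = Suc (tdist t (Suc i))" by (simp add: tdist_def)
    then show ?thesis by (simp add: c_def)
  next
    case False
    then have "tdist t (Suc i) = Suc (tdist t i)" by (simp add: tdist_def Suc_diff_le)
    then show ?thesis by (simp add: c_def)
  qed
  have c1: "(c (Suc i))\<^sup>2 \<le> (1 + 1 / ?C) * (c i)\<^sup>2" "(c i)\<^sup>2 \<le> (1 + 1 / ?C) * (c (Suc i))\<^sup>2" for i
    using step[of i] b_le b_le' by metis+
  have "(l2 (\<lambda>\<zeta>. z t (pre \<zeta> t)))\<^sup>2 = (c t)\<^sup>2 * (l2 (\<lambda>\<zeta>. z t (pre \<zeta> t)))\<^sup>2"
    by (simp add: c_def tdist_def)
  also have "\<dots> \<le> (\<Sum>t=s..n. (c t)\<^sup>2 * (l2 (\<lambda>\<zeta>. z t (pre \<zeta> t)))\<^sup>2)"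
    using t by (intro member_le_sum) auto
  also have "\<dots> \<le> ?C\<^sup>2 * (\<Sum>t=s..n. (c t)\<^sup>2 * ((?d t)\<^sup>2 + (?p t)\<^sup>2))"
    by (rule weighted_estimate[OF z n]) (rule c_pos c1)+
  also have "\<dots> \<le> ?C\<^sup>2 * (\<Sum>t=s..n. (c t * (?d t + ?p t))\<^sup>2)"
    unfolding power_mult_distrib
    by (intro mult_left_mono sum_mono) (auto simp: power2_sum)
  also have "\<dots> \<le> ?C\<^sup>2 * (\<Sum>t=s..n. c t * (?d t + ?p t))\<^sup>2"
  proof (intro mult_left_mono)
    have "sqrt (\<Sum>t=s..n. (c t * (?d t + ?p t))\<^sup>2) \<le> (\<Sum>t=s..n. c t * (?d t + ?p t))"
      unfolding L2_set_def[symmetric] using c_pos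
      by (intro L2_set_le_sum mult_nonneg_nonneg add_nonneg_nonneg) (auto simp: less_imp_le)
    then show "(\<Sum>t=s..n. (c t * (?d t + ?p t))\<^sup>2) \<le> (\<Sum>t=s..n. c t * (?d t + ?p t))\<^sup>2"
      by (rule sqrt_le_D)
  qed auto
  finally have "(l2 (\<lambda>\<zeta>. z t (pre \<zeta> t)))\<^sup>2 \<le> (?C * (\<Sum>t=s..n. c t * (?d t + ?p t)))\<^sup>2"
    by (simp only: power_mult_distrib)
  then have "l2 (\<lambda>\<zeta>. z t (pre \<zeta> t)) \<le> ?C * (\<Sum>t=s..n. c t * (?d t + ?p t))"
    by (rule power2_le_imp_le) (use C c_pos in \<open>auto intro!: mult_nonneg_nonneg sum_nonneg simp: less_imp_le\<close>)
  then show ?thesis by (simp only: c_def)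
qed

end

section \<open>Existence of optimal policies and the first-order condition\<close>

definition quad :: "real^'x^'x \<Rightarrow> real^'u^'u \<Rightarrow> (real^'x) \<times> (real^'u) \<Rightarrow> real" where
  "quad Q R v = (1/2) * (fst v \<bullet> (Q *v fst v)) + (1/2) * (snd v \<bullet> (R *v snd v))"

lemma stage_cost_expand:
  assumes "\<And>\<xi>. transpose (Q \<xi>) = Q \<xi>" "\<And>\<xi>. transpose (R \<xi>) = R \<xi>"
  shows "stage_cost Q R q r (w + c *\<^sub>R v) \<xi>
    = stage_cost Q R q r w \<xi> + c * variation (Q \<xi>) (R \<xi>) (q \<xi>) (r \<xi>) w v + c\<^sup>2 * quad (Q \<xi>) (R \<xi>) v"
  using symmetric_matrix_inner[OF assms(1)[of \<xi>], of "fst w" "fst v"]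
    symmetric_matrix_inner[OF assms(2)[of \<xi>], of "snd w" "snd v"]
  by (simp add: stage_cost_def variation_def quad_def matrix_vector_right_distrib
      matrix_vector_mult_scaleR inner_add_left inner_add_right inner_commute
      power2_eq_square field_simps)

lemma quadratic_nonneg_imp_linear_zero:
  fixes l q :: real
  assumes "\<And>c. 0 \<le> c * l + c\<^sup>2 * q"
  shows "l = 0"
proof (rule ccontr)
  assume "l \<noteq> 0"
  \<comment> \<open>\<open>D\<close> is positive and exceeds \<open>q\<close> whatever the sign of
    \<open>q\<close>, so the trial point \<open>- l / D\<close> makes the polynomial
    negative.\<close>
  define D where "D = \<bar>q\<bar> + 1"
  have D: "0 < D" "q < D" by (auto simp: D_def)
  have "0 \<le> (- l / D) * l + (- l / D)\<^sup>2 * q" by (rule assms)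
  also have "\<dots> = (l\<^sup>2 / D\<^sup>2) * (q - D)" using D by (simp add: power2_eq_square field_simps)
  also have "\<dots> < 0" using D \<open>l \<noteq> 0\<close> by (intro mult_pos_neg) auto
  finally show False by simp
qed

text \<open>Tychonoff's theorem. Controls are indexed by all prefixes, possibly infinitely many, so
  the compactness is that of the product topology.\<close>

lemma compact_bounded_functions: "compact {u :: 'i \<Rightarrow> real^'n. \<forall>l. norm (u l) \<le> b}"
proof -
  have "{u :: 'i \<Rightarrow> real^'n. \<forall>l. norm (u l) \<le> b} = PiE UNIV (\<lambda>_. cball 0 b)"
    by (auto simp: PiE_def Pi_def)
  moreover have "compactin (product_topology (\<lambda>_. euclidean) UNIV) (PiE UNIV (\<lambda>_::'i. cball (0::real^'n) b))"
    by (simp add: compactin_PiE compactin_euclidean_iff)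
  ultimately show ?thesis by (simp add: euclidean_product_topology compactin_euclidean_iff)
qed

locale stoch_lq =
  fixes P :: "(nat \<Rightarrow> 'a) pmf" and T :: nat
    and A :: "'a \<Rightarrow> real^'x^'x" and B :: "'a \<Rightarrow> real^'u^'x" and d :: "'a \<Rightarrow> real^'x"
    and Q :: "'a \<Rightarrow> real^'x^'x" and R :: "'a \<Rightarrow> real^'u^'u"
    and q :: "'a \<Rightarrow> real^'x" and r :: "'a \<Rightarrow> real^'u" and \<gamma> :: real
  assumes finite_P: "finite (set_pmf P)"
    and Q_sym: "transpose (Q \<xi>) = Q \<xi>"
    and R_sym: "transpose (R \<xi>) = R \<xi>"
    and Q_psd: "\<zeta> \<in> set_pmf P \<Longrightarrow> t \<le> T \<Longrightarrow> 0 \<le> x \<bullet> (Q (\<zeta> t) *v x)"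
    and R_pos: "\<zeta> \<in> set_pmf P \<Longrightarrow> t \<le> T \<Longrightarrow> \<gamma> * (norm v)\<^sup>2 \<le> v \<bullet> (R (\<zeta> t) *v v)"
    and gamma_pos: "0 < \<gamma>"
begin

text \<open>The state response to a control law. The control sees the prefix alone, whose length
  already determines the time; \<open>dd\<close> supplies the initial state at \<open>s\<close> and
  the drift afterwards.\<close>

primrec roll :: "(nat \<Rightarrow> 'a list \<Rightarrow> real^'x) \<Rightarrow> nat \<Rightarrow> ('a list \<Rightarrow> real^'u) \<Rightarrow> nat \<Rightarrow> 'a list \<Rightarrow> real^'x" where
  "roll dd s u 0 h = dd 0 h"
| "roll dd s u (Suc t) h = (if Suc t \<le> s then dd (Suc t) h
     else A (h ! Suc t) *v roll dd s u t (take (Suc t) h) + B (h ! Suc t) *v u (take (Suc t) h) + dd (Suc t) h)"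

definition policy :: "(nat \<Rightarrow> 'a list \<Rightarrow> real^'x) \<Rightarrow> nat \<Rightarrow> ('a list \<Rightarrow> real^'u) \<Rightarrow> nat \<Rightarrow> 'a list \<Rightarrow> (real^'x) \<times> (real^'u)" where
  "policy dd s u t h = (roll dd s u t h, u h)"

lemma roll_start: "roll dd s u s h = dd s h"
  by (cases s) auto

lemma roll_affine: "roll dd s (\<lambda>h. u h + c *\<^sub>R v h) t h = roll dd s u t h + c *\<^sub>R roll (\<lambda>_ _. 0) s v t h"
  by (induction t arbitrary: h)
    (auto simp: matrix_vector_right_distrib matrix_vector_mult_scaleR scaleR_add_right)

lemma policy_affine: "policy dd s (\<lambda>h. u h + c *\<^sub>R v h) t h = policy dd s u t h + c *\<^sub>R policy (\<lambda>_ _. 0) s v t h"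
  by (simp add: policy_def roll_affine)

lemma roll_cong:
  assumes "\<And>i. s \<le> i \<Longrightarrow> i < t \<Longrightarrow> u (pre \<zeta> i) = u' (pre \<zeta> i)"
  shows "roll dd s u t (pre \<zeta> t) = roll dd s u' t (pre \<zeta> t)"
  using assms by (induction t) auto

lemma continuous_on_roll: "continuous_on UNIV (\<lambda>u. roll dd s u t h)"
proof (induction t arbitrary: h)
  case (Suc t)
  have "continuous_on UNIV (\<lambda>u. A (h ! Suc t) *v roll dd s u t (take (Suc t) h))"
    by (rule continuous_on_compose2[OF linear_continuous_on[OF matrix_vector_mul_bounded_linear] Suc]) auto
  moreover have "continuous_on UNIV (\<lambda>u. B (h ! Suc t) *v u (take (Suc t) h))"
    by (rule continuous_on_compose2[OF linear_continuous_on[OF matrix_vector_mul_bounded_linear]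
          continuous_on_product_coordinates]) auto
  ultimately show ?case by (cases "Suc t \<le> s") (auto intro!: continuous_intros)
qed simp

context
  fixes \<tau> W :: nat and h :: "'a list" and wb :: "(real^'x) \<times> (real^'u)" and \<zeta>\<^sub>0 :: "nat \<Rightarrow> 'a"
  assumes h: "\<zeta>\<^sub>0 \<in> set_pmf P" "h = pre \<zeta>\<^sub>0 \<tau>" and tau: "\<tau> \<le> T"
begin

abbreviation "N \<equiv> min (\<tau> + W) T"
abbreviation "Ph \<equiv> cond_pmf P {\<zeta>. pre \<zeta> \<tau> = h}"
abbreviation "Sh \<equiv> {\<zeta> \<in> set_pmf P. pre \<zeta> \<tau> = h}"

lemma set_Ph: "set_pmf Ph = Sh"
  using h by (subst set_cond_pmf) auto

lemma finite_Sh: "finite Sh" using finite_P by simp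

lemma cost_eq: "trunc_cost P T Q R q r \<tau> W h w
    = (\<Sum>\<zeta>\<in>Sh. pmf Ph \<zeta> * (\<Sum>t=\<tau>..N. stage_cost Q R q r (w t (pre \<zeta> t)) (\<zeta> t)))"
  unfolding trunc_cost_def using set_Ph
  by (subst integral_measure_pmf_real[OF finite_Sh]) (auto simp: mult.commute)

lemma cost_expand: "trunc_cost P T Q R q r \<tau> W h (\<lambda>t h. w t h + c *\<^sub>R v t h) = trunc_cost P T Q R q r \<tau> W h w
    + c * (\<Sum>\<zeta>\<in>Sh. pmf Ph \<zeta> * (\<Sum>t=\<tau>..N. variation (Q (\<zeta> t)) (R (\<zeta> t)) (q (\<zeta> t)) (r (\<zeta> t)) (w t (pre \<zeta> t)) (v t (pre \<zeta> t))))
    + c\<^sup>2 * (\<Sum>\<zeta>\<in>Sh. pmf Ph \<zeta> * (\<Sum>t=\<tau>..N. quad (Q (\<zeta> t)) (R (\<zeta> t)) (v t (pre \<zeta> t))))"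
  unfolding cost_eq stage_cost_expand[where Q=Q and R=R, OF Q_sym R_sym]
  by (simp add: sum.distrib sum_distrib_left algebra_simps)

text \<open>Any multiple of \<open>v\<close> may be added to a feasible policy without losing
  feasibility, and along this line the cost is a quadratic polynomial minimal at 0.\<close>

lemma trunc_opt_first_order:
  assumes opt: "trunc_opt P T A B d Q R q r \<tau> W h wb w"
    and v: "\<And>\<zeta>. \<zeta> \<in> Sh \<Longrightarrow> fst (v \<tau> (pre \<zeta> \<tau>)) = 0"
      "\<And>\<zeta> t. \<zeta> \<in> Sh \<Longrightarrow> \<tau> \<le> t \<Longrightarrow> t < N \<Longrightarrow> fst (v (Suc t) (pre \<zeta> (Suc t)))
        = A (\<zeta> (Suc t)) *v fst (v t (pre \<zeta> t)) + B (\<zeta> (Suc t)) *v snd (v t (pre \<zeta> t))"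
  shows "(\<Sum>\<zeta>\<in>Sh. pmf Ph \<zeta> * (\<Sum>t=\<tau>..N.
      variation (Q (\<zeta> t)) (R (\<zeta> t)) (q (\<zeta> t)) (r (\<zeta> t)) (w t (pre \<zeta> t)) (v t (pre \<zeta> t)))) = 0"
proof (rule quadratic_nonneg_imp_linear_zero)
  fix c :: real
  let ?w = "\<lambda>t h. w t h + c *\<^sub>R v t h"
  have feas: "trunc_feasible P T A B d \<tau> W h wb w" using opt by (simp add: trunc_opt_def)
  have "trunc_feasible P T A B d \<tau> W h wb ?w"
    unfolding trunc_feasible_def
  proof (intro conjI ballI impI)
    show "fst (?w \<tau> h) = dyn A B d wb (h ! \<tau>)"
      using feas v(1)[of \<zeta>\<^sub>0] h by (simp add: trunc_feasible_def)
    fix \<zeta> t assume \<zeta>: "\<zeta> \<in> set_pmf P" "pre \<zeta> \<tau> = h" and t: "t \<in> {Suc \<tau>..N}"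
    obtain i where i: "t = Suc i" "\<tau> \<le> i" "i < N" using t by (cases t) auto
    have "fst (w t (pre \<zeta> t)) = dyn A B d (w (t - 1) (pre \<zeta> (t - 1))) (\<zeta> t)"
      using feas \<zeta> t unfolding trunc_feasible_def by blast
    then show "fst (?w t (pre \<zeta> t)) = dyn A B d (?w (t - 1) (pre \<zeta> (t - 1))) (\<zeta> t)"
      using v(2)[of \<zeta> i] \<zeta> i
      by (simp add: dyn_def matrix_vector_right_distrib matrix_vector_mult_scaleR scaleR_add_right)
  qed
  then have "trunc_cost P T Q R q r \<tau> W h w \<le> trunc_cost P T Q R q r \<tau> W h ?w"
    using opt by (simp add: trunc_opt_def)
  then show "0 \<le> c * (\<Sum>\<zeta>\<in>Sh. pmf Ph \<zeta> * (\<Sum>t=\<tau>..N.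
      variation (Q (\<zeta> t)) (R (\<zeta> t)) (q (\<zeta> t)) (r (\<zeta> t)) (w t (pre \<zeta> t)) (v t (pre \<zeta> t))))
    + c\<^sup>2 * (\<Sum>\<zeta>\<in>Sh. pmf Ph \<zeta> * (\<Sum>t=\<tau>..N. quad (Q (\<zeta> t)) (R (\<zeta> t)) (v t (pre \<zeta> t))))"
    unfolding cost_expand by simp
qed

definition "drift t l = (if t = \<tau> then dyn A B d wb (h ! \<tau>) else d (l ! t))"

lemma policy_feasible: "trunc_feasible P T A B d \<tau> W h wb (policy drift \<tau> u)"
  unfolding trunc_feasible_def
proof (intro conjI ballI impI)
  show "fst (policy drift \<tau> u \<tau> h) = dyn A B d wb (h ! \<tau>)"
    by (simp add: policy_def roll_start drift_def)
  fix \<zeta> t assume "t \<in> {Suc \<tau>..N}"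
  then obtain i where i: "t = Suc i" "\<tau> \<le> i" by (cases t) auto
  then show "fst (policy drift \<tau> u t (pre \<zeta> t)) = dyn A B d (policy drift \<tau> u (t - 1) (pre \<zeta> (t - 1))) (\<zeta> t)"
    by (simp add: policy_def drift_def dyn_def)
qed

text \<open>On the prefixes that the problem sees, the controls determine the states. Eliminating
  the states leaves a minimisation over controls without constraints.\<close>

lemma feasible_eq_policy:
  assumes feas: "trunc_feasible P T A B d \<tau> W h wb w" and \<zeta>: "\<zeta> \<in> Sh" and t: "\<tau> \<le> t" "t \<le> N"
  shows "w t (pre \<zeta> t) = policy drift \<tau> (\<lambda>l. snd (w (length l - 1) l)) t (pre \<zeta> t)"
proof -
  have "fst (w t (pre \<zeta> t)) = roll drift \<tau> (\<lambda>l. snd (w (length l - 1) l)) t (pre \<zeta> t)"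
    using t
  proof (induction t rule: dec_induct)
    case base
    then show ?case using feas \<zeta> by (auto simp: roll_start drift_def trunc_feasible_def)
  next
    case (step i)
    have "Suc i \<in> {Suc \<tau>..N}" using step by simp
    then have "fst (w (Suc i) (pre \<zeta> (Suc i))) = dyn A B d (w i (pre \<zeta> i)) (\<zeta> (Suc i))"
      using feas \<zeta> unfolding trunc_feasible_def by force
    then show ?case using step by (simp add: dyn_def drift_def)
  qed
  then show ?thesis by (simp add: policy_def prod_eq_iff)
qed

section \<open>Minimisation over the controls\<close>

definition "J u = trunc_cost P T Q R q r \<tau> W h (policy drift \<tau> u)"

lemma continuous_on_J: "continuous_on UNIV J"
proof -
  have x: "continuous_on UNIV (\<lambda>u. roll dd s u t l)" for dd s t l by (rule continuous_on_roll)
  have u: "continuous_on UNIV (\<lambda>u. (u l) :: real^'u)" for l :: "'a list"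
    by (rule continuous_on_product_coordinates)
  have Mx: "continuous_on UNIV (\<lambda>u. M *v roll dd s u t l)" for M :: "real^'x^'x" and dd s t l
    by (rule continuous_on_compose2[OF linear_continuous_on[OF matrix_vector_mul_bounded_linear] x]) auto
  have Mu: "continuous_on UNIV (\<lambda>u. M *v ((u l) :: real^'u))" for M :: "real^'u^'u" and l :: "'a list"
    by (rule continuous_on_compose2[OF linear_continuous_on[OF matrix_vector_mul_bounded_linear] u]) auto
  show ?thesis
    unfolding J_def cost_eq stage_cost_def policy_def fst_conv snd_conv
    by (intro continuous_intros x u Mx Mu)
qed

lemma J_cong:
  assumes "\<And>\<zeta> t. \<zeta> \<in> Sh \<Longrightarrow> \<tau> \<le> t \<Longrightarrow> t \<le> N \<Longrightarrow> u (pre \<zeta> t) = u' (pre \<zeta> t)"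
  shows "J u = J u'"
  unfolding J_def cost_eq
proof (intro sum.cong refl arg_cong2[where f="(*)"])
  fix \<zeta> t assume \<zeta>: "\<zeta> \<in> Sh" and t: "t \<in> {\<tau>..N}"
  have "roll drift \<tau> u t (pre \<zeta> t) = roll drift \<tau> u' t (pre \<zeta> t)"
    using assms[OF \<zeta>] t by (intro roll_cong) auto
  then show "stage_cost Q R q r (policy drift \<tau> u t (pre \<zeta> t)) (\<zeta> t) = stage_cost Q R q r (policy drift \<tau> u' t (pre \<zeta> t)) (\<zeta> t)"
    using assms[OF \<zeta>, of t] t by (simp add: policy_def)
qed

text \<open>The lower bound on \<open>p\<close> is the coercivity given by \<open>R_pos\<close> and
  \<open>Q_psd\<close>; it is stated for each prefix separately so that the largest control can be
  singled out.\<close>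

lemma J_ray:
  obtains l p where "\<And>c. J (\<lambda>h. c *\<^sub>R v h) = J (\<lambda>_. 0) + c * l + c\<^sup>2 * p"
    "\<And>\<zeta> t. \<zeta> \<in> Sh \<Longrightarrow> \<tau> \<le> t \<Longrightarrow> t \<le> N \<Longrightarrow> (\<gamma> / 2) * pmf Ph \<zeta> * (norm (v (pre \<zeta> t)))\<^sup>2 \<le> p"
proof
  let ?v = "policy (\<lambda>_ _. 0) \<tau> v"
  show "J (\<lambda>h. c *\<^sub>R v h) = J (\<lambda>_. 0)
    + c * (\<Sum>\<zeta>\<in>Sh. pmf Ph \<zeta> * (\<Sum>t=\<tau>..N. variation (Q (\<zeta> t)) (R (\<zeta> t)) (q (\<zeta> t)) (r (\<zeta> t)) (policy drift \<tau> (\<lambda>_. 0) t (pre \<zeta> t)) (?v t (pre \<zeta> t))))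
    + c\<^sup>2 * (\<Sum>\<zeta>\<in>Sh. pmf Ph \<zeta> * (\<Sum>t=\<tau>..N. quad (Q (\<zeta> t)) (R (\<zeta> t)) (?v t (pre \<zeta> t))))" for c
    unfolding J_def cost_expand[symmetric] policy_affine[symmetric] by simp
  have quad_ge: "\<gamma> / 2 * (norm (v (pre \<zeta> t)))\<^sup>2 \<le> quad (Q (\<zeta> t)) (R (\<zeta> t)) (?v t (pre \<zeta> t))"
    if "\<zeta> \<in> Sh" "t \<le> N" for \<zeta> t
    using Q_psd[of \<zeta> t "fst (?v t (pre \<zeta> t))"] R_pos[of \<zeta> t "v (pre \<zeta> t)"] that
    by (simp add: quad_def policy_def)
  have quad_nn: "0 \<le> quad (Q (\<zeta> t)) (R (\<zeta> t)) (?v t (pre \<zeta> t))" if "\<zeta> \<in> Sh" "t \<le> N" for \<zeta> t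
    by (rule order_trans[OF _ quad_ge[OF that]]) (use gamma_pos in simp)
  fix \<zeta> t assume \<zeta>: "\<zeta> \<in> Sh" and t: "\<tau> \<le> t" "t \<le> N"
  have "(\<gamma> / 2) * pmf Ph \<zeta> * (norm (v (pre \<zeta> t)))\<^sup>2 = pmf Ph \<zeta> * ((\<gamma> / 2) * (norm (v (pre \<zeta> t)))\<^sup>2)"
    by simp
  also have "\<dots> \<le> pmf Ph \<zeta> * quad (Q (\<zeta> t)) (R (\<zeta> t)) (?v t (pre \<zeta> t))"
    by (intro mult_left_mono quad_ge \<zeta> t) auto
  also have "\<dots> \<le> pmf Ph \<zeta> * (\<Sum>t=\<tau>..N. quad (Q (\<zeta> t)) (R (\<zeta> t)) (?v t (pre \<zeta> t)))"
    using t \<zeta> quad_nn by (intro mult_left_mono member_le_sum[of t]) auto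
  also have "\<dots> \<le> (\<Sum>\<zeta>\<in>Sh. pmf Ph \<zeta> * (\<Sum>t=\<tau>..N. quad (Q (\<zeta> t)) (R (\<zeta> t)) (?v t (pre \<zeta> t))))"
    using \<zeta> quad_nn finite_Sh
    by (intro member_le_sum[of \<zeta> Sh "\<lambda>\<zeta>. pmf Ph \<zeta> * (\<Sum>t=\<tau>..N. quad (Q (\<zeta> t)) (R (\<zeta> t)) (?v t (pre \<zeta> t)))"])
      (auto intro!: mult_nonneg_nonneg sum_nonneg)
  finally show "(\<gamma> / 2) * pmf Ph \<zeta> * (norm (v (pre \<zeta> t)))\<^sup>2
      \<le> (\<Sum>\<zeta>\<in>Sh. pmf Ph \<zeta> * (\<Sum>t=\<tau>..N. quad (Q (\<zeta> t)) (R (\<zeta> t)) (?v t (pre \<zeta> t))))" .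
qed

text \<open>On a ray \<open>J\<close> is a quadratic polynomial whose leading coefficient is bounded below on the unit
  sphere of the finitely many relevant controls; with a lower bound of \<open>J\<close> on the compact unit ball
  this forces the infimum to be attained on a compact ball.\<close>

lemma J_attains_min: "\<exists>u. \<forall>u'. J u \<le> J u'"
proof -
  define I where "I = (\<lambda>(\<zeta>, t). pre \<zeta> t) ` (Sh \<times> {\<tau>..N})"
  have fin: "finite I" unfolding I_def using finite_Sh by simp
  define U where "U b = {u :: 'a list \<Rightarrow> real^'u. \<forall>l. norm (u l) \<le> b}" for b
  have minU: "\<exists>u\<in>U b. \<forall>u'\<in>U b. J u \<le> J u'" if "0 \<le> b" for b
    unfolding U_def using that
    by (intro continuous_attains_inf compact_bounded_functions continuous_on_subset[OF continuous_on_J])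
      (auto intro: exI[of _ "\<lambda>_. 0"])
  obtain u1 where u1: "\<forall>u'\<in>U 1. J u1 \<le> J u'" using minU[of 1] by auto
  define pm where "pm = Min (pmf Ph ` Sh)"
  have Sh_ne: "Sh \<noteq> {}" using h by auto
  have pm: "0 < pm" "\<And>\<zeta>. \<zeta> \<in> Sh \<Longrightarrow> pm \<le> pmf Ph \<zeta>"
    unfolding pm_def using finite_Sh Sh_ne set_Ph
    by (auto simp: Min_gr_iff pmf_positive_iff)
  define c0 where "c0 = \<gamma> / 2 * pm"
  have c0: "0 < c0" using gamma_pos pm by (simp add: c0_def)
  let ?z = "\<lambda>_. 0 :: real^'u"
  \<comment> \<open>Chosen so that at any radius \<open>b > b0\<close> the growth
    \<open>(b - 1) * c0\<close> outweighs the possible drop from \<open>J ?z\<close> to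
    \<open>J u1\<close>.\<close>
  define b0 where "b0 = 2 + \<bar>J ?z - J u1\<bar> / c0"
  have b0: "2 \<le> b0" unfolding b0_def using c0 by simp
  obtain u where u: "\<forall>u'\<in>U b0. J u \<le> J u'" using minU[of b0] b0 by auto
  show ?thesis
  proof (intro exI allI)
    fix u' :: "'a list \<Rightarrow> real^'u"
    \<comment> \<open>\<open>J\<close> does not see controls off \<open>I\<close>; setting them to 0
      leaves finitely many entries, so that a largest one exists.\<close>
    define u2 where "u2 l = (if l \<in> I then u' l else 0)" for l
    have J2: "J u' = J u2" by (rule J_cong) (auto simp: u2_def I_def)
    show "J u \<le> J u'"
    proof (cases "u2 \<in> U b0")
      case True
      then show ?thesis using u J2 by simp
    next
      case False
      then obtain l0 where "b0 < norm (u2 l0)" by (auto simp: U_def not_le)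
      then have l0: "l0 \<in> I" "b0 < norm (u2 l0)" using b0 by (auto simp: u2_def split: if_splits)
      define b where "b = Max ((\<lambda>l. norm (u2 l)) ` I)"
      have "b \<in> (\<lambda>l. norm (u2 l)) ` I" unfolding b_def using fin l0 by (intro Max_in) auto
      then obtain l1 where l1: "l1 \<in> I" "norm (u2 l1) = b" by auto
      have bI: "norm (u2 l) \<le> b" if "l \<in> I" for l unfolding b_def using fin that by (intro Max_ge) auto
      have b: "b0 < b" using bI[OF l0(1)] l0(2) by simp
      then have ball: "norm (u2 l) \<le> b" for l using bI[of l] b0 by (cases "l \<in> I") (auto simp: u2_def)
      define v where "v l = (1 / b) *\<^sub>R u2 l" for l
      have bp: "2 < b" using b b0 by simp
      obtain \<zeta> t where \<zeta>: "\<zeta> \<in> Sh" "\<tau> \<le> t" "t \<le> N" "l1 = pre \<zeta> t" using l1 unfolding I_def by auto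
      obtain l p where ray: "\<And>c. J (\<lambda>h. c *\<^sub>R v h) = J ?z + c * l + c\<^sup>2 * p"
        and p': "\<And>\<zeta> t. \<zeta> \<in> Sh \<Longrightarrow> \<tau> \<le> t \<Longrightarrow> t \<le> N \<Longrightarrow> (\<gamma> / 2) * pmf Ph \<zeta> * (norm (v (pre \<zeta> t)))\<^sup>2 \<le> p"
        by (rule J_ray[of v]) (rule that)
      have p: "(\<gamma> / 2) * pmf Ph \<zeta> * (norm (v (pre \<zeta> t)))\<^sup>2 \<le> p" by (rule p'[OF \<zeta>(1-3)])
      have "norm (v (pre \<zeta> t)) = 1" using l1 \<zeta> bp by (simp add: v_def)
      then have "(\<gamma> / 2) * pmf Ph \<zeta> \<le> p" using p by simp
      moreover have "c0 \<le> (\<gamma> / 2) * pmf Ph \<zeta>"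
        unfolding c0_def using pm \<zeta> gamma_pos by (intro mult_left_mono) auto
      ultimately have p0: "c0 \<le> p" by simp
      have "v \<in> U 1" unfolding U_def v_def using ball bp by (auto simp: divide_le_eq_1)
      then have "J u1 \<le> J (\<lambda>h. 1 *\<^sub>R v h)" using u1 by simp
      \<comment> \<open>The lower bound of \<open>J\<close> on the unit ball, read at parameter 1 of
        the ray, bounds the slope \<open>l\<close> from below.\<close>
      then have l: "J u1 - J ?z - p \<le> l" unfolding ray by simp
      have "J u2 = J (\<lambda>h. b *\<^sub>R v h)" using bp by (simp add: v_def)
      also have "\<dots> = J ?z + b * l + b\<^sup>2 * p" by (rule ray)
      also have "\<dots> \<ge> J ?z + b * (J u1 - J ?z - p) + b\<^sup>2 * p"
        using l bp by (intro add_right_mono add_left_mono mult_left_mono) auto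
      also have "J ?z + b * (J u1 - J ?z - p) + b\<^sup>2 * p = J ?z + b * ((J u1 - J ?z) + (b - 1) * p)"
        by (simp add: power2_eq_square algebra_simps)
      finally have "J ?z + b * ((J u1 - J ?z) + (b - 1) * p) \<le> J u2" .
      moreover have "0 \<le> (J u1 - J ?z) + (b - 1) * p"
      proof -
        have "\<bar>J ?z - J u1\<bar> / c0 \<le> b - 1" using b by (simp add: b0_def)
        then have "\<bar>J ?z - J u1\<bar> \<le> (b - 1) * c0" using c0 by (simp add: field_simps)
        also have "\<dots> \<le> (b - 1) * p" using p0 bp by (intro mult_left_mono) auto
        finally show ?thesis by linarith
      qed
      ultimately have "J ?z \<le> J u2" using bp
        by (smt (verit) mult_nonneg_nonneg)
      moreover have "J u \<le> J ?z" using u b0 by (simp add: U_def)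
      ultimately show ?thesis using J2 by simp
    qed
  qed
qed

text \<open>Existence makes the choice operator in \<open>spc_first\<close> return an actual
  minimiser, whose feasibility and first-order condition are then available.\<close>

theorem trunc_opt_exists: "\<exists>w. trunc_opt P T A B d Q R q r \<tau> W h wb w"
proof -
  obtain u where u: "\<And>u'. J u \<le> J u'" using J_attains_min by blast
  have "trunc_opt P T A B d Q R q r \<tau> W h wb (policy drift \<tau> u)"
    unfolding trunc_opt_def
  proof (intro conjI allI impI policy_feasible)
    fix w assume w: "trunc_feasible P T A B d \<tau> W h wb w"
    have "trunc_cost P T Q R q r \<tau> W h w = J (\<lambda>l. snd (w (length l - 1) l))"
      unfolding J_def cost_eq using feasible_eq_policy[OF w] by (intro sum.cong refl arg_cong2[where f="(*)"]) auto
    then show "trunc_cost P T Q R q r \<tau> W h (policy drift \<tau> u) \<le> trunc_cost P T Q R q r \<tau> W h w"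
      using u by (simp add: J_def)
  qed
  then show ?thesis by blast
qed

end
end

section \<open>The closed-loop recursion and the constants\<close>

lemma tdist_commute: "tdist t t' = tdist t' t"
  by (simp add: tdist_def)

lemma tdist_triangle: "tdist i k \<le> tdist i j + tdist j k"
  by (auto simp: tdist_def)

text \<open>\<open>a s\<close> measures the implemented decision, \<open>y0\<close> the first
  prediction, \<open>e s t\<close> the change at \<open>t\<close> from prediction \<open>s\<close>
  to \<open>s + 1\<close>, and \<open>yy s\<close> prediction \<open>s\<close> at its horizon. As
  \<open>yy s\<close> refers back to \<open>a s\<close> with \<open>s < t\<close>, a strong
  induction closes once the feedback coefficient is at most 1/2; the other half of \<open>c\<close>
  pays for the data.\<close>

lemma closed_loop_recursion:
  fixes a y0 p yy :: "nat \<Rightarrow> real" and e :: "nat \<Rightarrow> nat \<Rightarrow> real" and \<kappa> b C L c nw :: real and W T :: nat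
  assumes kap: "1/2 \<le> \<kappa>" "\<kappa> < 1" and b: "b = \<kappa> ^ 6" and C: "1 \<le> C" and L: "1 \<le> L" and W: "1 \<le> W"
    and p: "\<And>t. 0 \<le> p t" and nw: "0 \<le> nw"
    and c: "13 * L * C\<^sup>2 / (1 - \<kappa>) \<le> c / 2" "2 * L * C\<^sup>2 * \<kappa> ^ (4 * W) / (1 - \<kappa>) \<le> 1 / 2"
    and a: "\<And>t. t \<le> T \<Longrightarrow> a t \<le> y0 t + (\<Sum>s<t. e s t)"
    and y0: "\<And>t. t \<le> T \<Longrightarrow> y0 t \<le> C * (b ^ t * (2 * L * nw + p 0) + 2 * (\<Sum>t'\<le>T. b ^ tdist t t' * p t'))"
    and e: "\<And>s t. s < t \<Longrightarrow> t \<le> T \<Longrightarrow> e s t \<le> (if s + W + 1 \<le> T \<and> t \<le> s + W + 1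
      then C * b ^ (s + W + 1 - t) * (2 * p (s + W + 1) + 2 * L * yy s) else 0)"
    and yy: "\<And>s. s + W + 1 \<le> T \<Longrightarrow> yy s \<le> C * (b ^ W * a s + 2 * (\<Sum>t'\<le>T. b ^ tdist (s + W) t' * p t'))"
  shows "t \<le> T \<Longrightarrow> a t \<le> c * (2 * L * \<kappa> ^ t * nw + (\<Sum>t'\<le>T. \<kappa> ^ tdist t t' * p t'))"
proof -
  define G where "G t = 2 * L * \<kappa> ^ t * nw + (\<Sum>t'\<le>T. \<kappa> ^ tdist t t' * p t')" for t
  have k0: "0 < \<kappa>" "0 \<le> \<kappa>" "\<kappa> \<le> 1" using kap by auto
  have b0: "0 < b" "b \<le> \<kappa>" "b \<le> 1"
    using k0 power_decreasing[of 1 6 \<kappa>] by (auto simp: b power_le_one)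
  have G0: "0 \<le> G t" for t unfolding G_def using L nw p k0 by (auto intro!: add_nonneg_nonneg sum_nonneg)
  have bsum: "(\<Sum>t'\<le>T. b ^ tdist t t' * p t') \<le> G t" for t
  proof -
    have "(\<Sum>t'\<le>T. b ^ tdist t t' * p t') \<le> (\<Sum>t'\<le>T. \<kappa> ^ tdist t t' * p t')"
      using b0 p by (intro sum_mono mult_right_mono power_mono) auto
    moreover have "0 \<le> 2 * L * \<kappa> ^ t * nw" using L nw k0 by simp
    ultimately show ?thesis unfolding G_def by linarith
  qed
  \<comment> \<open>\<open>G\<close> changes by at most a factor \<open>1 / \<kappa>\<close> per
    stage, so powers of \<kappa> can be spent to move \<open>G\<close> from one time to
    another.\<close>
  have G_lip: "\<kappa> ^ tdist s t * G s \<le> G t" for s t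
  proof -
    have pw: "\<kappa> ^ tdist s t * \<kappa> ^ i \<le> \<kappa> ^ j" if "j \<le> tdist s t + i" for i j
      unfolding power_add[symmetric] using k0 that by (intro power_decreasing) auto
    have "\<kappa> ^ tdist s t * G s = 2 * L * nw * (\<kappa> ^ tdist s t * \<kappa> ^ s) + (\<Sum>t'\<le>T. (\<kappa> ^ tdist s t * \<kappa> ^ tdist s t') * p t')"
      unfolding G_def by (simp add: distrib_left sum_distrib_left mult_ac)
    also have "\<dots> \<le> 2 * L * nw * \<kappa> ^ t + (\<Sum>t'\<le>T. \<kappa> ^ tdist t t' * p t')"
    proof (intro add_mono mult_left_mono sum_mono mult_right_mono pw p)
      show "t \<le> tdist s t + s" by (simp add: tdist_def)
      show "tdist t t' \<le> tdist s t + tdist s t'" for t'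
        using tdist_triangle[of t t' s] by (simp add: tdist_commute)
    qed (use L nw in simp)
    also have "\<dots> = G t" by (simp add: G_def mult_ac)
    finally show ?thesis .
  qed
  have pG: "p t \<le> G t" if "t \<le> T" for t
  proof -
    have "p t = \<kappa> ^ tdist t t * p t" by (simp add: tdist_def)
    also have "\<dots> \<le> (\<Sum>t'\<le>T. \<kappa> ^ tdist t t' * p t')"
      using that k0 p by (intro member_le_sum) auto
    also have "\<dots> \<le> G t" unfolding G_def using L nw k0 by simp
    finally show ?thesis .
  qed
  have c0: "0 \<le> c"
  proof -
    have "0 \<le> 13 * L * C\<^sup>2 / (1 - \<kappa>)" using L kap by simp
    then show ?thesis using c(1) by linarith
  qed
  have "a t \<le> c * G t" if "t \<le> T" for t
    using that
  proof (induction t rule: less_induct)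
    case (less t)
    have y0G: "y0 t \<le> 3 * C * G t"
    proof -
      have "b ^ t * (2 * L * nw + p 0) \<le> \<kappa> ^ t * (2 * L * nw + p 0)"
        using b0 L nw p[of 0] by (intro mult_right_mono power_mono) auto
      also have "\<dots> = 2 * L * \<kappa> ^ t * nw + \<kappa> ^ tdist t 0 * p 0" by (simp add: algebra_simps tdist_def)
      also have "\<dots> \<le> G t" unfolding G_def using p k0 by (intro add_left_mono member_le_sum) auto
      finally have 1: "b ^ t * (2 * L * nw + p 0) \<le> G t" .
      have "y0 t \<le> C * (b ^ t * (2 * L * nw + p 0) + 2 * (\<Sum>t'\<le>T. b ^ tdist t t' * p t'))"
        by (rule y0[OF less.prems])
      also have "\<dots> \<le> C * (G t + 2 * G t)"
        using 1 bsum[of t] C by (intro mult_left_mono add_mono) auto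
      finally show ?thesis by simp
    qed
    \<comment> \<open>\<open>2 * C\<close> comes from the datum entering the window,
      \<open>8 * L * C\<^sup>2\<close> from the data part of the old prediction at its horizon, and
      the last term from the induction hypothesis.\<close>
    define H where "H = 2 * C + 8 * L * C\<^sup>2 + 2 * L * C\<^sup>2 * c * \<kappa> ^ (4 * W)"
    have H0: "0 \<le> H" unfolding H_def using C L c0 k0 by simp
    have eG: "e s t \<le> (if t \<le> s + W + 1 then \<kappa> ^ (s + W + 1 - t) * (H * G t) else 0)" if s: "s < t" for s
    proof (cases "s + W + 1 \<le> T \<and> t \<le> s + W + 1")
      case False
      then show ?thesis using e[OF s less.prems] H0 G0[of t] k0
        by (smt (verit) mult_nonneg_nonneg zero_le_power)
    next
      case True
      define j where "j = s + W + 1 - t"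
      have j: "s + W + 1 = t + j" "t - s + j = W + 1" using True s by (auto simp: j_def)
      have td: "tdist (s + W + 1) t = j" using True by (simp add: tdist_def j_def)
      have bj: "b ^ j = \<kappa> ^ (6 * j)" by (simp add: b power_mult)
      have pj: "b ^ j * p (s + W + 1) \<le> \<kappa> ^ j * G t"
      proof -
        have "b ^ j * p (s + W + 1) \<le> \<kappa> ^ (j + j) * G (s + W + 1)"
          unfolding bj using pG[of "s + W + 1"] True p k0 by (intro mult_mono power_decreasing) auto
        also have "\<dots> = \<kappa> ^ j * (\<kappa> ^ tdist (s + W + 1) t * G (s + W + 1))"
          unfolding td by (simp only: power_add mult.assoc)
        also have "\<dots> \<le> \<kappa> ^ j * G t" using G_lip k0 by (intro mult_left_mono) auto
        finally show ?thesis .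
      qed
      have Gj: "b ^ j * G (s + W) \<le> 2 * (\<kappa> ^ j * G t)"
      proof -
        have "b ^ j * G (s + W) \<le> 2 * \<kappa> ^ (j + tdist (s + W) t) * G (s + W)"
        proof (intro mult_right_mono G0)
          show "b ^ j \<le> 2 * \<kappa> ^ (j + tdist (s + W) t)"
          proof (cases j)
            \<comment> \<open>Here \<open>t\<close> lies one stage past the old horizon and there is
              no decay to spend; \<kappa> \<ge> 1/2 and the factor 2 cover this single step.\<close>
            case 0
            then have "tdist (s + W) t = 1" using j by (simp add: tdist_def)
            then show ?thesis using 0 kap by simp
          next
            case (Suc i)
            then have "tdist (s + W) t = i" using j by (simp add: tdist_def)
            then have "b ^ j \<le> \<kappa> ^ (j + tdist (s + W) t)"
              unfolding bj using Suc k0 by (intro power_decreasing) auto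
            also have "\<dots> \<le> 2 * \<dots>" using k0 by simp
            finally show ?thesis .
          qed
        qed
        also have "\<dots> = 2 * (\<kappa> ^ j * (\<kappa> ^ tdist (s + W) t * G (s + W)))" by (simp add: power_add)
        also have "\<dots> \<le> 2 * (\<kappa> ^ j * G t)" using G_lip k0 by (intro mult_left_mono) auto
        finally show ?thesis .
      qed
      have aj: "b ^ j * (b ^ W * a s) \<le> c * \<kappa> ^ (4 * W) * (\<kappa> ^ j * G t)"
      proof -
        have as: "a s \<le> c * G s" using less.IH[OF s] s less.prems by simp
        have "b ^ j * (b ^ W * a s) = \<kappa> ^ (6 * j + 6 * W) * a s"
          by (simp add: b power_mult[symmetric] power_add mult.assoc)
        also have "\<dots> \<le> \<kappa> ^ (6 * j + 6 * W) * (c * G s)" using as k0 by (intro mult_left_mono) auto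
        \<comment> \<open>With \<open>t - s = W + 1 - j\<close> the left exponent exceeds the right
          one by \<open>6 * j + W - 1\<close>, which is nonnegative because 1 \<le> W.\<close>
        also have "\<dots> \<le> \<kappa> ^ (4 * W + j + tdist s t) * (c * G s)"
          using k0 c0 G0[of s] j s W by (intro mult_right_mono power_decreasing) (auto simp: tdist_def)
        also have "\<dots> = c * \<kappa> ^ (4 * W) * (\<kappa> ^ j * (\<kappa> ^ tdist s t * G s))" by (simp add: power_add)
        also have "\<dots> \<le> c * \<kappa> ^ (4 * W) * (\<kappa> ^ j * G t)"
          using G_lip k0 c0 by (intro mult_left_mono) auto
        finally show ?thesis .
      qed
      have "b ^ j * yy s \<le> b ^ j * (C * (b ^ W * a s + 2 * (\<Sum>t'\<le>T. b ^ tdist (s + W) t' * p t')))"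
        using yy[of s] True b0 by (intro mult_left_mono) auto
      also have "\<dots> \<le> b ^ j * (C * (b ^ W * a s + 2 * G (s + W)))"
        using bsum[of "s + W"] b0 C by (intro mult_left_mono add_left_mono) auto
      also have "\<dots> = C * (b ^ j * (b ^ W * a s) + 2 * (b ^ j * G (s + W)))" by (simp add: algebra_simps)
      also have "\<dots> \<le> C * (c * \<kappa> ^ (4 * W) * (\<kappa> ^ j * G t) + 2 * (2 * (\<kappa> ^ j * G t)))"
        using aj Gj C by (intro mult_left_mono add_mono) auto
      finally have yj: "b ^ j * yy s \<le> C * (c * \<kappa> ^ (4 * W) * (\<kappa> ^ j * G t) + 2 * (2 * (\<kappa> ^ j * G t)))" .
      have "e s t \<le> C * b ^ j * (2 * p (s + W + 1) + 2 * L * yy s)"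
        using e[OF s less.prems] True by (simp add: j_def)
      also have "\<dots> = C * (2 * (b ^ j * p (s + W + 1)) + 2 * L * (b ^ j * yy s))" by (simp add: algebra_simps)
      also have "\<dots> \<le> C * (2 * (\<kappa> ^ j * G t) + 2 * L * (C * (c * \<kappa> ^ (4 * W) * (\<kappa> ^ j * G t) + 2 * (2 * (\<kappa> ^ j * G t)))))"
        using pj yj C L by (intro mult_left_mono add_mono) auto
      also have "\<dots> = \<kappa> ^ j * (H * G t)" by (simp add: H_def power2_eq_square algebra_simps)
      finally show ?thesis using True by (simp add: j_def)
    qed
    have "(\<Sum>s<t. e s t) \<le> (\<Sum>s<t. if t \<le> s + W + 1 then \<kappa> ^ (s + W + 1 - t) * (H * G t) else 0)"
      using eG by (intro sum_mono) auto
    also have "\<dots> = (\<Sum>s\<in>{s\<in>{..<t}. t \<le> s + W + 1}. \<kappa> ^ (s + W + 1 - t)) * (H * G t)"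
      unfolding sum_distrib_right by (intro sum.mono_neutral_cong_right) auto
    also have "\<dots> \<le> 1 / (1 - \<kappa>) * (H * G t)"
      using k0 kap H0 G0[of t] by (intro mult_right_mono geometric_sum_le) (auto intro!: inj_onI)
    finally have "a t \<le> 3 * C * G t + 1 / (1 - \<kappa>) * (H * G t)"
      using a[OF less.prems] y0G by linarith
    also have "\<dots> = (3 * C + H / (1 - \<kappa>)) * G t" by (simp add: algebra_simps)
    also have "\<dots> \<le> c * G t"
    proof (rule mult_right_mono[OF _ G0])
      have i: "1 \<le> 1 / (1 - \<kappa>)" using k0 kap by simp
      have "3 * C \<le> 3 * C * (1 / (1 - \<kappa>))" using mult_left_mono[OF i, of "3 * C"] C by simp
      moreover have "H / (1 - \<kappa>) = (2 * C + 8 * L * C\<^sup>2) * (1 / (1 - \<kappa>)) + c * (2 * L * C\<^sup>2 * \<kappa> ^ (4 * W) / (1 - \<kappa>))"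
        by (simp add: H_def add_divide_distrib mult_ac)
      moreover have "c * (2 * L * C\<^sup>2 * \<kappa> ^ (4 * W) / (1 - \<kappa>)) \<le> c * (1 / 2)"
        by (intro mult_left_mono c c0)
      ultimately have "3 * C + H / (1 - \<kappa>) \<le> 3 * C * (1 / (1 - \<kappa>)) + (2 * C + 8 * L * C\<^sup>2) * (1 / (1 - \<kappa>)) + c / 2"
        by linarith
      also have "3 * C * (1 / (1 - \<kappa>)) + (2 * C + 8 * L * C\<^sup>2) * (1 / (1 - \<kappa>)) = (5 * C + 8 * L * C\<^sup>2) * (1 / (1 - \<kappa>))"
        by (simp only: distrib_right[symmetric]) simp
      also have "(5 * C + 8 * L * C\<^sup>2) * (1 / (1 - \<kappa>)) \<le> (13 * L * C\<^sup>2) * (1 / (1 - \<kappa>))"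
      proof (rule mult_right_mono)
        have "C * 1 \<le> C * (L * C)" using C L by (intro mult_left_mono mult_ge1_I) auto
        then show "5 * C + 8 * L * C\<^sup>2 \<le> 13 * L * C\<^sup>2" by (simp add: power2_eq_square mult_ac)
      qed (use kap in simp)
      also have "\<dots> \<le> c / 2" using c(1) by simp
      finally show "3 * C + H / (1 - \<kappa>) \<le> c" by simp
    qed
    finally show ?case .
  qed
  then show "t \<le> T \<Longrightarrow> a t \<le> c * (2 * L * \<kappa> ^ t * nw + (\<Sum>t'\<le>T. \<kappa> ^ tdist t t' * p t'))"
    by (simp only: G_def)
qed

section \<open>Comparison of the given constants with those of the estimates\<close>

context
  fixes L \<alpha> \<gamma> :: real
  assumes L: "1 \<le> L" and alpha: "0 < \<alpha>" "\<alpha> < 1" and gamma: "0 < \<gamma>" "\<gamma> \<le> 1"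
begin

private abbreviation (input) "\<G> \<equiv> inverse (gamma_H L \<alpha> \<gamma>)"

text \<open>Of the sum defining \<open>\<G>\<close> only the term with \<open>gG\<^sup>2\<close> is
  kept. It is at least \<open>27648 L^10 / (\<gamma>^2 a^6)\<close> with
  \<open>a = 1 - \<alpha>\<close>, while \<open>CC\<close> is exactly
  \<open>728 L^7 / (\<gamma> a^3)\<close>; the excess powers are at least 1, and 18 * 728 is below
  27648.\<close>

lemma inverse_gamma_H_ge: "18 * CC L \<alpha> \<gamma> \<le> \<G>" "18 \<le> \<G>"
proof -
  define a where "a = 1 - \<alpha>"
  have a: "0 < a" "a \<le> 1" using alpha by (auto simp: a_def)
  have LH: "3 \<le> L_H L" using L by (simp add: L_H_def)
  have L4: "4 \<le> (1 + L)\<^sup>2" using power_mono[of 2 "1 + L" 2] L by simp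
  define gF where "gF = 1 / gamma_F L \<alpha>"
  define gG where "gG = 1 / gamma_G L \<alpha> \<gamma>"
  have "gF = (1 + L)\<^sup>2 * (L\<^sup>2 / a\<^sup>2)" by (simp add: gF_def gamma_F_def a_def)
  also have "\<dots> \<ge> 4 * (L\<^sup>2 / a\<^sup>2)" using L4 by (intro mult_right_mono) auto
  finally have F: "4 * (L\<^sup>2 / a\<^sup>2) \<le> gF" .
  have "gG = (1 + L)\<^sup>2 * (2 * L ^ 4 / (\<gamma> * a\<^sup>2))" by (simp add: gG_def gamma_G_def a_def)
  also have "\<dots> \<ge> 4 * (2 * L ^ 4 / (\<gamma> * a\<^sup>2))" using L4 gamma by (intro mult_right_mono) auto
  finally have G: "8 * (L ^ 4 / (\<gamma> * a\<^sup>2)) \<le> gG" by simp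
  have Fp: "0 \<le> gF" by (rule order_trans[OF _ F]) simp
  have Gp: "0 \<le> gG" by (rule order_trans[OF _ G]) (use gamma in simp)
  define \<mu> where "\<mu> = mu_bar L \<alpha> \<gamma>"
  have "\<mu> = (2 * (L_H L)\<^sup>2 * gG + gamma_G L \<alpha> \<gamma> + L_H L) * gF"
    by (simp add: \<mu>_def mu_bar_def gF_def gG_def)
  moreover have "0 \<le> gamma_G L \<alpha> \<gamma>" using gamma by (simp add: gamma_G_def)
  ultimately have mu: "0 \<le> \<mu>" using Gp Fp LH by simp
  have "\<G> = 2 * gG + (1 + 4 * L_H L * gG + 4 * (L_H L)\<^sup>2 * gG\<^sup>2) * (L_H L * (1 + \<mu> * L_H L) * gF) + \<mu>"
    by (simp add: gamma_H_def \<mu>_def gF_def gG_def power_divide)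
  also have "\<dots> \<ge> 0 + (0 + 0 + 4 * (L_H L)\<^sup>2 * gG\<^sup>2) * (L_H L * (1 + 0) * gF) + 0"
    using Fp Gp mu LH by (intro add_mono mult_mono order_refl) auto
  finally have 1: "4 * (L_H L)\<^sup>2 * gG\<^sup>2 * (L_H L * gF) \<le> \<G>" by simp
  have "4 * 3\<^sup>2 * (8 * (L ^ 4 / (\<gamma> * a\<^sup>2)))\<^sup>2 * (3 * (4 * (L\<^sup>2 / a\<^sup>2))) \<le> 4 * (L_H L)\<^sup>2 * gG\<^sup>2 * (L_H L * gF)"
    using LH F G Fp Gp gamma by (intro mult_mono power_mono) auto
  with 1 have "4 * 3\<^sup>2 * (8 * (L ^ 4 / (\<gamma> * a\<^sup>2)))\<^sup>2 * (3 * (4 * (L\<^sup>2 / a\<^sup>2))) \<le> \<G>" by linarith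
  also have "4 * 3\<^sup>2 * (8 * (L ^ 4 / (\<gamma> * a\<^sup>2)))\<^sup>2 * (3 * (4 * (L\<^sup>2 / a\<^sup>2))) = 27648 * ((L ^ 7 / (\<gamma> * a ^ 3)) * (L ^ 3 / (\<gamma> * a ^ 3)))"
    by (simp add: power_divide power_mult_distrib power_mult[symmetric] power_add[symmetric] power2_eq_square[of \<gamma>])
  finally have 2: "27648 * ((L ^ 7 / (\<gamma> * a ^ 3)) * (L ^ 3 / (\<gamma> * a ^ 3))) \<le> \<G>" .
  have ga: "0 < \<gamma> * a ^ 3" "\<gamma> * a ^ 3 \<le> 1" using gamma a by (auto intro!: mult_le_one power_le_one)
  have "1 \<le> L ^ 3" "1 \<le> L ^ 7" using L by (simp_all add: one_le_power)
  with ga have 3: "1 \<le> L ^ 3 / (\<gamma> * a ^ 3)" "1 \<le> L ^ 7 / (\<gamma> * a ^ 3)" by (auto simp: le_divide_eq)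
  have "27648 * ((L ^ 7 / (\<gamma> * a ^ 3)) * 1) \<le> 27648 * ((L ^ 7 / (\<gamma> * a ^ 3)) * (L ^ 3 / (\<gamma> * a ^ 3)))"
    using 3 by (intro mult_left_mono) auto
  with 2 have 4: "27648 * (L ^ 7 / (\<gamma> * a ^ 3)) \<le> \<G>" by simp
  have "CC L \<alpha> \<gamma> = 728 * (L ^ 7 / (\<gamma> * a ^ 3))"
    using a gamma unfolding CC_def MC_def kC_def a_def[symmetric]
    by (simp add: power_divide power_mult_distrib power2_eq_square power_numeral_reduce field_simps)
  then show "18 * CC L \<alpha> \<gamma> \<le> \<G>" "18 \<le> \<G>" using 3 4 by linarith+
qed

private abbreviation (input) "\<rho> \<equiv> rho_c L \<alpha> \<gamma>"
private abbreviation (input) "\<kappa> \<equiv> sqrt \<rho>"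
private abbreviation (input) "g \<equiv> gamma_H L \<alpha> \<gamma>"

lemma G_pow: "\<G> ^ n = 1 / g ^ n"
  by (metis power_inverse inverse_eq_divide)

lemma g_bounds: "0 < g" "g \<le> 1/18" "g * \<G> = 1"
proof -
  have G: "18 \<le> \<G>" by (rule inverse_gamma_H_ge)
  then have "0 < \<G>" by linarith
  then show p: "0 < g" by (simp only: inverse_positive_iff_positive)
  show "g \<le> 1/18" using G p by (simp add: field_simps)
  show "g * \<G> = 1" using p by simp
qed

lemma LH_ge: "3 \<le> L_H L" "9 \<le> (L_H L)\<^sup>2" "(L_H L)\<^sup>2 \<le> 9 * L\<^sup>2"
proof -
  show 3: "3 \<le> L_H L" using L by (simp add: L_H_def)
  show "9 \<le> (L_H L)\<^sup>2" using power_mono[OF 3, of 2] by simp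
  have "L_H L \<le> 3 * L" using L by (simp add: L_H_def)
  then have "(L_H L)\<^sup>2 \<le> (3 * L)\<^sup>2" using 3 by (intro power_mono) auto
  then show "(L_H L)\<^sup>2 \<le> 9 * L\<^sup>2" by (simp add: power_mult_distrib)
qed

lemma rho_sq: "\<rho>\<^sup>2 = 1 - 2 * g\<^sup>2 / ((L_H L)\<^sup>2 + g\<^sup>2)"
proof -
  have "g\<^sup>2 \<le> 1" using g_bounds by (simp add: power_le_one)
  then have nn: "0 \<le> ((L_H L)\<^sup>2 - g\<^sup>2) / ((L_H L)\<^sup>2 + g\<^sup>2)" and D: "(L_H L)\<^sup>2 + g\<^sup>2 \<noteq> 0"
    using LH_ge by (auto simp: add_pos_nonneg)
  have "\<rho>\<^sup>2 = (((L_H L)\<^sup>2 + g\<^sup>2) - 2 * g\<^sup>2) / ((L_H L)\<^sup>2 + g\<^sup>2)"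
    unfolding rho_c_def using nn by simp
  also have "\<dots> = 1 - 2 * g\<^sup>2 / ((L_H L)\<^sup>2 + g\<^sup>2)"
    unfolding diff_divide_distrib using D by simp
  finally show ?thesis .
qed

text \<open>\<open>1 - \<rho>\<^sup>2\<close> must be small for the weights to be slow, yet not too
  small for the sum over stages. The 5 comes from
  \<open>(L_H L)\<^sup>2 + g\<^sup>2 \<le> 10 * L\<^sup>2\<close>.\<close>

lemma rho_sq_bounds: "1 - 2 / 9 * g\<^sup>2 \<le> \<rho>\<^sup>2" "g\<^sup>2 / (5 * L\<^sup>2) \<le> 1 - \<rho>\<^sup>2"
proof -
  have g2: "0 < g\<^sup>2" "g\<^sup>2 \<le> 1" using g_bounds by (simp_all add: power_le_one)
  have "2 * g\<^sup>2 / ((L_H L)\<^sup>2 + g\<^sup>2) \<le> 2 * g\<^sup>2 / 9"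
    by (rule frac_le) (use LH_ge(2) g2 in linarith)+
  then show "1 - 2 / 9 * g\<^sup>2 \<le> \<rho>\<^sup>2" unfolding rho_sq by simp
  have L2: "1 \<le> L\<^sup>2" using L by (simp add: one_le_power)
  then have "(L_H L)\<^sup>2 + g\<^sup>2 \<le> 10 * L\<^sup>2" using LH_ge g2 by linarith
  have "2 * g\<^sup>2 / (10 * L\<^sup>2) \<le> 2 * g\<^sup>2 / ((L_H L)\<^sup>2 + g\<^sup>2)"
    by (rule frac_le) (use LH_ge(2) g2 \<open>(L_H L)\<^sup>2 + g\<^sup>2 \<le> 10 * L\<^sup>2\<close> in linarith)+
  then show "g\<^sup>2 / (5 * L\<^sup>2) \<le> 1 - \<rho>\<^sup>2" unfolding rho_sq by simp
qed

lemma rho_bounds: "0 < \<rho>" "\<rho> < 1"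
proof -
  have g2: "0 < g\<^sup>2" "g\<^sup>2 \<le> 1" using g_bounds by (simp_all add: power_le_one)
  have nn: "0 \<le> \<rho>" unfolding rho_c_def using g2 LH_ge by (simp add: add_nonneg_nonneg)
  have "\<rho> \<noteq> 0" using rho_sq_bounds(1) g2 by (intro notI) simp
  with nn show "0 < \<rho>" by simp
  have "0 < g\<^sup>2 / (5 * L\<^sup>2)" using g2 L by simp
  then have "\<rho>\<^sup>2 < 1\<^sup>2" using rho_sq_bounds(2) by simp
  then show "\<rho> < 1" by (rule power_less_imp_less_base) simp
qed

lemma kappa_pow: "\<kappa> ^ 2 = \<rho>" "\<kappa> ^ 4 = \<rho>\<^sup>2" "\<kappa> ^ 6 = \<rho> ^ 3"
proof -
  show 2: "\<kappa> ^ 2 = \<rho>" using rho_bounds by simp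
  have "\<kappa> ^ 4 = (\<kappa> ^ 2) ^ 2" "\<kappa> ^ 6 = (\<kappa> ^ 2) ^ 3" by (simp_all flip: power_mult)
  then show "\<kappa> ^ 4 = \<rho>\<^sup>2" "\<kappa> ^ 6 = \<rho> ^ 3" using 2 by simp_all
qed

text \<open>Factoring \<open>1 - \<kappa> ^ 4 = 1 - \<rho>\<^sup>2\<close> loses a factor 4 and
  transfers the lower bound to \<open>1 - \<kappa>\<close>, whence 20 = 4 * 5.\<close>

lemma kappa_bounds: "1/2 \<le> \<kappa>" "\<kappa> < 1" "1 / (1 - \<kappa>) \<le> 20 * L\<^sup>2 * \<G>\<^sup>2"
proof -
  have g2: "0 < g\<^sup>2" "g\<^sup>2 \<le> 1" using g_bounds by (simp_all add: power_le_one)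
  show k1: "\<kappa> < 1" using rho_bounds by simp
  have "(1/2) ^ 4 \<le> \<kappa> ^ 4" unfolding kappa_pow using rho_sq_bounds(1) g2 by (simp add: power_divide)
  then show "1/2 \<le> \<kappa>" using rho_bounds by (subst (asm) power_mono_iff) auto
  have k: "0 \<le> \<kappa>" "\<kappa> \<le> 1" using rho_bounds by auto
  have "1 - \<kappa> ^ 4 = (1 - \<kappa>) * (1 + \<kappa> + \<kappa> ^ 2 + \<kappa> ^ 3)" by algebra
  also have "\<dots> \<le> (1 - \<kappa>) * 4"
  proof (rule mult_left_mono)
    have "\<kappa> ^ 2 \<le> 1" "\<kappa> ^ 3 \<le> 1" using k by (auto intro: power_le_one)
    then show "1 + \<kappa> + \<kappa> ^ 2 + \<kappa> ^ 3 \<le> 4" using k by linarith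
  qed (use k in simp)
  finally have 1: "g\<^sup>2 / (20 * L\<^sup>2) \<le> 1 - \<kappa>" using rho_sq_bounds(2) unfolding kappa_pow by simp
  have "0 < g\<^sup>2 / (20 * L\<^sup>2)" using g2 L by simp
  then have "1 / (1 - \<kappa>) \<le> 1 / (g\<^sup>2 / (20 * L\<^sup>2))" using 1 by (intro frac_le) auto
  also have "\<dots> = 20 * L\<^sup>2 * \<G>\<^sup>2" unfolding G_pow by simp
  finally show "1 / (1 - \<kappa>) \<le> 20 * L\<^sup>2 * \<G>\<^sup>2" .
qed

text \<open>Bernoulli's inequality bounds \<open>\<rho> ^ 6\<close> below by
  \<open>1 - 2/3 g\<close>, while \<open>1 / CC\<close> is at least \<open>18 g\<close>; for g \<le>
  1/18 the gain beats the loss together with the product term.\<close>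

lemma weight_ratio: "1 \<le> (1 + 1 / CC L \<alpha> \<gamma>) * (\<kappa> ^ 6)\<^sup>2" if C: "1 \<le> CC L \<alpha> \<gamma>"
proof -
  have g: "0 < g" "g \<le> 1/18" by (rule g_bounds)+
  have g2: "0 < g\<^sup>2" "g\<^sup>2 \<le> g" using g by (auto simp: power2_eq_square intro: mult_left_le_one_le)
  have "18 * CC L \<alpha> \<gamma> \<le> inverse g" by (rule inverse_gamma_H_ge)
  then have "18 * CC L \<alpha> \<gamma> * g \<le> 1" using g by (simp add: field_simps)
  then have gC: "18 * g \<le> 1 / CC L \<alpha> \<gamma>" using C by (simp add: field_simps)
  have "1 \<le> (1 + 18 * g) * (1 - 2 / 3 * g)"
    using g mult_mono[OF g(2) order_refl, of g] by (simp add: algebra_simps)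
  also have "\<dots> \<le> (1 + 1 / CC L \<alpha> \<gamma>) * (\<kappa> ^ 6)\<^sup>2"
  proof (rule mult_mono)
    have "1 + real 3 * (- (2 / 9 * g\<^sup>2)) \<le> (1 + (- (2 / 9 * g\<^sup>2))) ^ 3"
      by (rule Bernoulli_inequality) (use g2 g in linarith)
    also have "\<dots> \<le> (\<rho>\<^sup>2) ^ 3" using rho_sq_bounds(1) g2 g by (intro power_mono) auto
    also have "\<dots> = (\<kappa> ^ 6)\<^sup>2" unfolding kappa_pow by (simp flip: power_mult)
    finally show "1 - 2 / 3 * g \<le> (\<kappa> ^ 6)\<^sup>2" using g2 by simp
  qed (use gC g C in auto)
  finally show ?thesis .
qed

lemma c1_ge: "3 * \<G>\<^sup>2 \<le> c1 L \<alpha> \<gamma>"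
proof -
  have "3 * \<G>\<^sup>2 = 3 / (g\<^sup>2 * 1)" unfolding G_pow by simp
  also have "\<dots> \<le> L_H L / (g\<^sup>2 * \<rho>)"
    using LH_ge g_bounds rho_bounds by (intro frac_le mult_left_mono) auto
  finally show ?thesis by (simp add: c1_def)
qed

lemma c1_sq_ge: "9 * \<G> ^ 4 \<le> (c1 L \<alpha> \<gamma>)\<^sup>2"
proof -
  have "(3 * \<G>\<^sup>2)\<^sup>2 \<le> (c1 L \<alpha> \<gamma>)\<^sup>2" by (intro power_mono c1_ge) auto
  then show ?thesis by (simp add: power_mult_distrib flip: power_mult)
qed

text \<open>\<open>\<rho> powr (3/2)\<close> is \<open>\<kappa> ^ 3\<close>, and
  \<open>1 - \<kappa> ^ 3 \<le> 3 * (1 - \<kappa>)\<close> brings the denominator of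
  \<open>c2\<close> to the one of the recursion.\<close>

lemma c2_ge: "6 * \<G> ^ 4 * L / (1 - \<kappa>) \<le> c2 L \<alpha> \<gamma>"
proof -
  have k: "0 \<le> \<kappa>" "\<kappa> < 1" using rho_bounds by auto
  have r: "\<rho> powr (3/2) = \<kappa> ^ 3"
  proof -
    have "\<rho> powr (3/2) = (\<rho> powr (1/2)) powr 3" by (simp add: powr_powr)
    also have "\<dots> = \<kappa> powr 3" using rho_bounds by (simp add: powr_half_sqrt)
    also have "\<dots> = \<kappa> ^ 3" using rho_bounds by simp
    finally show ?thesis .
  qed
  have "1 - \<kappa> ^ 3 = (1 - \<kappa>) * (1 + \<kappa> + \<kappa> ^ 2)" by algebra
  also have "\<dots> \<le> (1 - \<kappa>) * 3"
  proof (rule mult_left_mono)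
    have "\<kappa> ^ 2 \<le> 1" using k by (auto intro: power_le_one)
    then show "1 + \<kappa> + \<kappa> ^ 2 \<le> 3" using k by linarith
  qed (use k in simp)
  finally have 3: "1 - \<kappa> ^ 3 \<le> (1 - \<kappa>) * 3" .
  have k3: "0 < 1 - \<kappa> ^ 3" using k power_less_one_iff[of \<kappa> 3] by simp
  have "6 * x * L / D = 2 * (9 * x) * L / (1 * (D * 3))" for x D :: real by simp
  then have "6 * \<G> ^ 4 * L / (1 - \<kappa>) = 2 * (9 * \<G> ^ 4) * L / (1 * ((1 - \<kappa>) * 3))" .
  also have "\<dots> \<le> 2 * (c1 L \<alpha> \<gamma>)\<^sup>2 * L / (\<rho> * (1 - \<kappa> ^ 3))"
  proof (rule frac_le)
    show "\<rho> * (1 - \<kappa> ^ 3) \<le> 1 * ((1 - \<kappa>) * 3)" using 3 k3 rho_bounds by (intro mult_mono) auto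
  qed (use c1_sq_ge L k3 rho_bounds in \<open>auto intro!: mult_right_mono mult_pos_pos\<close>)
  also have "\<dots> = c2 L \<alpha> \<gamma>" by (simp add: c2_def r)
  finally show ?thesis .
qed

text \<open>The threshold is solved for \<open>\<rho> ^ (2 * W)\<close>, the inequality turning
  because \<open>ln \<rho>\<close> is negative. The 144 = 4 * 4 * 9 collects
  \<open>sqrt \<alpha> - \<alpha> \<le> 1/4\<close>, the 4 in \<open>W_bar\<close> and the 9 of
  \<open>c1_sq_ge\<close>.\<close>

lemma horizon_decay:
  assumes "W_bar L \<alpha> \<gamma> \<le> real W"
  shows "\<kappa> ^ (4 * W) \<le> 1 / (144 * \<G> ^ 4 * L ^ 3)"
proof -
  define X where "X = (sqrt \<alpha> - \<alpha>) / (4 * (c1 L \<alpha> \<gamma>)\<^sup>2 * L ^ 3)"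
  have G: "0 < \<G> ^ 4" using g_bounds by simp
  have c1p: "0 < (c1 L \<alpha> \<gamma>)\<^sup>2" using c1_sq_ge G by linarith
  have s: "(sqrt \<alpha>)\<^sup>2 = \<alpha>" using alpha by simp
  have "sqrt \<alpha> * sqrt \<alpha> < sqrt \<alpha> * 1" using alpha by (intro mult_strict_left_mono) auto
  then have sa: "0 < sqrt \<alpha> - \<alpha>" using s by (simp add: power2_eq_square)
  have "0 \<le> (sqrt \<alpha> - 1/2)\<^sup>2" by simp
  then have sa4: "sqrt \<alpha> - \<alpha> \<le> 1/4" unfolding power2_diff s by (simp add: power2_eq_square)
  have X: "0 < X" unfolding X_def using sa c1p L by simp
  have ln: "ln \<rho> < 0" using rho_bounds by simp
  have "ln X / (2 * ln \<rho>) \<le> real W" using assms by (simp add: W_bar_def X_def)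
  then have "real W * (2 * ln \<rho>) \<le> ln X" using ln by (simp add: divide_le_eq split: if_splits)
  then have "ln (\<rho> ^ (2 * W)) \<le> ln X" using rho_bounds by (simp add: ln_realpow mult_ac)
  then have "\<rho> ^ (2 * W) \<le> X" using X rho_bounds by (simp add: ln_le_cancel_iff)
  then have "\<kappa> ^ (4 * W) \<le> X" by (simp add: power_mult kappa_pow)
  also have "\<dots> \<le> (1/4) / (4 * (9 * \<G> ^ 4) * L ^ 3)"
    unfolding X_def using sa4 sa c1_sq_ge G L by (intro frac_le mult_mono) auto
  finally show ?thesis by (simp add: mult_ac)
qed

text \<open>\<open>W = 0\<close> would give \<open>1 \<le> 1 / 144\<close>. A positive
  \<open>W\<close> puts stage \<open>s + 1\<close> inside the horizon of prediction
  \<open>s\<close>, on which the comparison of consecutive predictions relies.\<close>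

lemma horizon_pos:
  assumes "W_bar L \<alpha> \<gamma> \<le> real W"
  shows "1 \<le> W"
proof (rule ccontr)
  assume "\<not> 1 \<le> W"
  then have "W = 0" by simp
  then have "1 \<le> 1 / (144 * \<G> ^ 4 * L ^ 3)" using horizon_decay[OF assms] by simp
  moreover have "1 \<le> \<G> ^ 4" "1 \<le> L ^ 3" using inverse_gamma_H_ge(2) L by (auto intro!: one_le_power)
  then have "1 * 1 \<le> \<G> ^ 4 * L ^ 3" by (intro mult_mono) auto
  then have "1 / (144 * \<G> ^ 4 * L ^ 3) \<le> 1 / 144" unfolding mult.assoc by (intro frac_le) linarith+
  ultimately show False by linarith
qed

text \<open>In the second claim the powers balance: \<open>CC\<^sup>2\<close> and
  \<open>1 / (1 - \<kappa>)\<close> bring \<open>\<G>\<^sup>2\<close> each against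
  \<open>\<G> ^ 4\<close> from the horizon, and likewise \<open>L * L\<^sup>2\<close> against
  \<open>L ^ 3\<close>. What is left is the number 40 / (324 * 144).\<close>

lemma loop_constants:
  assumes C: "1 \<le> CC L \<alpha> \<gamma>" and W: "W_bar L \<alpha> \<gamma> \<le> real W"
  shows "13 * L * (CC L \<alpha> \<gamma>)\<^sup>2 / (1 - \<kappa>) \<le> c2 L \<alpha> \<gamma> / 2"
    "2 * L * (CC L \<alpha> \<gamma>)\<^sup>2 * \<kappa> ^ (4 * W) / (1 - \<kappa>) \<le> 1 / 2"
proof -
  let ?C = "CC L \<alpha> \<gamma>"
  have CG: "?C \<le> \<G> / 18" "18 \<le> \<G>" using inverse_gamma_H_ge by auto
  have "?C\<^sup>2 \<le> (\<G> / 18)\<^sup>2" using C CG by (intro power_mono) auto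
  then have C2: "?C\<^sup>2 \<le> \<G>\<^sup>2 / 324" by (simp add: power_divide)
  have G24: "\<G>\<^sup>2 \<le> \<G> ^ 4" using CG by (intro power_increasing) auto
  have k: "\<kappa> < 1" by (rule kappa_bounds)
  have "13 * L * ?C\<^sup>2 / (1 - \<kappa>) \<le> 13 * L * (\<G> ^ 4 / 324) / (1 - \<kappa>)"
    using C2 G24 L k by (intro divide_right_mono mult_left_mono) auto
  also have "\<dots> \<le> 3 * (L * \<G> ^ 4) / (1 - \<kappa>)"
  proof (rule divide_right_mono)
    have "0 \<le> L * \<G> ^ 4" using L by simp
    then show "13 * L * (\<G> ^ 4 / 324) \<le> 3 * (L * \<G> ^ 4)" by linarith
  qed (use k in simp)
  also have "\<dots> = (6 * \<G> ^ 4 * L / (1 - \<kappa>)) / 2"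
  proof -
    have "3 * (l * x) / D = (6 * x * l / D) / 2" for l x D :: real by simp
    then show ?thesis .
  qed
  also have "\<dots> \<le> c2 L \<alpha> \<gamma> / 2" by (rule divide_right_mono[OF c2_ge]) simp
  finally show "13 * L * ?C\<^sup>2 / (1 - \<kappa>) \<le> c2 L \<alpha> \<gamma> / 2" .
  have k0: "0 \<le> \<kappa> ^ (4 * W)" using kappa_bounds(1) by (intro zero_le_power) linarith
  have "2 * L * ?C\<^sup>2 * \<kappa> ^ (4 * W) / (1 - \<kappa>) = 2 * L * ?C\<^sup>2 * \<kappa> ^ (4 * W) * (1 / (1 - \<kappa>))" by simp
  also have "\<dots> \<le> 2 * L * (\<G>\<^sup>2 / 324) * (1 / (144 * \<G> ^ 4 * L ^ 3)) * (20 * L\<^sup>2 * \<G>\<^sup>2)"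
    using C2 horizon_decay[OF W] kappa_bounds L CG k0 by (intro mult_mono mult_nonneg_nonneg k0) auto
  also have "\<dots> = 40 / (324 * 144)"
  proof -
    have "2 * l * (G\<^sup>2 / 324) * (1 / (144 * G ^ 4 * l ^ 3)) * (20 * l\<^sup>2 * G\<^sup>2) = 40 / (324 * 144)"
      if "G \<noteq> 0" "l \<noteq> 0" for G l :: real
      using that by (simp add: field_simps power_numeral_reduce)
    moreover have "\<G> \<noteq> 0" "L \<noteq> 0" using L CG by linarith+
    ultimately show ?thesis by blast
  qed
  also have "\<dots> \<le> 1 / 2" by simp
  finally show "2 * L * ?C\<^sup>2 * \<kappa> ^ (4 * W) / (1 - \<kappa>) \<le> 1 / 2" .
qed

end

section \<open>The predictive control policy\<close>

lemma norm_components_le: "norm (fst z) \<le> norm z" "norm (snd z) \<le> norm z"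
  by (metis norm_fst_le prod.collapse, metis norm_snd_le prod.collapse)

text \<open>The scenarios are the part of the support with initial value \<open>xi0\<close>,
  weighted by the conditional law, so that \<open>l2\<close> is the conditional root mean
  square.\<close>

locale spc_loop =
  stoch_lq P T A B d Q R q r \<gamma> + lq_tree S m A B Q R K Kd T L \<alpha> \<gamma>
  for P :: "(nat \<Rightarrow> 'a) pmf" and T :: nat
    and A :: "'a \<Rightarrow> real^'x^'x" and B :: "'a \<Rightarrow> real^'u^'x" and d :: "'a \<Rightarrow> real^'x"
    and Q :: "'a \<Rightarrow> real^'x^'x" and R :: "'a \<Rightarrow> real^'u^'u"
    and q :: "'a \<Rightarrow> real^'x" and r :: "'a \<Rightarrow> real^'u" and \<gamma> :: real
    and S :: "(nat \<Rightarrow> 'a) set" and m :: "(nat \<Rightarrow> 'a) \<Rightarrow> real"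
    and K :: "nat \<Rightarrow> 'a list \<Rightarrow> real^'x^'u" and Kd :: "nat \<Rightarrow> 'a list \<Rightarrow> real^'x^'x" and L \<alpha> :: real +
  fixes xi0 :: 'a and wbar :: "(real^'x) \<times> (real^'u)" and W :: nat and b :: real
  assumes S_eq: "S = {\<zeta> \<in> set_pmf P. \<zeta> 0 = xi0}"
    and m_eq: "m \<zeta> = pmf (cond_pmf P {\<zeta>. \<zeta> 0 = xi0}) \<zeta>"
    and W_pos: "1 \<le> W"
    and b: "0 < b" "b < 1" "1 \<le> (1 + 1 / CC L \<alpha> \<gamma>) * b\<^sup>2"
begin

abbreviation "policy_at \<equiv> spc P T A B d Q R q r W wbar"
abbreviation "opt s h w0 \<equiv> SOME w. trunc_opt P T A B d Q R q r s W h w0 w"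
abbreviation "hor s \<equiv> min (s + W) T"

lemma S_P: "\<zeta> \<in> S \<Longrightarrow> \<zeta> \<in> set_pmf P" by (simp add: S_eq)

lemma L_ge: "1 \<le> L" and C_ge: "1 \<le> CC L \<alpha> \<gamma>"
proof -
  obtain \<zeta> where "\<zeta> \<in> S" using S_nonempty by blast
  then show "1 \<le> L" "1 \<le> CC L \<alpha> \<gamma>" using lq_path.L[OF path] lq_path.C_ge(2)[OF path] by blast+
qed

lemma B_bound: "\<zeta> \<in> S \<Longrightarrow> t \<le> T \<Longrightarrow> mnorm (B (\<zeta> t)) \<le> L"
  using lq_path.B[OF path] by blast

section \<open>Gluing the truncated solutions along the tree\<close>

lemma spc_cong: "pre \<zeta> t = pre \<eta> t \<Longrightarrow> policy_at t \<zeta> = policy_at t \<eta>"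
proof (induction t)
  case (Suc t)
  then have "policy_at t \<zeta> = policy_at t \<eta>" using pre_eq_le[of \<zeta> "Suc t" \<eta> t] by simp
  with Suc.prems show ?case by simp
qed simp

text \<open>The prefix is read as a trajectory through \<open>\<lambda>i. h ! i\<close>; whatever
  this yields past its end is harmless by \<open>spc_cong\<close>.\<close>

definition wprevious :: "nat \<Rightarrow> 'a list \<Rightarrow> (real^'x) \<times> (real^'u)" where
  "wprevious s h = (case s of 0 \<Rightarrow> wbar | Suc s' \<Rightarrow> policy_at s' (\<lambda>i. h ! i))"

lemma wprevious_Suc: "s \<le> t \<Longrightarrow> wprevious (Suc s) (pre \<zeta> t) = policy_at s \<zeta>"
  unfolding wprevious_def by (auto intro!: spc_cong simp: pre_def simp del: upt_Suc)

lemma wprevious_cong: "s \<le> t \<Longrightarrow> pre \<zeta> s = pre \<eta> s \<Longrightarrow> wprevious s (pre \<zeta> t) = wprevious s (pre \<eta> s)"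
proof (cases s)
  case (Suc i)
  assume "s \<le> t" "pre \<zeta> s = pre \<eta> s"
  then have "policy_at i \<zeta> = policy_at i \<eta>" using Suc pre_eq_le[of \<zeta> s \<eta> i] by (intro spc_cong) simp
  then show ?thesis using Suc \<open>s \<le> t\<close> by (simp add: wprevious_Suc)
qed (simp add: wprevious_def)

text \<open>\<open>yopt s\<close> glues the solutions of the truncated problems that the policy solves at stage \<open>s\<close>, and is
  extended by zero beyond the prediction horizon.\<close>

definition yopt :: "nat \<Rightarrow> nat \<Rightarrow> 'a list \<Rightarrow> (real^'x) \<times> (real^'u)" where
  "yopt s t h = (if t \<le> hor s then opt s (take (Suc s) h) (wprevious s h) t h else 0)"

lemma opt_optimal:
  assumes "\<zeta> \<in> S" "s \<le> T"
  shows "trunc_opt P T A B d Q R q r s W (pre \<zeta> s) w0 (opt s (pre \<zeta> s) w0)"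
  using trunc_opt_exists[OF S_P[OF assms(1)] refl assms(2)] by (rule someI_ex)

lemma opt_feasible:
  assumes "\<zeta> \<in> S" "s \<le> T"
  shows "trunc_feasible P T A B d s W (pre \<zeta> s) w0 (opt s (pre \<zeta> s) w0)"
  using opt_optimal[OF assms] unfolding trunc_opt_def by blast

text \<open>The arguments of the choice operator depend on the prefix at \<open>s\<close> alone, so
  all continuations of one prefix follow the same chosen solution.\<close>

lemma yopt_eq:
  assumes "pre \<zeta> s = pre \<eta> s" "s \<le> t" "t \<le> hor s"
  shows "yopt s t (pre \<zeta> t) = opt s (pre \<eta> s) (wprevious s (pre \<eta> s)) t (pre \<zeta> t)"
  using assms wprevious_cong[of s t \<zeta> \<eta>] by (simp add: yopt_def)

lemma yopt_self: "s \<le> T \<Longrightarrow> yopt s s (pre \<zeta> s) = policy_at s \<zeta>"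
proof -
  assume "s \<le> T"
  then have "yopt s s (pre \<zeta> s) = opt s (pre \<zeta> s) (wprevious s (pre \<zeta> s)) s (pre \<zeta> s)"
    by (intro yopt_eq) auto
  also have "\<dots> = policy_at s \<zeta>"
  proof (cases s)
    case 0
    then show ?thesis by (simp add: wprevious_def spc_first_def)
  next
    case (Suc i)
    then have "wprevious s (pre \<zeta> s) = policy_at i \<zeta>" by (simp add: wprevious_Suc)
    then show ?thesis using Suc by (simp add: spc_first_def)
  qed
  finally show ?thesis .
qed

lemma yopt_start:
  assumes "\<zeta> \<in> S" "s \<le> T"
  shows "fst (yopt s s (pre \<zeta> s)) = dyn A B d (wprevious s (pre \<zeta> s)) (\<zeta> s)"
proof -
  have "fst (opt s (pre \<zeta> s) (wprevious s (pre \<zeta> s)) s (pre \<zeta> s)) = dyn A B d (wprevious s (pre \<zeta> s)) (pre \<zeta> s ! s)"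
    using opt_feasible[OF assms] unfolding trunc_feasible_def by blast
  then show ?thesis using assms by (subst yopt_eq[of \<zeta> s \<zeta>]) simp_all
qed

lemma yopt_step:
  assumes "\<zeta> \<in> S" "s \<le> t" "t < hor s"
  shows "fst (yopt s (Suc t) (pre \<zeta> (Suc t))) = dyn A B d (yopt s t (pre \<zeta> t)) (\<zeta> (Suc t))"
proof -
  have "s \<le> T" using assms by simp
  then have "trunc_feasible P T A B d s W (pre \<zeta> s) (wprevious s (pre \<zeta> s)) (opt s (pre \<zeta> s) (wprevious s (pre \<zeta> s)))"
    by (rule opt_feasible[OF assms(1)])
  moreover have "Suc t \<in> {Suc s..hor s}" using assms by simp
  ultimately have "fst (opt s (pre \<zeta> s) (wprevious s (pre \<zeta> s)) (Suc t) (pre \<zeta> (Suc t)))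
      = dyn A B d (opt s (pre \<zeta> s) (wprevious s (pre \<zeta> s)) t (pre \<zeta> t)) (\<zeta> (Suc t))"
    using S_P[OF assms(1)] unfolding trunc_feasible_def by (metis diff_Suc_1)
  then show ?thesis using assms yopt_eq[of \<zeta> s \<zeta>] by simp
qed

definition ddata :: "nat \<Rightarrow> nat \<Rightarrow> 'a list \<Rightarrow> real^'x" where
  "ddata s t h = (if t = s then fst (yopt s s h) else d (h ! t))"

lemma yopt_obeys: "s \<le> T \<Longrightarrow> obeys s (hor s) (ddata s) (yopt s)"
  unfolding obeys_def using yopt_step by (auto simp: ddata_def dyn_def)

text \<open>Below a fixed prefix both conditional laws are multiples of \<open>P\<close>; the ratio
  \<open>\<theta>\<close> of their normalisations carries the conditional expectation of the
  truncated problem over to the weights \<open>m\<close>.\<close>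

lemma m_cond:
  assumes "\<zeta>\<^sub>0 \<in> S"
  shows "\<exists>\<theta>. \<forall>\<zeta>\<in>set_pmf P. pre \<zeta> s = pre \<zeta>\<^sub>0 s \<longrightarrow>
    m \<zeta> = \<theta> * pmf (cond_pmf P {\<zeta>. pre \<zeta> s = pre \<zeta>\<^sub>0 s}) \<zeta>"
proof (intro exI ballI impI)
  let ?H = "{\<zeta>. pre \<zeta> s = pre \<zeta>\<^sub>0 s}" and ?X = "{\<zeta>. \<zeta> 0 = xi0}"
  have P0: "\<zeta>\<^sub>0 \<in> set_pmf P" "\<zeta>\<^sub>0 0 = xi0" using assms by (auto simp: S_eq)
  then have ne: "set_pmf P \<inter> ?H \<noteq> {}" "set_pmf P \<inter> ?X \<noteq> {}" by auto
  have pos: "measure (measure_pmf P) ?H \<noteq> 0"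
    using ne(1) by (simp add: measure_pmf_zero_iff)
  fix \<zeta> assume \<zeta>: "\<zeta> \<in> set_pmf P" "pre \<zeta> s = pre \<zeta>\<^sub>0 s"
  then have "\<zeta> 0 = xi0" using P0 pre_eq_nth[of \<zeta> s \<zeta>\<^sub>0 0] by simp
  then show "m \<zeta> = (measure (measure_pmf P) ?H / measure (measure_pmf P) ?X) * pmf (cond_pmf P ?H) \<zeta>"
    using \<zeta> pos by (simp add: m_eq pmf_cond[OF ne(1)] pmf_cond[OF ne(2)])
qed

text \<open>Sorting the scenarios by their prefix at \<open>s\<close> splits the sum into the
  first-order conditions of the separate truncated problems, each scaled by its own
  \<open>\<theta>\<close>.\<close>

lemma yopt_stationary:
  assumes s: "s \<le> T"
  shows "stationary s (hor s) (\<lambda>t h. q (h ! t)) (\<lambda>t h. r (h ! t)) (yopt s)"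
  unfolding stationary_def
proof (intro allI impI)
  fix v assume v: "obeys s (hor s) (\<lambda>_ _. 0) v"
  let ?F = "\<lambda>\<zeta>. \<Sum>t=s..hor s. variation (Q (\<zeta> t)) (R (\<zeta> t)) (q (pre \<zeta> t ! t)) (r (pre \<zeta> t ! t))
        (yopt s t (pre \<zeta> t)) (v t (pre \<zeta> t))"
  have "(\<Sum>\<zeta>\<in>S. m \<zeta> * ?F \<zeta>) = (\<Sum>h\<in>(\<lambda>\<zeta>. pre \<zeta> s) ` S. \<Sum>\<zeta>\<in>{\<zeta>\<in>S. pre \<zeta> s = h}. m \<zeta> * ?F \<zeta>)"
    by (rule sum.image_gen[OF finite_S])
  also have "\<dots> = 0"
  proof (rule sum.neutral, rule ballI)
    fix h assume "h \<in> (\<lambda>\<zeta>. pre \<zeta> s) ` S"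
    then obtain \<zeta>\<^sub>0 where \<zeta>0: "\<zeta>\<^sub>0 \<in> S" "h = pre \<zeta>\<^sub>0 s" by auto
    let ?P = "cond_pmf P {\<zeta>. pre \<zeta> s = h}"
    let ?w = "opt s h (wprevious s h)"
    have set_eq: "{\<zeta>\<in>S. pre \<zeta> s = h} = {\<zeta>\<in>set_pmf P. pre \<zeta> s = h}"
    proof -
      have "\<zeta> 0 = xi0" if "pre \<zeta> s = h" for \<zeta>
        using that \<zeta>0 pre_eq_nth[of \<zeta> s \<zeta>\<^sub>0 0] S_eq by simp
      then show ?thesis unfolding S_eq by blast
    qed
    obtain \<theta> where \<theta>: "\<And>\<zeta>. \<zeta> \<in> set_pmf P \<Longrightarrow> pre \<zeta> s = h \<Longrightarrow> m \<zeta> = \<theta> * pmf ?P \<zeta>"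
      using m_cond[OF \<zeta>0(1), of s] unfolding \<zeta>0(2) by blast
    have "(\<Sum>\<zeta>\<in>{\<zeta>\<in>S. pre \<zeta> s = h}. m \<zeta> * ?F \<zeta>)
        = \<theta> * (\<Sum>\<zeta>\<in>{\<zeta>\<in>set_pmf P. pre \<zeta> s = h}. pmf ?P \<zeta> * (\<Sum>t=s..hor s.
          variation (Q (\<zeta> t)) (R (\<zeta> t)) (q (\<zeta> t)) (r (\<zeta> t)) (?w t (pre \<zeta> t)) (v t (pre \<zeta> t))))"
      unfolding set_eq sum_distrib_left[of \<theta>]
    proof (intro sum.cong refl)
      fix \<zeta> assume \<zeta>: "\<zeta> \<in> {\<zeta>\<in>set_pmf P. pre \<zeta> s = h}"
      have "?F \<zeta> = (\<Sum>t=s..hor s. variation (Q (\<zeta> t)) (R (\<zeta> t)) (q (\<zeta> t)) (r (\<zeta> t)) (?w t (pre \<zeta> t)) (v t (pre \<zeta> t)))"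
        using \<zeta> \<zeta>0 yopt_eq[of \<zeta> s \<zeta>\<^sub>0] by (intro sum.cong) auto
      then show "m \<zeta> * ?F \<zeta> = \<theta> * (pmf ?P \<zeta> * (\<Sum>t=s..hor s.
          variation (Q (\<zeta> t)) (R (\<zeta> t)) (q (\<zeta> t)) (r (\<zeta> t)) (?w t (pre \<zeta> t)) (v t (pre \<zeta> t))))"
        using \<theta> \<zeta> by simp
    qed
    also have "(\<Sum>\<zeta>\<in>{\<zeta>\<in>set_pmf P. pre \<zeta> s = h}. pmf ?P \<zeta> * (\<Sum>t=s..hor s.
          variation (Q (\<zeta> t)) (R (\<zeta> t)) (q (\<zeta> t)) (r (\<zeta> t)) (?w t (pre \<zeta> t)) (v t (pre \<zeta> t)))) = 0"
    proof (rule trunc_opt_first_order[OF S_P[OF \<zeta>0(1)] \<zeta>0(2) s])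
      show "trunc_opt P T A B d Q R q r s W h (wprevious s h) ?w"
        unfolding \<zeta>0(2) by (rule opt_optimal[OF \<zeta>0(1) s])
    qed (use v set_eq in \<open>auto simp: obeys_def\<close>)
    finally show "(\<Sum>\<zeta>\<in>{\<zeta>\<in>S. pre \<zeta> s = h}. m \<zeta> * ?F \<zeta>) = 0" by simp
  qed
  finally show "(\<Sum>\<zeta>\<in>S. m \<zeta> * ?F \<zeta>) = 0" .
qed

section \<open>Decay of the predictions and of their differences\<close>

definition "pn t = l2 (\<lambda>\<zeta>. (q (\<zeta> t), r (\<zeta> t), d (\<zeta> t)))"

lemma pn_ge: "l2 (\<lambda>\<zeta>. d (\<zeta> t)) \<le> pn t" "l2 (\<lambda>\<zeta>. (q (\<zeta> t), r (\<zeta> t))) \<le> pn t"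
  unfolding pn_def by (auto intro!: l2_mono real_le_rsqrt simp: norm_Pair)

lemma pn_nonneg: "0 \<le> pn t" by (simp add: pn_def)

text \<open>Prediction \<open>s\<close> is driven by the state handed over at \<open>s\<close> and
  by the data; the factor 2 arises because \<open>pn\<close> bounds the drift and the linear cost
  separately.\<close>

lemma yopt_bound:
  assumes s: "s \<le> t" "t \<le> hor s"
  shows "l2 (\<lambda>\<zeta>. yopt s t (pre \<zeta> t)) \<le> CC L \<alpha> \<gamma> * (b ^ (t - s) * l2 (\<lambda>\<zeta>. fst (policy_at s \<zeta>))
      + 2 * (\<Sum>t'\<le>T. b ^ tdist t t' * pn t'))"
proof -
  have sT: "s \<le> T" using s by simp
  have "l2 (\<lambda>\<zeta>. yopt s t (pre \<zeta> t)) \<le> CC L \<alpha> \<gamma> * (\<Sum>t'=s..hor s. b ^ tdist t t' *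
    (l2 (\<lambda>\<zeta>. ddata s t' (pre \<zeta> t')) + l2 (\<lambda>\<zeta>. (q (pre \<zeta> t' ! t'), r (pre \<zeta> t' ! t')))))"
    using s by (intro decay_estimate[OF yopt_obeys yopt_stationary _ b] sT) auto
  also have "\<dots> \<le> CC L \<alpha> \<gamma> * (\<Sum>t'=s..hor s. (if t' = s then b ^ (t - s) * l2 (\<lambda>\<zeta>. fst (policy_at s \<zeta>)) else 0)
      + b ^ tdist t t' * (2 * pn t'))"
  proof (intro mult_left_mono sum_mono)
    fix t' assume t': "t' \<in> {s..hor s}"
    have "l2 (\<lambda>\<zeta>. ddata s t' (pre \<zeta> t')) \<le> (if t' = s then l2 (\<lambda>\<zeta>. fst (policy_at s \<zeta>)) else 0) + pn t'"
      using pn_ge pn_nonneg by (auto simp: ddata_def yopt_self[OF sT])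
    then have "b ^ tdist t t' * (l2 (\<lambda>\<zeta>. ddata s t' (pre \<zeta> t')) + l2 (\<lambda>\<zeta>. (q (pre \<zeta> t' ! t'), r (pre \<zeta> t' ! t'))))
        \<le> b ^ tdist t t' * ((if t' = s then l2 (\<lambda>\<zeta>. fst (policy_at s \<zeta>)) else 0) + pn t' + pn t')"
      using pn_ge(2)[of t'] b by (intro mult_left_mono add_mono) auto
    also have "\<dots> = (if t' = s then b ^ (t - s) * l2 (\<lambda>\<zeta>. fst (policy_at s \<zeta>)) else 0) + b ^ tdist t t' * (2 * pn t')"
      using s by (simp add: distrib_left tdist_def)
    finally show "b ^ tdist t t' * (l2 (\<lambda>\<zeta>. ddata s t' (pre \<zeta> t')) + l2 (\<lambda>\<zeta>. (q (pre \<zeta> t' ! t'), r (pre \<zeta> t' ! t'))))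
      \<le> (if t' = s then b ^ (t - s) * l2 (\<lambda>\<zeta>. fst (policy_at s \<zeta>)) else 0) + b ^ tdist t t' * (2 * pn t')" .
  qed (use C_ge in simp)
  also have "\<dots> = CC L \<alpha> \<gamma> * (b ^ (t - s) * l2 (\<lambda>\<zeta>. fst (policy_at s \<zeta>)) + 2 * (\<Sum>t'=s..hor s. b ^ tdist t t' * pn t'))"
    using sT by (simp add: sum.distrib sum.delta sum_distrib_left mult.left_commute)
  also have "\<dots> \<le> CC L \<alpha> \<gamma> * (b ^ (t - s) * l2 (\<lambda>\<zeta>. fst (policy_at s \<zeta>)) + 2 * (\<Sum>t'\<le>T. b ^ tdist t t' * pn t'))"
    using C_ge b pn_nonneg by (intro mult_left_mono add_left_mono sum_mono2) auto
  finally show ?thesis .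
qed

text \<open>Consecutive predictions start from the same state and solve the same problem except for the data
  at the end of the horizon, so their difference decays backwards from there.\<close>

lemma yopt_diff_bound:
  assumes s: "s < t" "t \<le> T"
  shows "l2 (\<lambda>\<zeta>. yopt (Suc s) t (pre \<zeta> t) - yopt s t (pre \<zeta> t)) \<le> (if s + W + 1 \<le> T \<and> t \<le> s + W + 1
    then CC L \<alpha> \<gamma> * b ^ (s + W + 1 - t) * (2 * pn (s + W + 1) + 2 * L * l2 (\<lambda>\<zeta>. yopt s (s + W) (pre \<zeta> (s + W)))) else 0)"
proof (cases "t \<le> hor (Suc s)")
  case False
  then have "yopt (Suc s) t h = 0" "yopt s t h = 0" for h by (auto simp: yopt_def)
  then show ?thesis using False s by auto
next
  case tN: True
  define n where "n = hor (Suc s)"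
  have sT: "s \<le> T" "Suc s \<le> T" using s by auto
  \<comment> \<open>Both states at \<open>s + 1\<close> are one step of the true dynamics from the
    decision \<open>policy_at s\<close>.\<close>
  have start: "fst (yopt (Suc s) (Suc s) (pre \<zeta> (Suc s))) = fst (yopt s (Suc s) (pre \<zeta> (Suc s)))" if "\<zeta> \<in> S" for \<zeta>
    using yopt_start[OF that sT(2)] yopt_step[OF that order_refl] sT W_pos
    by (simp add: wprevious_Suc yopt_self)
  have 1: "obeys (Suc s) n (ddata (Suc s)) (yopt (Suc s))"
    "stationary (Suc s) n (\<lambda>t h. q (h ! t)) (\<lambda>t h. r (h ! t)) (yopt (Suc s))"
    unfolding n_def by (rule yopt_obeys[OF sT(2)] yopt_stationary[OF sT(2)])+
  show ?thesis
  proof (cases "s + W + 1 \<le> T")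
    case False
    \<comment> \<open>The old horizon already ends at \<open>T\<close>: both predictions solve the
      same remaining problem, and every datum of their difference is 0.\<close>
    then have Ns: "hor s = n" unfolding n_def by simp
    define D where "D t h = ddata (Suc s) t h - (if t = Suc s then fst (yopt s (Suc s) h) else ddata s t h)" for t h
    have "obeys (Suc s) n (\<lambda>t h. if t = Suc s then fst (yopt s (Suc s) h) else ddata s t h) (yopt s)"
      using yopt_obeys[OF sT(1)] unfolding Ns by (auto simp: obeys_def)
    then have o: "obeys (Suc s) n D (\<lambda>t h. yopt (Suc s) t h - yopt s t h)"
      unfolding D_def by (intro obeys_diff 1)
    have st: "stationary (Suc s) n (\<lambda>t h. q (h ! t) - q (h ! t)) (\<lambda>t h. r (h ! t) - r (h ! t)) (\<lambda>t h. yopt (Suc s) t h - yopt s t h)"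
      using yopt_stationary[OF sT(1)] s tN unfolding Ns
      by (intro stationary_diff 1 stationary_Suc) (auto simp: n_def)
    have "l2 (\<lambda>\<zeta>. yopt (Suc s) t (pre \<zeta> t) - yopt s t (pre \<zeta> t)) \<le> CC L \<alpha> \<gamma> * (\<Sum>t'=Suc s..n. b ^ tdist t t' *
      (l2 (\<lambda>\<zeta>. D t' (pre \<zeta> t')) + l2 (\<lambda>\<zeta>. (q (pre \<zeta> t' ! t') - q (pre \<zeta> t' ! t'), r (pre \<zeta> t' ! t') - r (pre \<zeta> t' ! t')))))"
      using s tN by (intro decay_estimate[OF o st _ b]) (auto simp: n_def)
    also have "\<dots> = 0"
    proof -
      have "l2 (\<lambda>\<zeta>. D t' (pre \<zeta> t')) = l2 (\<lambda>\<zeta>. 0 :: real^'x)" if "Suc s \<le> t'" for t'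
        using that start by (intro l2_cong) (auto simp: D_def ddata_def)
      then show ?thesis by (simp add: zero_prod_def[symmetric])
    qed
    finally show ?thesis using False by simp
  next
    case True
    then have n: "n = Suc (s + W)" "hor s = s + W" "n \<le> T" by (auto simp: n_def)
    \<comment> \<open>At the new end \<open>n\<close> the zero extension of the old prediction obeys
      the dynamics only with the drift \<open>- (A x + B u)\<close> formed from its last stage. The
      mismatch with the true drift is the sole state datum of the difference.\<close>
    define D where "D t h = ddata (Suc s) t h - (if t = Suc s then fst (yopt s (Suc s) h)
        else if t = n then - (A (h ! n) *v fst (yopt s (s + W) (take n h)) + B (h ! n) *v snd (yopt s (s + W) (take n h)))
        else ddata s t h)" for t h
    define qq where "qq t h = (if t = n then 0 else q (h ! t))" for t and h :: "'a list"
    define rr where "rr t h = (if t = n then 0 else r (h ! t))" for t and h :: "'a list"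
    have y0: "yopt s n h = 0" for h using n by (simp add: yopt_def)
    have "obeys (Suc s) n (\<lambda>t h. if t = Suc s then fst (yopt s (Suc s) h)
        else if t = n then - (A (h ! n) *v fst (yopt s (s + W) (take n h)) + B (h ! n) *v snd (yopt s (s + W) (take n h)))
        else ddata s t h) (yopt s)"
      using yopt_obeys[OF sT(1)] W_pos y0 unfolding n(2) by (auto simp: obeys_def n(1) less_Suc_eq)
    then have o: "obeys (Suc s) n D (\<lambda>t h. yopt (Suc s) t h - yopt s t h)"
      unfolding D_def by (intro obeys_diff 1)
    have "stationary s (s + W) qq rr (yopt s)"
      using yopt_stationary[OF sT(1)] unfolding n(2) stationary_def qq_def rr_def n(1) by simp
    then have "stationary s n qq rr (yopt s)"
      unfolding n(1) by (rule stationary_extend) (auto simp: qq_def rr_def n(1) y0[unfolded n(1)])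
    then have st: "stationary (Suc s) n (\<lambda>t h. q (h ! t) - qq t h) (\<lambda>t h. r (h ! t) - rr t h) (\<lambda>t h. yopt (Suc s) t h - yopt s t h)"
      by (intro stationary_diff 1 stationary_Suc) (auto simp: n(1))
    let ?E = "\<lambda>t'. l2 (\<lambda>\<zeta>. D t' (pre \<zeta> t')) + l2 (\<lambda>\<zeta>. (q (pre \<zeta> t' ! t') - qq t' (pre \<zeta> t'), r (pre \<zeta> t' ! t') - rr t' (pre \<zeta> t')))"
    have "l2 (\<lambda>\<zeta>. yopt (Suc s) t (pre \<zeta> t) - yopt s t (pre \<zeta> t)) \<le> CC L \<alpha> \<gamma> * (\<Sum>t'=Suc s..n. b ^ tdist t t' * ?E t')"
      using s tN n by (intro decay_estimate[OF o st _ b]) auto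
    also have "(\<Sum>t'=Suc s..n. b ^ tdist t t' * ?E t') = (\<Sum>t'\<in>{n}. b ^ tdist t t' * ?E t')"
    proof (rule sum.mono_neutral_right)
      show "\<forall>t'\<in>{Suc s..n} - {n}. b ^ tdist t t' * ?E t' = 0"
      proof
        fix t' assume t': "t' \<in> {Suc s..n} - {n}"
        have "l2 (\<lambda>\<zeta>. D t' (pre \<zeta> t')) = l2 (\<lambda>\<zeta>. 0 :: real^'x)"
          using t' start by (intro l2_cong) (auto simp: D_def ddata_def)
        then show "b ^ tdist t t' * ?E t' = 0" using t' by (simp add: qq_def rr_def zero_prod_def[symmetric])
      qed
    qed (use n in auto)
    also have "\<dots> = b ^ (n - t) * ?E n" using tN by (simp add: tdist_def n_def)
    also have "CC L \<alpha> \<gamma> * \<dots> \<le> CC L \<alpha> \<gamma> * (b ^ (n - t) * (2 * pn n + 2 * L * l2 (\<lambda>\<zeta>. yopt s (s + W) (pre \<zeta> (s + W)))))"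
    proof (intro mult_left_mono)
      have "l2 (\<lambda>\<zeta>. D n (pre \<zeta> n)) \<le> l2 (\<lambda>\<zeta>. d (\<zeta> n)) + l2 (\<lambda>\<zeta>. A (\<zeta> n) *v fst (yopt s (s + W) (pre \<zeta> (s + W))) + B (\<zeta> n) *v snd (yopt s (s + W) (pre \<zeta> (s + W))))"
        using n W_pos by (intro order_trans[OF _ l2_add] eq_refl l2_cong) (simp add: D_def ddata_def)
      also have "\<dots> \<le> pn n + 2 * L * l2 (\<lambda>\<zeta>. yopt s (s + W) (pre \<zeta> (s + W)))"
      proof (intro add_mono pn_ge l2_scale)
        fix \<zeta> assume \<zeta>: "\<zeta> \<in> S"
        let ?y = "yopt s (s + W) (pre \<zeta> (s + W))"
        have "norm (A (\<zeta> n) *v fst ?y + B (\<zeta> n) *v snd ?y) \<le> L * norm (fst ?y) + L * norm (snd ?y)"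
          using A_bound[OF \<zeta> n(3)] B_bound[OF \<zeta> n(3)] by (intro norm_triangle_mono norm_mult_vec_le)
        also have "\<dots> \<le> L * norm ?y + L * norm ?y"
          using L_ge norm_components_le[of ?y] by (intro add_mono mult_left_mono) auto
        finally show "norm (A (\<zeta> n) *v fst ?y + B (\<zeta> n) *v snd ?y) \<le> 2 * L * norm ?y" by simp
      qed (use L_ge in simp)
      finally show "?E n \<le> 2 * pn n + 2 * L * l2 (\<lambda>\<zeta>. yopt s (s + W) (pre \<zeta> (s + W)))"
        using pn_ge(2)[of n] by (simp add: qq_def rr_def)
    qed (use b C_ge in auto)
    finally show ?thesis using True tN n by (simp add: mult.assoc)
  qed
qed

lemma l2_fst: "l2 (\<lambda>\<zeta>. fst (F \<zeta>)) \<le> l2 F"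
  by (rule l2_mono) (rule norm_components_le)

section \<open>Assembling the closed-loop bound\<close>

lemma sum_m: "sum m S = 1"
proof -
  have "set_pmf (cond_pmf P {\<zeta>. \<zeta> 0 = xi0}) = S"
    using S_nonempty by (subst set_cond_pmf) (auto simp: S_eq)
  then show ?thesis unfolding m_eq using finite_S by (intro sum_pmf_eq_1) auto
qed

lemma initial_state: "l2 (\<lambda>\<zeta>. fst (policy_at 0 \<zeta>)) \<le> 2 * L * norm wbar + pn 0"
proof -
  have "l2 (\<lambda>\<zeta>. fst (policy_at 0 \<zeta>)) = l2 (\<lambda>\<zeta>. (A (\<zeta> 0) *v fst wbar + B (\<zeta> 0) *v snd wbar) + d (\<zeta> 0))"
    using yopt_start[of _ 0] by (intro l2_cong) (simp add: yopt_self[symmetric] dyn_def wprevious_def del: spc.simps)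
  also have "\<dots> \<le> l2 (\<lambda>\<zeta>. A (\<zeta> 0) *v fst wbar + B (\<zeta> 0) *v snd wbar) + l2 (\<lambda>\<zeta>. d (\<zeta> 0))" by (rule l2_add)
  also have "\<dots> \<le> 2 * L * l2 (\<lambda>\<zeta>. wbar) + pn 0"
  proof (intro add_mono pn_ge l2_scale)
    fix \<zeta> assume \<zeta>: "\<zeta> \<in> S"
    have "norm (A (\<zeta> 0) *v fst wbar + B (\<zeta> 0) *v snd wbar) \<le> L * norm (fst wbar) + L * norm (snd wbar)"
      using A_bound[OF \<zeta>] B_bound[OF \<zeta>] by (intro norm_triangle_mono norm_mult_vec_le) auto
    also have "\<dots> \<le> L * norm wbar + L * norm wbar"
      using L_ge norm_components_le[of wbar] by (intro add_mono mult_left_mono) auto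
    finally show "norm (A (\<zeta> 0) *v fst wbar + B (\<zeta> 0) *v snd wbar) \<le> 2 * L * norm wbar" by simp
  qed (use L_ge in simp)
  also have "l2 (\<lambda>\<zeta>. wbar) = norm wbar"
  proof -
    have "(l2 (\<lambda>\<zeta>. wbar))\<^sup>2 = (norm wbar)\<^sup>2" unfolding l2_sq by (simp add: sum_m flip: sum_distrib_right)
    then show ?thesis by simp
  qed
  finally show ?thesis by simp
qed

theorem policy_bound:
  assumes kap: "1/2 \<le> \<kappa>" "\<kappa> < 1" "b = \<kappa> ^ 6"
    and c: "13 * L * (CC L \<alpha> \<gamma>)\<^sup>2 / (1 - \<kappa>) \<le> c / 2" "2 * L * (CC L \<alpha> \<gamma>)\<^sup>2 * \<kappa> ^ (4 * W) / (1 - \<kappa>) \<le> 1 / 2"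
    and t: "t \<le> T"
  shows "l2 (policy_at t) \<le> c * (2 * L * \<kappa> ^ t * norm wbar + (\<Sum>t'\<le>T. \<kappa> ^ tdist t t' * pn t'))"
proof (rule closed_loop_recursion[OF kap C_ge L_ge W_pos pn_nonneg norm_ge_zero c _ _ yopt_diff_bound _ t])
  fix t assume t: "t \<le> T"
  have tel: "yopt 0 t h + (\<Sum>s<t. yopt (Suc s) t h - yopt s t h) = yopt t t h" for h
    using sum_lessThan_telescope[of "\<lambda>s. yopt s t h" t] by simp
  have "l2 (policy_at t) = l2 (\<lambda>\<zeta>. yopt 0 t (pre \<zeta> t) + (\<Sum>s<t. yopt (Suc s) t (pre \<zeta> t) - yopt s t (pre \<zeta> t)))"
    by (simp add: tel yopt_self[OF t])
  also have "\<dots> \<le> l2 (\<lambda>\<zeta>. yopt 0 t (pre \<zeta> t)) + (\<Sum>s<t. l2 (\<lambda>\<zeta>. yopt (Suc s) t (pre \<zeta> t) - yopt s t (pre \<zeta> t)))"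
    by (intro order_trans[OF l2_add] add_left_mono l2_sum)
  finally show "l2 (policy_at t) \<le> l2 (\<lambda>\<zeta>. yopt 0 t (pre \<zeta> t)) + (\<Sum>s<t. l2 (\<lambda>\<zeta>. yopt (Suc s) t (pre \<zeta> t) - yopt s t (pre \<zeta> t)))" .
  show "l2 (\<lambda>\<zeta>. yopt 0 t (pre \<zeta> t)) \<le> CC L \<alpha> \<gamma> * (b ^ t * (2 * L * norm wbar + pn 0) + 2 * (\<Sum>t'\<le>T. b ^ tdist t t' * pn t'))"
  proof (cases "t \<le> hor 0")
    case True
    then have "l2 (\<lambda>\<zeta>. yopt 0 t (pre \<zeta> t)) \<le> CC L \<alpha> \<gamma> * (b ^ t * l2 (\<lambda>\<zeta>. fst (policy_at 0 \<zeta>)) + 2 * (\<Sum>t'\<le>T. b ^ tdist t t' * pn t'))"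
      using yopt_bound[of 0 t] by simp
    also have "\<dots> \<le> CC L \<alpha> \<gamma> * (b ^ t * (2 * L * norm wbar + pn 0) + 2 * (\<Sum>t'\<le>T. b ^ tdist t t' * pn t'))"
      using initial_state C_ge b by (intro mult_left_mono add_right_mono) auto
    finally show ?thesis .
  next
    case False
    \<comment> \<open>Past the first horizon prediction 0 has its default value 0, and the bound
      reduces to nonnegativity.\<close>
    then have "yopt 0 t h = 0" for h unfolding yopt_def by (simp only: if_False)
    then have "l2 (\<lambda>\<zeta>. yopt 0 t (pre \<zeta> t)) = 0" by simp
    also have "0 \<le> CC L \<alpha> \<gamma> * (b ^ t * (2 * L * norm wbar + pn 0) + 2 * (\<Sum>t'\<le>T. b ^ tdist t t' * pn t'))"
      using C_ge b L_ge pn_nonneg by (intro mult_nonneg_nonneg add_nonneg_nonneg sum_nonneg) auto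
    finally show ?thesis .
  qed
next
  fix s assume s: "s + W + 1 \<le> T"
  have "l2 (\<lambda>\<zeta>. yopt s (s + W) (pre \<zeta> (s + W))) \<le> CC L \<alpha> \<gamma> * (b ^ W * l2 (\<lambda>\<zeta>. fst (policy_at s \<zeta>)) + 2 * (\<Sum>t'\<le>T. b ^ tdist (s + W) t' * pn t'))"
    using yopt_bound[of s "s + W"] s by simp
  also have "\<dots> \<le> CC L \<alpha> \<gamma> * (b ^ W * l2 (policy_at s) + 2 * (\<Sum>t'\<le>T. b ^ tdist (s + W) t' * pn t'))"
    using C_ge b l2_fst by (intro mult_left_mono add_right_mono) auto
  finally show "l2 (\<lambda>\<zeta>. yopt s (s + W) (pre \<zeta> (s + W))) \<le> CC L \<alpha> \<gamma> * (b ^ W * l2 (policy_at s) + 2 * (\<Sum>t'\<le>T. b ^ tdist (s + W) t' * pn t'))" .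
qed auto

lemma expectation_eq_l2:
  "sqrt (measure_pmf.expectation (cond_pmf P {\<zeta>. \<zeta> 0 = xi0}) (\<lambda>\<zeta>. (norm (F \<zeta>))\<^sup>2)) = l2 F"
proof -
  have "set_pmf (cond_pmf P {\<zeta>. \<zeta> 0 = xi0}) = S"
    using S_nonempty by (subst set_cond_pmf) (auto simp: S_eq)
  then have "measure_pmf.expectation (cond_pmf P {\<zeta>. \<zeta> 0 = xi0}) (\<lambda>\<zeta>. (norm (F \<zeta>))\<^sup>2) = (l2 F)\<^sup>2"
    unfolding l2_sq m_eq by (subst integral_measure_pmf_real[OF finite_S]) (auto simp: mult.commute)
  then show ?thesis by simp
qed

end

theorem theorem2:
  fixes P :: "(nat \<Rightarrow> 'a) pmf" and T :: nat
    and A :: "'a \<Rightarrow> real^'x^'x" and B :: "'a \<Rightarrow> real^'u^'x" and d :: "'a \<Rightarrow> real^'x"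
    and Q :: "'a \<Rightarrow> real^'x^'x" and R :: "'a \<Rightarrow> real^'u^'u"
    and q :: "'a \<Rightarrow> real^'x" and r :: "'a \<Rightarrow> real^'u"
    and L \<alpha> \<gamma> :: real and xi0 :: 'a and wbar :: "(real^'x) \<times> (real^'u)" and W :: nat
  assumes T_pos: "0 < T"
    and Q_sym: "\<forall>\<xi>. transpose (Q \<xi>) = Q \<xi>"
    and R_sym: "\<forall>\<xi>. transpose (R \<xi>) = R \<xi>"
    and A1: "finite (set_pmf P)"
    and L_ge: "1 \<le> L" and alpha: "0 < \<alpha>" "\<alpha> < 1" and gamma: "0 < \<gamma>" "\<gamma> \<le> 1"
    and A2a: "\<forall>\<zeta>\<in>set_pmf P. \<forall>t\<le>T. mnorm (A (\<zeta> t)) \<le> L \<and> mnorm (B (\<zeta> t)) \<le> L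
                 \<and> mnorm (Q (\<zeta> t)) \<le> L \<and> mnorm (R (\<zeta> t)) \<le> L"
    and A2b: "\<forall>\<zeta>\<in>set_pmf P. \<forall>t\<le>T. psd (Q (\<zeta> t)) \<and> psd (R (\<zeta> t) - \<gamma> *\<^sub>R mat 1)"
    and A2c: "stabilizable P T L \<alpha> A B"
    and A2d: "detectable P T L \<alpha> A (\<lambda>\<xi>. msqrt (Q \<xi>))"
    and xi0: "xi0 \<in> (\<lambda>\<zeta>. \<zeta> 0) ` set_pmf P"
    and W: "W_bar L \<alpha> \<gamma> \<le> real W"
  shows "\<forall>t\<le>T.
    sqrt (measure_pmf.expectation (cond_pmf P {\<zeta>. \<zeta> 0 = xi0})
            (\<lambda>\<zeta>. (norm (spc P T A B d Q R q r W wbar t \<zeta>))^2))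
    \<le> c2 L \<alpha> \<gamma> * (2 * L * rho_c L \<alpha> \<gamma> powr (real t / 2) * norm wbar
        + (\<Sum>t'\<le>T. rho_c L \<alpha> \<gamma> powr (\<bar>real t - real t'\<bar> / 2) *
            sqrt (measure_pmf.expectation (cond_pmf P {\<zeta>. \<zeta> 0 = xi0})
                    (\<lambda>\<zeta>. (norm (q (\<zeta> t'), r (\<zeta> t'), d (\<zeta> t')))^2))))"
proof -
  obtain K :: "nat \<Rightarrow> 'a list \<Rightarrow> real^'x^'u" where K: "\<And>\<zeta> t. \<zeta> \<in> set_pmf P \<Longrightarrow> t < T \<Longrightarrow> mnorm (K t (pre \<zeta> t)) \<le> L"
    and stab: "stable P T L \<alpha> (\<lambda>t h. A (h ! t) - B (h ! t) ** K (t - 1) (take t h))"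
    using A2c unfolding stabilizable_def by blast
  obtain Kd :: "nat \<Rightarrow> 'a list \<Rightarrow> real^'x^'x" where Kd: "\<And>\<zeta> t. \<zeta> \<in> set_pmf P \<Longrightarrow> 1 \<le> t \<Longrightarrow> t \<le> T \<Longrightarrow> mnorm (Kd t (pre \<zeta> t)) \<le> L"
    and det: "stable P T L \<alpha> (\<lambda>t h. A (h ! t) - Kd t h ** msqrt (Q (h ! (t - 1))))"
    using A2d unfolding detectable_def by blast
  \<comment> \<open>Gains are given before \<open>T\<close> only. Extension by 0 meets the bound
    that \<open>lq_path\<close> asks at \<open>T\<close>, and products up to \<open>T\<close> read
    gains at times before \<open>T\<close>, where nothing changes.\<close>
  define K' where "K' t h = (if t < T then K t h else 0)" for t h
  define S where "S = {\<zeta> \<in> set_pmf P. \<zeta> 0 = xi0}"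
  define m where "m = pmf (cond_pmf P {\<zeta>. \<zeta> 0 = xi0})"
  let ?\<kappa> = "sqrt (rho_c L \<alpha> \<gamma>)"
  have R_pos: "\<gamma> * (norm v)\<^sup>2 \<le> v \<bullet> (R (\<zeta> t) *v v)" if "\<zeta> \<in> set_pmf P" "t \<le> T" for \<zeta> t v
  proof -
    have "0 \<le> v \<bullet> ((R (\<zeta> t) - \<gamma> *\<^sub>R mat 1) *v v)" using A2b that unfolding psd_def by blast
    also have "(R (\<zeta> t) - \<gamma> *\<^sub>R mat 1) *v v = R (\<zeta> t) *v v - \<gamma> *\<^sub>R v"
      by (simp add: matrix_vector_mult_diff_rdistrib scaleR_matrix_vector_assoc[symmetric])
    finally show ?thesis by (simp add: inner_diff_right power2_norm_eq_inner)
  qed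
  have pathI: "lq_path (\<lambda>t. A (\<zeta> t)) (\<lambda>t. B (\<zeta> t)) (\<lambda>t. Q (\<zeta> t)) (\<lambda>t. R (\<zeta> t))
      (\<lambda>t. K' t (pre \<zeta> t)) (\<lambda>t. Kd t (pre \<zeta> t)) (\<lambda>t. msqrt (Q (\<zeta> t))) T L \<alpha> \<gamma>" if \<zeta>: "\<zeta> \<in> set_pmf P" for \<zeta>
  proof
    show "mnorm (K' t (pre \<zeta> t)) \<le> L" if "t \<le> T" for t
      using K[OF \<zeta>, of t] L_ge by (auto simp: K'_def mnorm_def onorm_zero)
    show "(norm (msqrt (Q (\<zeta> t)) *v x))\<^sup>2 = x \<bullet> (Q (\<zeta> t) *v x)" if "t \<le> T" for t x
      using A2b \<zeta> that by (intro norm_msqrt_mult) blast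
    fix t' t assume t: "t' < t" "t \<le> T"
    have "tprod (\<lambda>t. A (\<zeta> t) - B (\<zeta> t) ** K' (t - 1) (pre \<zeta> (t - 1))) t' t
        = tprod (\<lambda>t. A (pre \<zeta> t ! t) - B (pre \<zeta> t ! t) ** K (t - 1) (take t (pre \<zeta> t))) t' t"
    proof (rule tprod_cong)
      fix i assume "0 < i" "i \<le> t"
      then show "A (\<zeta> i) - B (\<zeta> i) ** K' (i - 1) (pre \<zeta> (i - 1)) = A (pre \<zeta> i ! i) - B (pre \<zeta> i ! i) ** K (i - 1) (take i (pre \<zeta> i))"
        using t by (cases i) (auto simp: K'_def)
    qed
    then show "mnorm (tprod (\<lambda>t. A (\<zeta> t) - B (\<zeta> t) ** K' (t - 1) (pre \<zeta> (t - 1))) t' t) \<le> L * \<alpha> ^ (t - t')"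
      using stab \<zeta> t unfolding stable_def by simp
    show "mnorm (tprod (\<lambda>t. A (\<zeta> t) - Kd t (pre \<zeta> t) ** msqrt (Q (\<zeta> (t - 1)))) t' t) \<le> L * \<alpha> ^ (t - t')"
      using det \<zeta> t unfolding stable_def by simp
  qed (use L_ge alpha gamma A2a Kd R_pos \<zeta> in auto)
  have C: "1 \<le> CC L \<alpha> \<gamma>" using xi0 pathI lq_path.C_ge(2) by blast
  \<comment> \<open>The decay rate is fixed here as \<open>\<kappa> ^ 6 = \<rho> ^ 3\<close>, while
    the claim is read with base \<kappa> through
    \<open>\<rho> powr (n / 2) = \<kappa> ^ n\<close>.\<close>
  interpret spc_loop P T A B d Q R q r \<gamma> S m K' Kd L \<alpha> xi0 wbar W "?\<kappa> ^ 6"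
  proof (intro spc_loop.intro stoch_lq.intro lq_tree.intro spc_loop_axioms.intro)
    show "S \<noteq> {}" using xi0 by (auto simp: S_def)
    show "0 < m \<zeta>" if "\<zeta> \<in> S" for \<zeta>
      using that xi0 unfolding m_def pmf_positive_iff by (subst set_cond_pmf) (auto simp: S_def)
    show "0 < ?\<kappa> ^ 6" using rho_bounds[OF L_ge alpha gamma] by simp
    show "?\<kappa> ^ 6 < 1" using rho_bounds[OF L_ge alpha gamma] by (simp add: power_less_one_iff)
    show "1 \<le> W" by (rule horizon_pos[OF L_ge alpha gamma W])
    show "1 \<le> (1 + 1 / CC L \<alpha> \<gamma>) * (?\<kappa> ^ 6)\<^sup>2" by (rule weight_ratio[OF L_ge alpha gamma C])
  qed (use A1 Q_sym R_sym A2a A2b R_pos gamma pathI in \<open>auto simp: S_def m_def psd_def\<close>)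
  have kp: "rho_c L \<alpha> \<gamma> powr (real n / 2) = ?\<kappa> ^ n" for n
  proof -
    have "rho_c L \<alpha> \<gamma> powr (real n / 2) = (rho_c L \<alpha> \<gamma> powr (1/2)) powr real n" by (simp add: powr_powr)
    also have "\<dots> = ?\<kappa> ^ n" using rho_bounds[OF L_ge alpha gamma] by (simp add: powr_half_sqrt powr_realpow)
    finally show ?thesis .
  qed
  have ab: "\<bar>real t - real t'\<bar> = real (tdist t t')" for t t' by (simp add: tdist_def)
  note kap = kappa_bounds(1,2)[OF L_ge alpha gamma]
  show ?thesis
    unfolding expectation_eq_l2 ab kp
    using policy_bound[OF kap refl loop_constants[OF L_ge alpha gamma C W]]
    unfolding pn_def by blast
qed

end
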